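(* If $\mu\in\mathcal{R}$, then $\sharp_\mu=T_\mu\mathcal{R}$. If $\mu\in G\setminus\mathcal{R}$, then the geodesic $D$ through $\mu$ with direction $\sharp_\mu$ (that is, with $T_\mu D=\sharp_\mu$) is purely balanced.
   Context: $\mathbb{D}$ is the open unit disc and $\mathbb{T}$ the unit circle in $\mathbb{C}$. $G=\{(z+w,zw): |z|<1,|w|<1\}\subset\mathbb{C}^2$ is the symmetrized bidisc. The royal variety is $\mathcal{R}=\{(2z,z^2):z\in\mathbb{D}\}$, and $\partial\mathcal{R}=\{(2z,z^2):z\in\mathbb{T}\}$. A geodesic (that is, complex geodesic) in $G$ is a set $D=h(\mathbb{D})$ where $h:\mathbb{D}\to G$ is holomorphic and has a holomorphic left inverse $\Phi:G\to\mathbb{D}$, $\Phi\circ h=\mathrm{id}_{\mathbb{D}}$. If $\lambda=h(z)\in D$, the complex tangent space is $T_\lambda D=\mathbb{C}\,h'(z)\subset\mathbb{C}^2$. $\mathcal{R}$ is itself a geodesic. It is known that for every $\lambda\in G$ and every one-dimensional complex subspace $\mathcal{M}$ of $\mathbb{C}^2$ there is a unique geodesic $D$ with $\lambda\in D$ and $T_\lambda D=\mathcal{M}$. A geodesic $D$ is purely balanced if $D^-\cap\mathcal{R}^-$ (closures in $\mathbb{C}^2$) consists of exactly two points, both in $\partial\mathcal{R}$. Sharp direction: let $\mathrm{Orb}(\lambda)$ be the orbit of $\lambda\in G$ under the group $\mathrm{Aut}\,G$ of biholomorphic self-maps of $G$. It is known that $\mathrm{Orb}(\lambda)=\mathcal{R}$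 if $\lambda\in\mathcal{R}$, and $\mathrm{Orb}(\lambda)$ is a smooth properly embedded real 3-dimensional submanifold of $G$ if $\lambda\notin\mathcal{R}$. In both cases the real tangent space to $\mathrm{Orb}(\lambda)$ at $\lambda$ contains a unique one-dimensional complex subspace of $\mathbb{C}^2$, denoted $\sharp_\lambda$. *)

theory Defs
  imports "HOL-Analysis.Analysis"
begin

abbreviation disc :: "complex set"  ("\<bbbD>") where
  "\<bbbD> \<equiv> ball 0 1"

definition symm_bidisc :: "(complex^2) set" where
  "symm_bidisc = {vector [z + w, z * w] | z w. cmod z < 1 \<and> cmod w < 1}"

definition royal :: "(complex^2) set" where
  "royal = {vector [2 * z, z\<^sup>2] | z. z \<in> \<bbbD>}"

definition royal_boundary :: "(complex^2) set" where
  "royal_boundary = {vector [2 * z, z\<^sup>2] | z. cmod z = 1}"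

text \<open>Holomorphy of functions of several complex variables on an open set: the real Frechet
  derivative exists at every point and is complex linear.\<close>

definition holomorphic_cvec :: "(complex^'n \<Rightarrow> complex) \<Rightarrow> (complex^'n) set \<Rightarrow> bool" where
  "holomorphic_cvec f S \<longleftrightarrow>
     (\<forall>x\<in>S. \<exists>L. (f has_derivative L) (at x within S) \<and> Vector_Spaces.linear (*s) (*) L)"

definition holomorphic_map :: "(complex^'n \<Rightarrow> complex^'m) \<Rightarrow> (complex^'n) set \<Rightarrow> bool" where
  "holomorphic_map f S \<longleftrightarrow> (\<forall>i. holomorphic_cvec (\<lambda>x. f x $ i) S)"


definition geodesic_map :: "(complex \<Rightarrow> complex^2) \<Rightarrow> bool" where
  "geodesic_map h \<longleftrightarrow>
     (\<forall>i. (\<lambda>z. h z $ i) holomorphic_on \<bbbD>) \<and> h ` \<bbbD> \<subseteq> symm_bidisc \<and>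
     (\<exists>\<Phi>. holomorphic_cvec \<Phi> symm_bidisc \<and> \<Phi> ` symm_bidisc \<subseteq> \<bbbD> \<and> (\<forall>z\<in>\<bbbD>. \<Phi> (h z) = z))"

definition geodesic :: "(complex^2) set \<Rightarrow> bool" where
  "geodesic D \<longleftrightarrow> (\<exists>h. geodesic_map h \<and> D = h ` \<bbbD>)"

text \<open>The line spanned by the derivative does not depend on the parametrization: two geodesic
  maps with the same image differ by an automorphism of the disc.\<close>

definition geodesic_tangent :: "(complex^2) set \<Rightarrow> complex^2 \<Rightarrow> (complex^2) set" where
  "geodesic_tangent D x =
     (THE M. \<exists>h z. geodesic_map h \<and> D = h ` \<bbbD> \<and> z \<in> \<bbbD> \<and> x = h z \<and>
        M = range (\<lambda>c. c *s (\<chi> i. deriv (\<lambda>\<zeta>. h \<zeta> $ i) z)))"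

definition geodesic_through :: "complex^2 \<Rightarrow> (complex^2) set \<Rightarrow> (complex^2) set" where
  "geodesic_through x M = (THE D. geodesic D \<and> x \<in> D \<and> geodesic_tangent D x = M)"

definition purely_balanced :: "(complex^2) set \<Rightarrow> bool" where
  "purely_balanced D \<longleftrightarrow>
     geodesic D \<and> card (closure D \<inter> closure royal) = 2 \<and> closure D \<inter> closure royal \<subseteq> royal_boundary"


text \<open>Automorphisms are represented by total functions; only their values on the symmetrized
  bidisc matter.\<close>

definition Aut_G :: "(complex^2 \<Rightarrow> complex^2) set" where
  "Aut_G = {f. bij_betw f symm_bidisc symm_bidisc \<and> holomorphic_map f symm_bidisc \<and>
               holomorphic_map (inv_into symm_bidisc f) symm_bidisc}"

definition Orb :: "complex^2 \<Rightarrow> (complex^2) set" where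
  "Orb x = {f x | f. f \<in> Aut_G}"

text \<open>Velocities at \<open>x\<close> of continuously differentiable curves lying in \<open>S\<close>. If \<open>S\<close> is an
  embedded submanifold this is its real tangent space at \<open>x\<close>.\<close>

definition real_tangent_space :: "'a::real_normed_vector set \<Rightarrow> 'a \<Rightarrow> 'a set" where
  "real_tangent_space S x =
     {v. \<exists>\<gamma> e. e > 0 \<and> \<gamma> C1_differentiable_on {-e<..<e} \<and> \<gamma> ` {-e<..<e} \<subseteq> S \<and>
           \<gamma> 0 = x \<and> (\<gamma> has_vector_derivative v) (at 0)}"

definition sharp :: "complex^2 \<Rightarrow> (complex^2) set" where
  "sharp x = (THE M. vec.subspace M \<and> vec.dim M = 1 \<and> M \<subseteq> real_tangent_space (Orb x) x)"

end

theory Submission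
  imports Defs "HOL-Complex_Analysis.Conformal_Mappings"
begin

text \<open>A Moebius map \<open>m\<close> of the disc acts on the symmetrized bidisc by
  \<open>(z + w, z w) \<mapsto> (m z + m w, m z m w)\<close>. Moving the hyperbolic midpoint of \<open>z, w\<close> to the origin
  and rotating, every point is carried to some \<open>(0, -r)\<close> with \<open>0 \<le> r < 1\<close>, and \<open>r = 0\<close> exactly
  on the royal variety (\<open>normal_form\<close>). Orbits, sharp directions, geodesics and pure balance are
  all transported by such maps, so off the royal variety only \<open>x = (0, -r)\<close> with \<open>0 < r < 1\<close> has
  to be studied.

  The Moebius maps alone make the tangent space of the orbit of \<open>x\<close> contain the line \<open>\<complex> \<times> {0}\<close>.
  For this to be the only complex line the orbit must not be larger, so all automorphisms have
  to be controlled. The royal variety is invariant: at the origin the Caratheodory metric is the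
  \<open>l1\<close> norm \<open>|ds|/2 + |dp|\<close>. If an automorphism took \<open>x\<close> to the origin, its derivative would
  carry the directions \<open>(1,0)\<close> and \<open>(0,1)\<close>, each of which has two independent extremal functions
  at \<open>x\<close>, to directions of the same kind, that is to the coordinate axes; the metric at \<open>x\<close>
  would then be an \<open>l1\<close> norm in the coordinates \<open>ds, dp\<close>, and an explicit disc \<open>(m + n, m n)\<close>
  with Moebius maps \<open>m, n\<close> is too long for that (\<open>no_aut_to_origin\<close>). The number \<open>r\<close> is
  invariant: by Schwarz's lemma the supremum of \<open>|f (0, -r)|\<close>, over the \<open>f\<close> bounded by 1 that
  vanish on the royal variety, increases strictly with \<open>r\<close>. Hence the orbit of \<open>x\<close> lies in the
  real hypersurface \<open>|s\<^sup>2 - 4 p| (1 + r\<^sup>2) = 2 r (2 + 2 |p|\<^sup>2 - |s|\<^sup>2)\<close>, whose tangent vectors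
  at \<open>x\<close> satisfy \<open>Re dp = 0\<close>, and \<open>\<complex> \<times> {0}\<close> is the sharp direction.

  The geodesic through \<open>x\<close> in this direction is \<open>h z = (2 (1 - r) z, z\<^sup>2 - r) / (1 - r z\<^sup>2)\<close>.
  The functions \<open>\<Phi>\<^sub>\<omega> (s, p) = (2 \<omega> p - s) / (2 - \<omega> s)\<close> with \<open>\<omega> = 1\<close> and \<open>\<omega> = -1\<close> are both
  Moebius maps along \<open>h\<close>. By Schwarz's lemma they are the same two Moebius maps, up to a common
  rotation of the parameter, along every geodesic with this point and direction, and their two
  values determine a point, so \<open>h\<close> is the only one. Finally
  \<open>s\<^sup>2 - 4 p = 4 r (z\<^sup>2 - 1)\<^sup>2 / (1 - r z\<^sup>2)\<^sup>2\<close> along \<open>h\<close>, so its closure meets the closed royal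
  variety exactly at the boundary points \<open>z = 1\<close> and \<open>z = -1\<close>.\<close>

section \<open>The symmetrized bidisc and the magic functions\<close>

definition symm :: "complex \<Rightarrow> complex \<Rightarrow> complex^2" where
  "symm z w = vector [z + w, z * w]"

lemma symm_nth [simp]: "symm z w $ 1 = z + w" "symm z w $ 2 = z * w"
  by (simp_all add: symm_def)

lemma vec2_eqI: "x $ 1 = y $ 1 \<Longrightarrow> x $ 2 = y $ 2 \<Longrightarrow> x = (y :: 'a^2)"
  by (simp add: vec_eq_iff forall_2)

lemma ex_symm: "\<exists>z w. x = symm z w"
proof (intro exI)
  define d where "d = csqrt ((x$1)\<^sup>2 - 4 * x$2)"
  have "d\<^sup>2 = (x$1)\<^sup>2 - 4 * x$2" by (simp add: d_def)
  then have "(x$1 + d) * (x$1 - d) = 4 * x$2" by (simp add: algebra_simps power2_eq_square)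
  then show "x = symm ((x$1 + d) / 2) ((x$1 - d) / 2)"
    by (intro vec2_eqI) (simp_all add: field_simps)
qed

lemma mem_symm_bidisc: "x \<in> symm_bidisc \<longleftrightarrow> (\<exists>z w. cmod z < 1 \<and> cmod w < 1 \<and> x = symm z w)"
  unfolding symm_bidisc_def symm_def by blast

lemma symm_mem: "cmod z < 1 \<Longrightarrow> cmod w < 1 \<Longrightarrow> symm z w \<in> symm_bidisc"
  unfolding mem_symm_bidisc by blast

text \<open>Let \<open>a = |z|\<close>, \<open>b = |w|\<close> and \<open>E = a (1 - b\<^sup>2) + b (1 - a\<^sup>2)\<close>. For \<open>a, b < 1\<close> the triangle
  inequality bounds the modulus of this quantity by \<open>E\<close> from above, for \<open>b < 1 \<le> a\<close> it bounds it
  by \<open>E\<close> from below, and \<open>1 - a\<^sup>2 b\<^sup>2 - E = (1 - a) (1 - b) (1 - a b)\<close> has the corresponding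
  sign.\<close>
lemma symm_defect:
  fixes z w :: complex
  shows "(z + w) - cnj (z + w) * (z * w) =
    z * of_real (1 - (cmod w)\<^sup>2) + w * of_real (1 - (cmod z)\<^sup>2)"
  by (simp only: of_real_diff complex_norm_square of_real_1) (simp add: algebra_simps)

text \<open>Membership in terms of \<open>s\<close> and \<open>p\<close> alone, free of the roots \<open>z, w\<close>. It shows that the domain is
  open and is how explicit discs are seen to lie in it.\<close>
lemma symm_bidisc_iff:
  "x \<in> symm_bidisc \<longleftrightarrow> cmod (x$1 - cnj (x$1) * x$2) < 1 - (cmod (x$2))\<^sup>2"
proof
  have fac: "1 - (a * b)\<^sup>2 - (a * (1 - b\<^sup>2) + b * (1 - a\<^sup>2)) = (1 - a) * (1 - b) * (1 - a * b)"
    for a b :: real by algebra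
  {
    assume "x \<in> symm_bidisc"
    then obtain z w where x: "x = symm z w" and z: "cmod z < 1" and w: "cmod w < 1"
      by (auto simp: mem_symm_bidisc)
    define a b where "a = cmod z" and "b = cmod w"
    have ab: "0 \<le> a" "a < 1" "0 \<le> b" "b < 1" using z w by (auto simp: a_def b_def)
    have "a * b \<le> a" using ab by (simp add: mult_left_le)
    then have "a * b < 1" using ab by linarith
    then have pos: "0 < (1 - a) * (1 - b) * (1 - a * b)" using ab by simp
    have "a\<^sup>2 \<le> 1" "b\<^sup>2 \<le> 1" using ab by (simp_all add: power_le_one)
    then have "cmod (z * of_real (1 - b\<^sup>2)) = a * (1 - b\<^sup>2)" "cmod (w * of_real (1 - a\<^sup>2)) = b * (1 - a\<^sup>2)"
      by (simp_all only: norm_mult norm_of_real a_def[symmetric] b_def[symmetric])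
    then have "cmod (z * of_real (1 - b\<^sup>2) + w * of_real (1 - a\<^sup>2)) \<le> a * (1 - b\<^sup>2) + b * (1 - a\<^sup>2)"
      using norm_triangle_ineq[of "z * of_real (1 - b\<^sup>2)" "w * of_real (1 - a\<^sup>2)"] by linarith
    also have "\<dots> < 1 - (a * b)\<^sup>2" using fac[of a b] pos by linarith
    finally show "cmod (x$1 - cnj (x$1) * x$2) < 1 - (cmod (x$2))\<^sup>2"
      using symm_defect[of z w] by (simp add: x a_def b_def norm_mult)
  }
  assume lt: "cmod (x$1 - cnj (x$1) * x$2) < 1 - (cmod (x$2))\<^sup>2"
  have key: "cmod z < 1" if x: "x = symm z w" for z w
  proof (rule ccontr)
    define a b where "a = cmod z" and "b = cmod w"
    assume "\<not> cmod z < 1"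
    then have a: "1 \<le> a" by (simp add: a_def)
    have b0: "0 \<le> b" by (simp add: b_def)
    have "(a * b)\<^sup>2 < 1"
      using le_less_trans[OF norm_ge_zero lt] by (simp add: x norm_mult a_def b_def)
    then have ab: "a * b < 1" using a b0 by (simp add: abs_square_less_1)
    have "b \<le> a * b" using a b0 by (simp add: mult_le_cancel_right1)
    then have b: "b < 1" using ab by linarith
    have "1 \<le> a\<^sup>2" "b\<^sup>2 \<le> 1" using a b b0 by (simp_all add: one_le_power power_le_one)
    then have n: "cmod (z * of_real (1 - b\<^sup>2)) = a * (1 - b\<^sup>2)" "cmod (w * of_real (1 - a\<^sup>2)) = b * (a\<^sup>2 - 1)"
      by (simp_all only: norm_mult norm_of_real a_def[symmetric] b_def[symmetric]) simp_all
    have "a * (1 - b\<^sup>2) - b * (a\<^sup>2 - 1) \<le> cmod (z * of_real (1 - b\<^sup>2) + w * of_real (1 - a\<^sup>2))"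
      using norm_diff_ineq[of "z * of_real (1 - b\<^sup>2)" "w * of_real (1 - a\<^sup>2)"] n by linarith
    moreover have "(1 - a) * (1 - b) * (1 - a * b) \<le> 0"
      using a b ab by (simp add: mult_nonpos_nonneg)
    then have "1 - (a * b)\<^sup>2 \<le> a * (1 - b\<^sup>2) - b * (a\<^sup>2 - 1)" using fac[of a b]
      by (simp add: algebra_simps)
    moreover have "cmod (z * of_real (1 - b\<^sup>2) + w * of_real (1 - a\<^sup>2)) < 1 - (a * b)\<^sup>2"
      using lt symm_defect[of z w] by (simp add: x a_def b_def norm_mult)
    ultimately show False by linarith
  qed
  obtain z w where x: "x = symm z w" using ex_symm by blast
  then have "x = symm w z" by (simp add: symm_def algebra_simps)
  with x key[of z w] key[of w z] show "x \<in> symm_bidisc" by (simp add: symm_mem)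
qed

lemma open_symm_bidisc: "open symm_bidisc"
proof -
  have "open {x :: complex^2. cmod (x$1 - cnj (x$1) * x$2) < 1 - (cmod (x$2))\<^sup>2}"
    by (intro open_Collect_less continuous_intros)
  then show ?thesis by (simp add: symm_bidisc_iff[symmetric])
qed

text \<open>The functions \<open>\<Phi>\<^sub>\<omega>\<close> of Agler and Young; those with unimodular \<open>\<omega>\<close> provide all the extremal
  functions used below.\<close>
definition magic :: "complex \<Rightarrow> complex^2 \<Rightarrow> complex" where
  "magic \<omega> x = (2 * \<omega> * x$2 - x$1) / (2 - \<omega> * x$1)"

lemma magic_denom: "2 - \<omega> * x$1 \<noteq> 0" if "x \<in> symm_bidisc" "cmod \<omega> = 1"
proof -
  obtain z w where x: "x = symm z w" and z: "cmod z < 1" and w: "cmod w < 1"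
    using \<open>x \<in> symm_bidisc\<close> by (auto simp: mem_symm_bidisc)
  have "cmod (\<omega> * x$1) < 2"
    using that(2) norm_triangle_ineq[of z w] z w by (simp add: x norm_mult)
  then show ?thesis by auto
qed

text \<open>\<open>|2 - \<omega> s|\<^sup>2 - |2 \<omega> p - s|\<^sup>2 = 4 (1 - |p|\<^sup>2 - Re (\<omega> (s - cnj s p)))\<close>, which is positive by the
  description of the domain.\<close>
lemma magic_in_disc: "cmod (magic \<omega> x) < 1" if "x \<in> symm_bidisc" "cmod \<omega> = 1"
proof -
  define s p where "s = x$1" and "p = x$2"
  have om: "\<omega> * cnj \<omega> = 1" using that(2) by (simp add: complex_norm_square[symmetric])
  have "(2 - \<omega> * s) * cnj (2 - \<omega> * s) - (2 * \<omega> * p - s) * cnj (2 * \<omega> * p - s)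
     = 4 - 2 * (\<omega> * (s - cnj s * p) + cnj (\<omega> * (s - cnj s * p))) - 4 * (p * cnj p)"
    using om by simp algebra
  also have "\<dots> = of_real (4 * (1 - (cmod p)\<^sup>2 - Re (\<omega> * (s - cnj s * p))))"
    by (simp only: complex_add_cnj complex_norm_square[symmetric]) simp
  finally have eq: "(cmod (2 - \<omega> * s))\<^sup>2 - (cmod (2 * \<omega> * p - s))\<^sup>2
      = 4 * (1 - (cmod p)\<^sup>2 - Re (\<omega> * (s - cnj s * p)))"
    by (simp only: complex_norm_square[symmetric] of_real_diff[symmetric] of_real_eq_iff)
  have "Re (\<omega> * (s - cnj s * p)) \<le> cmod (s - cnj s * p)"
    using complex_Re_le_cmod[of "\<omega> * (s - cnj s * p)"] that(2) by (simp add: norm_mult)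
  also have "\<dots> < 1 - (cmod p)\<^sup>2" using that(1) by (simp add: symm_bidisc_iff s_def p_def)
  finally have "0 < 4 * (1 - (cmod p)\<^sup>2 - Re (\<omega> * (s - cnj s * p)))" by simp
  then have "(cmod (2 * \<omega> * p - s))\<^sup>2 < (cmod (2 - \<omega> * s))\<^sup>2"
    unfolding eq[symmetric] by simp
  then have "cmod (2 * \<omega> * p - s) < cmod (2 - \<omega> * s)"
    using norm_ge_zero power_less_imp_less_base by blast
  moreover from magic_denom[OF that] have "2 - \<omega> * s \<noteq> 0" by (simp add: s_def)
  ultimately show ?thesis by (simp add: magic_def norm_divide s_def p_def)
qed

text \<open>Let \<open>\<alpha>\<close> and \<open>\<beta>\<close> be the two values. Clearing denominators makes both equations affine in \<open>p\<close>;
  eliminating \<open>p\<close> leaves \<open>s (\<alpha> - \<beta> - 2) = 2 (\<alpha> + \<beta>)\<close>, where the factor of \<open>s\<close> is nonzero because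
  both values lie in the disc.\<close>
lemma magic_determine:
  assumes "x \<in> symm_bidisc" "y \<in> symm_bidisc" "magic 1 x = magic 1 y" "magic (-1) x = magic (-1) y"
  shows "x = y"
proof -
  have *: "x$1 * (magic 1 x - magic (-1) x - 2) = 2 * (magic 1 x + magic (-1) x)"
    "2 * x$2 - x$1 = magic 1 x * (2 - x$1)" if "x \<in> symm_bidisc" for x
  proof -
    have "2 - x$1 \<noteq> 0" "2 + x$1 \<noteq> 0"
      using magic_denom[OF that, of 1] magic_denom[OF that, of "-1"] by auto
    then have "2 * x$2 - x$1 = magic 1 x * (2 - x$1)" "- 2 * x$2 - x$1 = magic (-1) x * (2 + x$1)"
      by (simp_all add: magic_def)
    then show "x$1 * (magic 1 x - magic (-1) x - 2) = 2 * (magic 1 x + magic (-1) x)"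
    "2 * x$2 - x$1 = magic 1 x * (2 - x$1)" by algebra+
  qed
  have "cmod (magic 1 x - magic (-1) x) < 2"
    using norm_triangle_ineq4[of "magic 1 x" "magic (-1) x"] magic_in_disc[OF assms(1), of 1] magic_in_disc[OF assms(1), of "-1"]
    by simp
  then have nz: "magic 1 x - magic (-1) x - 2 \<noteq> 0" by auto
  have "x$1 * (magic 1 x - magic (-1) x - 2) = y$1 * (magic 1 x - magic (-1) x - 2)"
    using *(1)[OF assms(1)] *(1)[OF assms(2)] assms(3,4) by simp
  then have e1: "x$1 = y$1" using nz by simp
  moreover have "2 * x$2 - x$1 = 2 * y$2 - y$1"
    using *(2)[OF assms(1)] *(2)[OF assms(2)] assms(3) e1 by simp
  then have "x$2 = y$2" using e1 by simp
  ultimately show ?thesis by (rule vec2_eqI)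
qed

section \<open>Holomorphy in coordinates\<close>

lemma has_derivative_vec_nth:
  "(f has_derivative f') F \<Longrightarrow> ((\<lambda>x. f x $ i) has_derivative (\<lambda>v. f' v $ i)) F"
  using bounded_linear.has_derivative[OF bounded_linear_vec_nth] .

lemma has_derivative_vecI:
  fixes f :: "'a::real_normed_vector \<Rightarrow> 'b::euclidean_space^'n"
  assumes "\<And>i. ((\<lambda>x. f x $ i) has_derivative (\<lambda>v. f' v $ i)) (at x within S)"
  shows "(f has_derivative f') (at x within S)"
  unfolding has_derivative_componentwise_within[of f]
proof
  fix b :: "'b^'n" assume "b \<in> Basis"
  then obtain i c where b: "b = axis i c" by (auto simp: Basis_vec_def)
  show "((\<lambda>x. f x \<bullet> b) has_derivative (\<lambda>x. f' x \<bullet> b)) (at x within S)"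
    using has_derivative_inner_left[OF assms[of i], of c] by (simp add: b inner_axis)
qed

text \<open>The complex partial derivatives \<open>a = \<partial>f/\<partial>s\<close> and \<open>b = \<partial>f/\<partial>p\<close>; complex linearity of the derivative
  is built into the form of the linear map.\<close>
definition gradient :: "(complex^2 \<Rightarrow> complex) \<Rightarrow> complex^2 \<Rightarrow> complex \<Rightarrow> complex \<Rightarrow> bool" where
  "gradient f x a b \<longleftrightarrow> (f has_derivative (\<lambda>v. a * v$1 + b * v$2)) (at x)"

lemma linear_form_iff:
  fixes L :: "complex^2 \<Rightarrow> complex"
  shows "Vector_Spaces.linear (*s) (*) L \<longleftrightarrow> (\<exists>a b. L = (\<lambda>v. a * v$1 + b * v$2))"
proof
  assume L: "Vector_Spaces.linear (*s) (*) L"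
  have "L v = L (axis 1 1) * v$1 + L (axis 2 1) * v$2" for v
  proof -
    have "v = v$1 *s axis 1 1 + v$2 *s axis 2 1"
      by (rule vec2_eqI) (simp_all add: axis_def)
    then have "L v = L (v$1 *s axis 1 1 + v$2 *s axis 2 1)" by simp
    also have "\<dots> = v$1 * L (axis 1 1) + v$2 * L (axis 2 1)"
      using L unfolding Vector_Spaces.linear_iff by simp
    finally show ?thesis by simp
  qed
  then show "\<exists>a b. L = (\<lambda>v. a * v$1 + b * v$2)" by blast
next
  assume "\<exists>a b. L = (\<lambda>v. a * v$1 + b * v$2)"
  then obtain a b where L: "L = (\<lambda>v. a * v$1 + b * v$2)" by blast
  have "vector_space ((*) :: complex \<Rightarrow> _)"
    by unfold_locales (simp_all add: algebra_simps)
  then show "Vector_Spaces.linear (*s) (*) L"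
    unfolding Vector_Spaces.linear_iff L by (simp add: vec.vector_space_axioms algebra_simps)
qed

lemma holomorphic_cvec_iff:
  "holomorphic_cvec f symm_bidisc \<longleftrightarrow> (\<forall>x\<in>symm_bidisc. \<exists>a b. gradient f x a b)"
proof -
  have "(\<exists>L. (f has_derivative L) (at x within symm_bidisc) \<and> Vector_Spaces.linear (*s) (*) L)
      \<longleftrightarrow> (\<exists>a b. gradient f x a b)" if "x \<in> symm_bidisc" for x
    using at_within_open[OF that open_symm_bidisc] unfolding linear_form_iff gradient_def by auto
  then show ?thesis unfolding holomorphic_cvec_def by simp
qed

lemma gradient_const: "gradient (\<lambda>x. c) x 0 0"
  and gradient_nth1: "gradient (\<lambda>x. x$1) x 1 0"
  and gradient_nth2: "gradient (\<lambda>x. x$2) x 0 1"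
  unfolding gradient_def
  by (simp_all add: bounded_linear_imp_has_derivative bounded_linear_vec_nth)

lemma gradient_add: "gradient f x a b \<Longrightarrow> gradient g x c d \<Longrightarrow> gradient (\<lambda>x. f x + g x) x (a + c) (b + d)"
  unfolding gradient_def by (drule (1) has_derivative_add) (simp add: algebra_simps)

lemma gradient_diff: "gradient f x a b \<Longrightarrow> gradient g x c d \<Longrightarrow> gradient (\<lambda>x. f x - g x) x (a - c) (b - d)"
  unfolding gradient_def by (drule (1) has_derivative_diff) (simp add: algebra_simps)

lemma gradient_mult: "gradient f x a b \<Longrightarrow> gradient g x c d \<Longrightarrow>
    gradient (\<lambda>x. f x * g x) x (f x * c + a * g x) (f x * d + b * g x)"
  unfolding gradient_def by (drule (1) has_derivative_mult) (simp add: algebra_simps)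

lemma gradient_comp:
  assumes "(n has_field_derivative e) (at (f x))" "gradient f x a b"
  shows "gradient (\<lambda>x. n (f x)) x (e * a) (e * b)"
  using has_derivative_compose[OF assms(2)[unfolded gradient_def] assms(1)[unfolded has_field_derivative_def]]
  unfolding gradient_def by (simp add: algebra_simps)

lemma gradient_divide:
  assumes "gradient f x a b" "gradient g x c d" "g x \<noteq> 0"
  shows "gradient (\<lambda>x. f x / g x) x ((a * g x - f x * c) / (g x)\<^sup>2) ((b * g x - f x * d) / (g x)\<^sup>2)"
proof -
  have "(inverse has_field_derivative - (inverse (g x) ^ Suc (Suc 0))) (at (g x))"
    using DERIV_inverse[OF assms(3)] .
  from gradient_mult[OF assms(1) gradient_comp[OF this assms(2)]]
  have "gradient (\<lambda>x. f x * inverse (g x)) x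
     (f x * (- (inverse (g x) ^ Suc (Suc 0)) * c) + a * inverse (g x))
     (f x * (- (inverse (g x) ^ Suc (Suc 0)) * d) + b * inverse (g x))" .
  moreover have "f x * (- (inverse (g x) ^ Suc (Suc 0)) * c) + a * inverse (g x) = (a * g x - f x * c) / (g x)\<^sup>2" for a c
    using assms(3) by (simp add: divide_simps power2_eq_square)
  ultimately show ?thesis unfolding divide_inverse[of "f _"] by simp
qed

lemma gradient_unique:
  assumes "gradient f x a b" "gradient f x c d" shows "a = c" "b = d"
proof -
  have eq: "(\<lambda>v :: complex^2. a * v$1 + b * v$2) = (\<lambda>v. c * v$1 + d * v$2)"
    using has_derivative_unique assms unfolding gradient_def by blast
  show "a = c" using fun_cong[OF eq, of "vector [1, 0]"] by simp
  show "b = d" using fun_cong[OF eq, of "vector [0, 1]"] by simp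
qed

lemma matrix_vec2: "(M *v v) $ i = M$i$1 * v$1 + M$i$2 * v$(2::2)" for v :: "complex^2"
  by (simp add: matrix_vector_mult_def sum_2)

lemma holomorphic_map_iff:
  fixes F :: "complex^2 \<Rightarrow> complex^2"
  shows "holomorphic_map F symm_bidisc \<longleftrightarrow>
    (\<forall>x\<in>symm_bidisc. \<exists>M. (F has_derivative (\<lambda>v. M *v v)) (at x))"
proof -
  have "(\<forall>i. \<exists>a b. gradient (\<lambda>x. F x $ i) x a b) \<longleftrightarrow> (\<exists>M. (F has_derivative (\<lambda>v. M *v v)) (at x))" for x
  proof
    assume "\<forall>i. \<exists>a b. gradient (\<lambda>x. F x $ i) x a b"
    then obtain a b where "\<And>i. gradient (\<lambda>x. F x $ i) x (a i) (b i)" by metis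
    then have "(F has_derivative (\<lambda>v. (\<chi> i j. if j = 1 then a i else b i) *v v)) (at x)"
      unfolding gradient_def by (intro has_derivative_vecI) (simp add: matrix_vec2)
    then show "\<exists>M. (F has_derivative (\<lambda>v. M *v v)) (at x)" by blast
  next
    assume "\<exists>M. (F has_derivative (\<lambda>v. M *v v)) (at x)"
    then obtain M where "(F has_derivative (\<lambda>v. M *v v)) (at x)" by blast
    from has_derivative_vec_nth[OF this] show "\<forall>i. \<exists>a b. gradient (\<lambda>x. F x $ i) x a b"
      unfolding gradient_def matrix_vec2 by blast
  qed
  then show ?thesis unfolding holomorphic_map_def holomorphic_cvec_iff by blast
qed

text \<open>The derivative of a holomorphic curve as a vector, in the Frechet form that composes with
  derivatives of maps and functions on \<open>\<complex>\<^sup>2\<close>.\<close>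
definition disc_deriv :: "(complex \<Rightarrow> complex^2) \<Rightarrow> complex \<Rightarrow> complex^2 \<Rightarrow> bool" where
  "disc_deriv h z d \<longleftrightarrow> (h has_derivative (\<lambda>\<zeta>. \<zeta> *s d)) (at z)"

lemma has_field_derivative_iff_right:
  "(f has_field_derivative c) F \<longleftrightarrow> (f has_derivative (\<lambda>v. v * c)) F"
  by (simp add: has_field_derivative_def mult_commute_abs)

lemma disc_deriv_iff:
  "disc_deriv h z d \<longleftrightarrow> (\<forall>i. ((\<lambda>z. h z $ i) has_field_derivative d $ i) (at z))"
proof
  assume "disc_deriv h z d"
  from has_derivative_vec_nth[OF this[unfolded disc_deriv_def]]
  show "\<forall>i. ((\<lambda>z. h z $ i) has_field_derivative d $ i) (at z)"
    unfolding has_field_derivative_iff_right by simp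
next
  assume "\<forall>i. ((\<lambda>z. h z $ i) has_field_derivative d $ i) (at z)"
  then show "disc_deriv h z d"
    unfolding has_field_derivative_iff_right disc_deriv_def by (intro has_derivative_vecI) simp
qed

lemma disc_deriv_deriv:
  "disc_deriv h z d \<Longrightarrow> (\<chi> i. deriv (\<lambda>\<zeta>. h \<zeta> $ i) z) = d"
  by (simp add: disc_deriv_iff vec_eq_iff DERIV_imp_deriv)

lemma holomorphic_disc_deriv:
  assumes "\<forall>i. (\<lambda>z. h z $ i) holomorphic_on \<bbbD>" "z \<in> \<bbbD>"
  shows "disc_deriv h z (\<chi> i. deriv (\<lambda>\<zeta>. h \<zeta> $ i) z)"
  unfolding disc_deriv_iff using assms by (auto intro: holomorphic_derivI)

lemma holomorphic_disc_iff:
  "(\<forall>i. (\<lambda>z. h z $ i) holomorphic_on \<bbbD>) \<longleftrightarrow> (\<forall>z\<in>\<bbbD>. \<exists>d. disc_deriv h z d)"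
proof
  assume "\<forall>i. (\<lambda>z. h z $ i) holomorphic_on \<bbbD>"
  then show "\<forall>z\<in>\<bbbD>. \<exists>d. disc_deriv h z d" using holomorphic_disc_deriv by blast
next
  assume "\<forall>z\<in>\<bbbD>. \<exists>d. disc_deriv h z d"
  then show "\<forall>i. (\<lambda>z. h z $ i) holomorphic_on \<bbbD>"
    unfolding disc_deriv_iff holomorphic_on_open[OF open_ball] by blast
qed

lemma gradient_disc:
  assumes "gradient f (h z) a b" "disc_deriv h z d"
  shows "((\<lambda>z. f (h z)) has_field_derivative (a * d$1 + b * d$2)) (at z)"
  using has_derivative_compose[OF assms(2)[unfolded disc_deriv_def] assms(1)[unfolded gradient_def]]
  unfolding has_field_derivative_iff_right by (simp add: algebra_simps)

lemma map_disc_deriv: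
  assumes "(F has_derivative (\<lambda>v. M *v v)) (at (h z))" "disc_deriv h z d"
  shows "disc_deriv (\<lambda>z. F (h z)) z (M *v d)"
  using has_derivative_compose[OF assms(2)[unfolded disc_deriv_def] assms(1)]
  unfolding disc_deriv_def by (simp add: vec.scale)

lemma map_gradient:
  assumes "(F has_derivative (\<lambda>v. M *v v)) (at x)" "gradient f (F x) a b"
  shows "gradient (\<lambda>x. f (F x)) x (a * M$1$1 + b * M$2$1) (a * M$1$2 + b * M$2$2)"
  using has_derivative_compose[OF assms(1) assms(2)[unfolded gradient_def]]
  unfolding gradient_def by (simp add: algebra_simps matrix_vec2)

lemma disc_deriv_reparam:
  assumes "(m has_field_derivative e) (at z)" "disc_deriv h (m z) d"
  shows "disc_deriv (\<lambda>z. h (m z)) z (e *s d)"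
  using assms unfolding disc_deriv_iff by (auto intro: DERIV_chain2[THEN DERIV_cong])

section \<open>Moebius automorphisms of the symmetrized bidisc\<close>

text \<open>The Moebius maps are written homogeneously, with \<open>|B| < |A|\<close> and without normalizing
  \<open>|A|\<^sup>2 - |B|\<^sup>2\<close>: then the inverse has the coefficients \<open>cnj A\<close> and \<open>- B\<close>, and rotations are
  included as \<open>B = 0\<close>.\<close>
definition mob :: "complex \<Rightarrow> complex \<Rightarrow> complex \<Rightarrow> complex" where
  "mob A B z = (A * z + B) / (cnj B * z + cnj A)"

lemma mob_denom:
  assumes "cmod B < cmod A" "cmod z \<le> 1" shows "cnj B * z + cnj A \<noteq> 0"
proof
  assume "cnj B * z + cnj A = 0"
  then have "cnj A = - (cnj B * z)" by (simp add: add_eq_0_iff)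
  then have "cmod A = cmod B * cmod z" by (metis complex_mod_cnj norm_minus_cancel norm_mult)
  also have "\<dots> \<le> cmod B" using assms(2) by (simp add: mult_left_le)
  finally show False using assms(1) by simp
qed

lemma mob_norm_identity:
  "(cmod (cnj B * z + cnj A))\<^sup>2 - (cmod (A * z + B))\<^sup>2
     = ((cmod A)\<^sup>2 - (cmod B)\<^sup>2) * (1 - (cmod z)\<^sup>2)"
proof -
  have "complex_of_real ((cmod (cnj B * z + cnj A))\<^sup>2 - (cmod (A * z + B))\<^sup>2)
     = of_real (((cmod A)\<^sup>2 - (cmod B)\<^sup>2) * (1 - (cmod z)\<^sup>2))"
    by (simp only: of_real_diff of_real_mult of_real_1 complex_norm_square) (simp add: algebra_simps)
  then show ?thesis by (simp only: of_real_eq_iff)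
qed

lemma mob_norm:
  assumes "cmod B < cmod A"
  shows "cmod z < 1 \<Longrightarrow> cmod (mob A B z) < 1" "cmod z = 1 \<Longrightarrow> cmod (mob A B z) = 1"
    "cmod z \<le> 1 \<Longrightarrow> cmod (mob A B z) \<le> 1"
proof -
  have pos: "0 < (cmod A)\<^sup>2 - (cmod B)\<^sup>2" using assms by (simp add: power_strict_mono)
  show 1: "cmod (mob A B z) < 1" if "cmod z < 1"
  proof -
    have "0 < 1 - (cmod z)\<^sup>2" using that by (simp add: abs_square_less_1)
    then have "(cmod (A * z + B))\<^sup>2 < (cmod (cnj B * z + cnj A))\<^sup>2"
      using mob_norm_identity[of B z A] mult_pos_pos[OF pos, of "1 - (cmod z)\<^sup>2"] by simp
    then have "cmod (A * z + B) < cmod (cnj B * z + cnj A)" using norm_ge_zero power_less_imp_less_base by blast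
    then show ?thesis using mob_denom[OF assms, of z] that by (simp add: mob_def norm_divide)
  qed
  show 2: "cmod (mob A B z) = 1" if "cmod z = 1"
  proof -
    have "(cmod (A * z + B))\<^sup>2 = (cmod (cnj B * z + cnj A))\<^sup>2"
      using mob_norm_identity[of B z A] that by simp
    then have "cmod (A * z + B) = cmod (cnj B * z + cnj A)" by simp
    then show ?thesis using mob_denom[OF assms, of z] that by (simp add: mob_def norm_divide)
  qed
  show "cmod (mob A B z) \<le> 1" if "cmod z \<le> 1"
    using 1 2 that by (cases "cmod z = 1") auto
qed

lemma mob_inverse:
  assumes "cmod B < cmod A" "cmod z \<le> 1"
  shows "mob (cnj A) (- B) (mob A B z) = z"
proof -
  define n d where "n = A * z + B" and "d = cnj B * z + cnj A"
  have d: "d \<noteq> 0" using mob_denom[OF assms] by (simp add: d_def)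
  have AB: "A * cnj A - B * cnj B \<noteq> 0"
  proof
    assume "A * cnj A - B * cnj B = 0"
    then have "complex_of_real ((cmod A)\<^sup>2) = of_real ((cmod B)\<^sup>2)"
      unfolding complex_norm_square by simp
    then have "(cmod A)\<^sup>2 = (cmod B)\<^sup>2" by (simp only: of_real_eq_iff)
    then show False using assms(1) by (simp add: power2_eq_iff)
  qed
  have 1: "cnj A * n - B * d = (A * cnj A - B * cnj B) * z" "A * d - cnj B * n = A * cnj A - B * cnj B"
    unfolding n_def d_def by (simp_all add: algebra_simps)
  have "mob (cnj A) (- B) (mob A B z) = (cnj A * (n / d) - B) / (A - cnj B * (n / d))"
    by (simp add: mob_def n_def d_def)
  also have "\<dots> = (cnj A * n - B * d) / (A * d - cnj B * n)"
    using d by (simp add: divide_simps)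
  also have "\<dots> = z" unfolding 1 using AB by simp
  finally show ?thesis .
qed

lemma mob_holomorphic:
  assumes "cmod B < cmod A" shows "mob A B holomorphic_on \<bbbD>"
  unfolding mob_def using mob_denom[OF assms] by (auto intro!: holomorphic_intros)

definition lift_mob_den :: "complex \<Rightarrow> complex \<Rightarrow> complex^2 \<Rightarrow> complex" where
  "lift_mob_den A B x = cnj B * cnj B * x$2 + cnj A * cnj B * x$1 + cnj A * cnj A"

text \<open>The map induced on \<open>(z + w, z w)\<close> by \<open>z \<mapsto> mob A B z\<close>, written out as a rational map in \<open>s\<close> and
  \<open>p\<close>.\<close>
definition lift_mob :: "complex \<Rightarrow> complex \<Rightarrow> complex^2 \<Rightarrow> complex^2" where
  "lift_mob A B x = vector [(2 * A * cnj B * x$2 + (A * cnj A + B * cnj B) * x$1 + 2 * B * cnj A) / lift_mob_den A B x,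
     (A * A * x$2 + A * B * x$1 + B * B) / lift_mob_den A B x]"

lemma lift_mob_nth:
  "lift_mob A B x $ 1 = (2 * A * cnj B * x$2 + (A * cnj A + B * cnj B) * x$1 + 2 * B * cnj A) / lift_mob_den A B x"
  "lift_mob A B x $ 2 = (A * A * x$2 + A * B * x$1 + B * B) / lift_mob_den A B x"
  by (simp_all add: lift_mob_def)

lemma lift_mob_den_symm: "lift_mob_den A B (symm z w) = (cnj B * z + cnj A) * (cnj B * w + cnj A)"
  by (simp add: lift_mob_den_def algebra_simps)

lemma lift_mob_symm:
  assumes "cmod B < cmod A" "cmod z \<le> 1" "cmod w \<le> 1"
  shows "lift_mob A B (symm z w) = symm (mob A B z) (mob A B w)"
proof -
  have d: "cnj B * z + cnj A \<noteq> 0" "cnj B * w + cnj A \<noteq> 0" using mob_denom assms by auto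
  show ?thesis
  proof (rule vec2_eqI)
    show "lift_mob A B (symm z w) $ 1 = symm (mob A B z) (mob A B w) $ 1"
      unfolding lift_mob_nth lift_mob_den_symm mob_def symm_nth add_frac_eq[OF d] by (simp add: algebra_simps)
    show "lift_mob A B (symm z w) $ 2 = symm (mob A B z) (mob A B w) $ 2"
      unfolding lift_mob_nth lift_mob_den_symm mob_def symm_nth times_divide_times_eq
        by (simp add: algebra_simps)
  qed
qed

lemma lift_mob_mem:
  assumes "cmod B < cmod A" "x \<in> symm_bidisc" shows "lift_mob A B x \<in> symm_bidisc"
proof -
  obtain z w where "cmod z < 1" "cmod w < 1" "x = symm z w" using assms(2) unfolding mem_symm_bidisc by blast
  then show ?thesis using assms(1) by (simp add: lift_mob_symm symm_mem mob_norm)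
qed

lemma lift_mob_inverse:
  assumes "cmod B < cmod A" "cmod z \<le> 1" "cmod w \<le> 1"
  shows "lift_mob (cnj A) (- B) (lift_mob A B (symm z w)) = symm z w"
  using assms by (simp add: lift_mob_symm mob_norm mob_inverse)

lemma lift_mob_den_nz:
  assumes "cmod B < cmod A" "x \<in> symm_bidisc" shows "lift_mob_den A B x \<noteq> 0"
  using assms mob_denom[OF assms(1)] by (auto simp: mem_symm_bidisc lift_mob_den_symm)

lemma gradient_affine: "gradient (\<lambda>x. c * x$2 + d * x$1 + e) x d c"
  using gradient_add[OF gradient_add[OF gradient_mult[OF gradient_const[of c] gradient_nth2[of x]]
      gradient_mult[OF gradient_const[of d] gradient_nth1]] gradient_const[of e]] by simp

lemma ex_gradient_lift_mob:
  assumes "cmod B < cmod A" "x \<in> symm_bidisc"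
  shows "\<exists>a b. gradient (\<lambda>x. lift_mob A B x $ i) x a b"
proof -
  have "\<exists>a b. gradient (\<lambda>x. (c * x$2 + d * x$1 + e) / lift_mob_den A B x) x a b" for c d e
    using gradient_divide[OF gradient_affine gradient_affine] lift_mob_den_nz[OF assms]
    unfolding lift_mob_den_def by blast
  then show ?thesis using exhaust_2[of i] by (auto simp: lift_mob_nth)
qed

lemma holomorphic_map_lift_mob:
  assumes "cmod B < cmod A" shows "holomorphic_map (lift_mob A B) symm_bidisc"
  unfolding holomorphic_map_def holomorphic_cvec_iff using ex_gradient_lift_mob[OF assms] by blast

text \<open>Automorphisms are handled together with an inverse, since \<open>inv_into\<close> does not compose well.\<close>
definition aut_pair :: "(complex^2 \<Rightarrow> complex^2) \<Rightarrow> (complex^2 \<Rightarrow> complex^2) \<Rightarrow> bool" where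
  "aut_pair F H \<longleftrightarrow> holomorphic_map F symm_bidisc \<and> holomorphic_map H symm_bidisc \<and>
     F ` symm_bidisc \<subseteq> symm_bidisc \<and> H ` symm_bidisc \<subseteq> symm_bidisc \<and>
     (\<forall>x\<in>symm_bidisc. H (F x) = x \<and> F (H x) = x)"

lemma aut_pair_sym: "aut_pair F H \<Longrightarrow> aut_pair H F"
  unfolding aut_pair_def by blast

lemma aut_pairD:
  assumes "aut_pair F H" "x \<in> symm_bidisc"
  shows "F x \<in> symm_bidisc" "H x \<in> symm_bidisc" "H (F x) = x" "F (H x) = x"
    "\<exists>M. (F has_derivative (\<lambda>v. M *v v)) (at x)" "\<exists>M. (H has_derivative (\<lambda>v. M *v v)) (at x)"
  using assms unfolding aut_pair_def holomorphic_map_iff by auto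

lemma holomorphic_map_comp:
  fixes F H :: "complex^2 \<Rightarrow> complex^2"
  assumes "holomorphic_map F symm_bidisc" "holomorphic_map H symm_bidisc" "F ` symm_bidisc \<subseteq> symm_bidisc"
  shows "holomorphic_map (\<lambda>x. H (F x)) symm_bidisc"
  unfolding holomorphic_map_iff
proof
  fix x assume x: "x \<in> symm_bidisc"
  obtain M where M: "(F has_derivative (\<lambda>v. M *v v)) (at x)"
    using assms(1) x unfolding holomorphic_map_iff by blast
  obtain N where N: "(H has_derivative (\<lambda>v. N *v v)) (at (F x))"
    using assms(2,3) x unfolding holomorphic_map_iff by blast
  show "\<exists>M. ((\<lambda>x. H (F x)) has_derivative (\<lambda>v. M *v v)) (at x)"
    using has_derivative_compose[OF M N] by (auto simp: matrix_vector_mul_assoc)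
qed

lemma aut_pair_comp: "aut_pair F H \<Longrightarrow> aut_pair F' H' \<Longrightarrow> aut_pair (\<lambda>x. F' (F x)) (\<lambda>x. H (H' x))"
  using holomorphic_map_comp[of F F'] holomorphic_map_comp[of H' H]
  unfolding aut_pair_def image_subset_iff by auto

lemma Aut_G_iff: "F \<in> Aut_G \<longleftrightarrow> (\<exists>H. aut_pair F H)"
proof
  assume "F \<in> Aut_G"
  then have "aut_pair F (inv_into symm_bidisc F)"
    unfolding Aut_G_def aut_pair_def
    by (auto simp: bij_betw_def inv_into_into f_inv_into_f)
  then show "\<exists>H. aut_pair F H" by blast
next
  assume "\<exists>H. aut_pair F H"
  then obtain H where H: "aut_pair F H" by blast
  have bij: "bij_betw F symm_bidisc symm_bidisc"
    by (rule bij_betw_byWitness[of _ H]) (use H in \<open>auto simp: aut_pair_def\<close>)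
  have eq: "H x = inv_into symm_bidisc F x" if "x \<in> symm_bidisc" for x
    using aut_pairD[OF H that] bij by (metis bij_betw_inv_into_left)
  have "holomorphic_map (inv_into symm_bidisc F) symm_bidisc"
    unfolding holomorphic_map_iff
  proof
    fix x assume x: "x \<in> symm_bidisc"
    then obtain M where "(H has_derivative (\<lambda>v. M *v v)) (at x)" using aut_pairD[OF H] by blast
    from has_derivative_transform_within_open[OF this open_symm_bidisc x eq]
    show "\<exists>M. (inv_into symm_bidisc F has_derivative (\<lambda>v. M *v v)) (at x)" by blast
  qed
  with bij H show "F \<in> Aut_G" unfolding Aut_G_def aut_pair_def by blast
qed

lemma aut_pair_lift_mob:
  assumes "cmod B < cmod A" shows "aut_pair (lift_mob A B) (lift_mob (cnj A) (- B))"
proof -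
  have 1: "lift_mob (cnj A) (- B) (lift_mob A B x) = x" if "x \<in> symm_bidisc" "cmod B < cmod A" for x A B
    using that lift_mob_inverse[of B A] by (auto simp: mem_symm_bidisc)
  show ?thesis unfolding aut_pair_def
    using assms 1[of _ B A] 1[of _ "-B" "cnj A"] by (auto simp: holomorphic_map_lift_mob lift_mob_mem)
qed

definition axis_point :: "real \<Rightarrow> complex^2" where
  "axis_point r = vector [0, - of_real r]"

lemma axis_point_nth [simp]: "axis_point r $ 1 = 0" "axis_point r $ 2 = - of_real r"
  by (simp_all add: axis_point_def)

text \<open>The unimodular pair \<open>A = e, B = 0\<close> acts on \<open>p\<close> as multiplication by \<open>e\<^sup>2 / cnj e\<^sup>2 = e\<^sup>4\<close>, so
  prescribing this rotation takes a fourth root.\<close>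
lemma rotation_root:
  assumes u: "cmod u = 1" shows "\<exists>e. cmod e = 1 \<and> (e * e) / (cnj e * cnj e) = u"
proof -
  define e where "e = csqrt (csqrt u)"
  have e4: "e * e * (e * e) = u"
    using power2_csqrt[of u] power2_csqrt[of "csqrt u"] by (simp add: e_def power2_eq_square)
  have e1: "cmod e = 1" using u by (simp add: e_def)
  then have "e * cnj e = 1" by (simp add: complex_norm_square[symmetric])
  then have "(e * e) / (cnj e * cnj e) = e * e * (e * e)" by (simp add: divide_eq_eq) algebra
  then show ?thesis using e1 e4 by auto
qed

text \<open>With \<open>A = 1\<close>, the first coordinate of the image vanishes when
  \<open>2 cnj B p + (1 + |B|\<^sup>2) s + 2 B = 0\<close>. For \<open>B = - t (s - cnj s p)\<close> with real \<open>t\<close> the left side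
  is \<open>s\<close> times the real quadratic \<open>t\<^sup>2 |q|\<^sup>2 - 2 t (1 - |p|\<^sup>2) + 1\<close>, \<open>q = s - cnj s p\<close>; its
  smaller root gives \<open>|B| < 1\<close>. A rotation then makes the second coordinate a nonpositive real.\<close>
lemma normal_form:
  assumes x: "x \<in> symm_bidisc"
  shows "\<exists>A B r. cmod B < cmod A \<and> 0 \<le> r \<and> r < 1 \<and> lift_mob A B x = axis_point r"
proof -
  define s p q k where "s = x$1" and "p = x$2" and "q = s - cnj s * p" and "k = 1 - (cmod p)\<^sup>2"
  have qk: "cmod q < k" using x by (simp add: symm_bidisc_iff q_def s_def p_def k_def)
  have k0: "0 < k" using le_less_trans[OF norm_ge_zero qk] .
  define R where "R = sqrt (k\<^sup>2 - (cmod q)\<^sup>2)"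
  have R: "0 \<le> R" "R\<^sup>2 = k\<^sup>2 - (cmod q)\<^sup>2" using qk by (simp_all add: R_def power_mono)
  \<comment> \<open>\<open>t\<close> is the smaller root of the quadratic, rationalized so that \<open>q = 0\<close> is no exception.\<close>
  define t where "t = 1 / (k + R)"
  have t0: "0 < t" using R k0 by (simp add: t_def)
  have tkR: "t * (k + R) = 1" using R k0 by (simp add: t_def)
  have quad: "t\<^sup>2 * (cmod q)\<^sup>2 - 2 * t * k + 1 = 0" using tkR R(2) by algebra
  define B where "B = - of_real t * q"
  have "t * cmod q < t * k" using t0 qk by simp
  also have "t * k \<le> 1" using tkR mult_nonneg_nonneg[OF less_imp_le[OF t0] R(1)] by (simp add: distrib_left)
  finally have B: "cmod B < 1" using t0 by (simp add: B_def norm_mult)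
  have "of_real (t\<^sup>2 * (cmod q)\<^sup>2 - 2 * t * k + 1) = (0 :: complex)" unfolding quad by simp
  then have quadc: "(of_real t)\<^sup>2 * (q * cnj q) - 2 * of_real t * (1 - p * cnj p) + 1 = 0"
    unfolding k_def by (simp add: complex_norm_square flip: of_real_power)
  have num: "2 * cnj B * p + (1 + B * cnj B) * s + 2 * B = 0"
  proof -
    have "2 * cnj B * p + (1 + B * cnj B) * s + 2 * B
      = s * ((of_real t)\<^sup>2 * (q * cnj q) - 2 * of_real t * (1 - p * cnj p) + 1)"
      by (simp add: B_def q_def algebra_simps power2_eq_square)
    then show ?thesis using quadc by simp
  qed
  define p' where "p' = lift_mob 1 B x $ 2"
  have "lift_mob 1 B x \<in> symm_bidisc" using lift_mob_mem[OF _ x] B by simp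
  then have "0 < 1 - (cmod p')\<^sup>2"
    unfolding symm_bidisc_iff p'_def using norm_ge_zero le_less_trans by blast
  then have p': "cmod p' < 1" by (simp add: abs_square_less_1)
  obtain u where u: "cmod u = 1" "u * p' = - of_real (cmod p')"
  proof (cases "p' = 0")
    case False
    then show ?thesis by (intro that[of "- of_real (cmod p') / p'"]) (simp_all add: norm_divide)
  qed (use that[of 1] in simp)
  obtain e where e1: "cmod e = 1" and e4: "(e * e) / (cnj e * cnj e) = u"
    using rotation_root[OF u(1)] by auto
  have ee: "e * cnj e = 1" using e1 by (simp add: complex_norm_square[symmetric])
  have den: "lift_mob_den e (e * B) x = cnj e * cnj e * lift_mob_den 1 B x"
    by (simp add: lift_mob_den_def algebra_simps)
  have "lift_mob e (e * B) x $ 1 = 0"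
  proof -
    have "2 * e * cnj (e * B) * x$2 + (e * cnj e + (e * B) * cnj (e * B)) * x$1 + 2 * (e * B) * cnj e
      = e * cnj e * (2 * cnj B * p + (1 + B * cnj B) * s + 2 * B)"
      by (simp add: s_def p_def algebra_simps)
    then show ?thesis unfolding lift_mob_nth num by simp
  qed
  moreover have "lift_mob e (e * B) x $ 2 = - of_real (cmod p')"
  proof -
    have num: "e * e * x$2 + e * (e * B) * x$1 + (e * B) * (e * B) = e * e * (1 * 1 * x$2 + 1 * B * x$1 + B * B)"
      by (simp add: algebra_simps)
    have "lift_mob e (e * B) x $ 2 = (e * e) / (cnj e * cnj e) * p'"
      unfolding lift_mob_nth den p'_def num times_divide_times_eq ..
    then show ?thesis unfolding e4 u(2) .
  qed
  ultimately have "lift_mob e (e * B) x = axis_point (cmod p')" by (intro vec2_eqI) simp_all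
  moreover have "cmod (e * B) < cmod e" using B e1 by (simp add: norm_mult)
  ultimately show ?thesis using p' by (metis norm_ge_zero)
qed

section \<open>Analytic discs and extremal functions\<close>

lemma mob_deriv:
  assumes "cnj B * z + cnj A \<noteq> 0"
  shows "(mob A B has_field_derivative (A * cnj A - B * cnj B) / (cnj B * z + cnj A)\<^sup>2) (at z)"
  unfolding mob_def
  by (rule derivative_eq_intros refl assms)+ (simp add: power2_eq_square algebra_simps)

definition analytic_disc :: "(complex \<Rightarrow> complex^2) \<Rightarrow> bool" where
  "analytic_disc h \<longleftrightarrow> (\<forall>z\<in>\<bbbD>. h z \<in> symm_bidisc \<and> (\<exists>d. disc_deriv h z d))"

lemma analytic_disc_map:
  assumes "analytic_disc h" "holomorphic_map F symm_bidisc" "F ` symm_bidisc \<subseteq> symm_bidisc"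
  shows "analytic_disc (\<lambda>z. F (h z))"
  unfolding analytic_disc_def
proof
  fix z assume "z \<in> \<bbbD>"
  then obtain d where h: "h z \<in> symm_bidisc" "disc_deriv h z d" using assms(1)
    unfolding analytic_disc_def by blast
  then obtain M where M: "(F has_derivative (\<lambda>v. M *v v)) (at (h z))"
    using assms(2) unfolding holomorphic_map_iff by blast
  show "F (h z) \<in> symm_bidisc \<and> (\<exists>d. disc_deriv (\<lambda>z. F (h z)) z d)"
    using map_disc_deriv[OF M h(2)] h(1) assms(3) by blast
qed

lemma analytic_disc_reparam:
  assumes "analytic_disc h" "m holomorphic_on \<bbbD>" "m ` \<bbbD> \<subseteq> \<bbbD>"
  shows "analytic_disc (\<lambda>z. h (m z))"
  unfolding analytic_disc_def
proof
  fix z assume z: "z \<in> \<bbbD>"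
  then have mz: "m z \<in> \<bbbD>" using assms(3) by blast
  then obtain d where h: "h (m z) \<in> symm_bidisc" "disc_deriv h (m z) d"
    using assms(1) unfolding analytic_disc_def by blast
  have "(m has_field_derivative deriv m z) (at z)" using assms(2) z by (auto intro: holomorphic_derivI)
  from disc_deriv_reparam[OF this h(2)] h(1)
  show "h (m z) \<in> symm_bidisc \<and> (\<exists>d. disc_deriv (\<lambda>z. h (m z)) z d)" by blast
qed

lemma holomorphic_along_disc:
  assumes "analytic_disc h" "holomorphic_cvec f symm_bidisc"
  shows "(\<lambda>z. f (h z)) holomorphic_on \<bbbD>"
  unfolding holomorphic_on_open[OF open_ball]
proof
  fix z assume "z \<in> \<bbbD>"
  then obtain d where h: "h z \<in> symm_bidisc" "disc_deriv h z d" using assms(1)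
    unfolding analytic_disc_def by blast
  then obtain a b where "gradient f (h z) a b" using assms(2) unfolding holomorphic_cvec_iff by blast
  from gradient_disc[of f h, OF this h(2)]
  show "\<exists>f'. ((\<lambda>z. f (h z)) has_field_derivative f') (at z)" by blast
qed

text \<open>The Schwarz-Pick lemma for \<open>f\<close> along the disc \<open>h\<close>: a Moebius map takes \<open>f (h 0)\<close> to the origin.\<close>
lemma Schwarz_Pick_disc:
  assumes h: "analytic_disc h" and f: "holomorphic_cvec f symm_bidisc"
  and f1: "\<And>y. y \<in> symm_bidisc \<Longrightarrow> cmod (f y) < 1"
    and d: "disc_deriv h 0 d" and g: "gradient f (h 0) a b"
  shows "cmod (a * d$1 + b * d$2) \<le> 1 - (cmod (f (h 0)))\<^sup>2"
proof -
  define c where "c = f (h 0)"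
  have c: "cmod c < 1" unfolding c_def using h by (intro f1) (auto simp: analytic_disc_def)
  then have c': "cmod (- c) < cmod 1" by simp
  let ?\<phi> = "\<lambda>z. mob 1 (- c) (f (h z))"
  have fh: "cmod (f (h z)) < 1" if "z \<in> \<bbbD>" for z using h that
    by (intro f1) (auto simp: analytic_disc_def)
  have hol: "?\<phi> holomorphic_on \<bbbD>"
    using holomorphic_on_compose_gen[OF holomorphic_along_disc[OF h f] mob_holomorphic[OF c']] fh
    unfolding o_def by (auto simp: image_subset_iff)
  have den: "1 - cnj c * c \<noteq> 0" using mob_denom[OF c', of c] c by auto
  have "(mob 1 (- c) has_field_derivative 1 / (1 - cnj c * c)) (at c)"
    using mob_deriv[of "- c" c 1] den by (simp add: power2_eq_square mult.commute)
  from DERIV_chain2[OF this[unfolded c_def] gradient_disc[of f h, OF g d]]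
  have D: "(?\<phi> has_field_derivative (a * d$1 + b * d$2) / (1 - cnj c * c)) (at 0)"
    by (simp add: c_def)
  have "?\<phi> 0 = 0" "\<And>z. cmod z < 1 \<Longrightarrow> cmod (?\<phi> z) < 1"
    using mob_norm(1)[OF c' fh] by (simp_all add: mob_def c_def)
  then have "cmod (deriv ?\<phi> 0) \<le> 1" using Schwarz_Lemma(2)[OF hol, of 0] by simp
  then have "cmod ((a * d$1 + b * d$2) / (1 - cnj c * c)) \<le> 1" using DERIV_imp_deriv[OF D] by simp
  moreover have "1 - cnj c * c = of_real (1 - (cmod c)\<^sup>2)"
    by (simp only: of_real_diff complex_norm_square) (simp add: mult.commute)
  moreover have "0 < 1 - (cmod c)\<^sup>2" using c by (simp add: abs_square_less_1)
  ultimately show ?thesis unfolding c_def[symmetric] by (simp add: norm_divide divide_le_eq del: of_real_diff)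
qed

lemma ex_gradient_magic:
  assumes "x \<in> symm_bidisc" "cmod \<omega> = 1" shows "\<exists>a b. gradient (magic \<omega>) x a b"
proof -
  have "2 + (- \<omega>) * x$1 \<noteq> 0" using magic_denom[OF assms] by simp
  then show ?thesis using gradient_divide[OF gradient_affine[of "2 * \<omega>" "- 1" 0] gradient_affine[of 0 "- \<omega>" 2], of x]
    unfolding magic_def by auto
qed

lemma holomorphic_magic: "cmod \<omega> = 1 \<Longrightarrow> holomorphic_cvec (magic \<omega>) symm_bidisc"
  unfolding holomorphic_cvec_iff using ex_gradient_magic by blast

lemma gradient_magic_axis_point: "gradient (magic \<omega>) (axis_point r) (- (1 + \<omega>\<^sup>2 * of_real r) / 2) \<omega>"
proof -
  have "gradient (magic \<omega>) (axis_point r) ((- 2 - 2 * \<omega> * complex_of_real r * \<omega>) / 4) \<omega>"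
    using gradient_divide[OF gradient_affine[of "2 * \<omega>" "- 1" 0 "axis_point r"] gradient_affine[of 0 "- \<omega>" 2 "axis_point r"]]
    unfolding magic_def by (simp add: power2_eq_square)
  moreover have "(- 2 - 2 * \<omega> * complex_of_real r * \<omega>) / 4 = - (1 + \<omega>\<^sup>2 * of_real r) / 2"
    by (simp add: power2_eq_square field_simps)
  ultimately show ?thesis by (simp only:)
qed

lemma magic_axis_point: "magic \<omega> (axis_point r) = - \<omega> * of_real r"
  by (simp add: magic_def)

lemma axis_point_mem: "0 \<le> r \<Longrightarrow> r < 1 \<Longrightarrow> axis_point r \<in> symm_bidisc"
  by (simp add: symm_bidisc_iff abs_square_less_1)

text \<open>At the origin the derivative of \<open>\<Phi>\<^sub>\<omega>\<close> is \<open>\<omega> dp - ds / 2\<close>; choosing the phase \<open>\<omega>\<close> that aligns the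
  two terms bounds the \<open>l1\<close> length of every disc through the origin.\<close>
lemma origin_disc_bound:
  assumes k: "analytic_disc k" "k 0 = axis_point 0" "disc_deriv k 0 d"
  shows "cmod (d$1) / 2 + cmod (d$2) \<le> 1"
proof -
  have 1: "cmod (\<omega> * d$2 - d$1 / 2) \<le> 1" if "cmod \<omega> = 1" for \<omega>
    using Schwarz_Pick_disc[OF k(1) holomorphic_magic[OF that] magic_in_disc[OF _ that] k(3)
      gradient_magic_axis_point[of \<omega> 0, folded k(2)]] k(2)
    by (simp add: magic_axis_point algebra_simps)
  show ?thesis
  proof (cases "d$1 = 0 \<or> d$2 = 0")
    case True
    then show ?thesis using 1[of 1] by (auto simp: norm_minus_commute norm_divide)
  next
    case False
    \<comment> \<open>The phase that gives \<open>\<omega> d\<^sub>2\<close> the argument of \<open>- d\<^sub>1 / 2\<close>.\<close>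
    define \<omega> where "\<omega> = - (d$1 / cmod (d$1)) * (cmod (d$2) / d$2)"
    have "cmod \<omega> = 1" using False by (simp add: \<omega>_def norm_mult norm_divide)
    moreover have "\<omega> * d$2 - d$1 / 2 = - (d$1 / cmod (d$1)) * of_real (cmod (d$1) / 2 + cmod (d$2))"
      using False by (simp add: \<omega>_def field_simps)
    moreover have "cmod (- (d$1 / cmod (d$1)) * of_real (cmod (d$1) / 2 + cmod (d$2))) = cmod (d$1) / 2 + cmod (d$2)"
      using False by (simp only: norm_mult norm_minus_cancel norm_divide norm_of_real) simp
    ultimately show ?thesis using 1[of \<omega>] by simp
  qed
qed

text \<open>The geodesic through \<open>(0, -r)\<close> in the direction \<open>(1, 0)\<close>. By the symmetry \<open>(s, p) \<mapsto> (-s, p)\<close> its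
  first component should be odd and its second an even Blaschke product; \<open>2 (1 - r)\<close> is the
  largest factor of \<open>z\<close> compatible with \<open>|s| \<le> 2\<close> on the unit circle, where equality holds at
  \<open>z = 1\<close> and \<open>z = -1\<close>.\<close>
definition balanced_disc :: "real \<Rightarrow> complex \<Rightarrow> complex^2" where
  "balanced_disc r z = vector [2 * (1 - of_real r) * z / (1 - of_real r * z\<^sup>2), (z\<^sup>2 - of_real r) / (1 - of_real r * z\<^sup>2)]"

lemma balanced_disc_nth:
  "balanced_disc r z $ 1 = 2 * (1 - of_real r) * z / (1 - of_real r * z\<^sup>2)"
  "balanced_disc r z $ 2 = (z\<^sup>2 - of_real r) / (1 - of_real r * z\<^sup>2)"
  by (simp_all add: balanced_disc_def)

lemma balanced_disc_denom:
  assumes "0 \<le> r" "r < 1" "cmod z \<le> 1" shows "1 - complex_of_real r * z\<^sup>2 \<noteq> 0"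
proof
  assume "1 - complex_of_real r * z\<^sup>2 = 0"
  then have "complex_of_real r * z\<^sup>2 = 1" by simp
  then have "r * (cmod z)\<^sup>2 = 1" using assms(1)
    by (metis norm_mult norm_of_real norm_one norm_power abs_of_nonneg)
  moreover have "r * (cmod z)\<^sup>2 \<le> r" using assms by (simp add: mult_left_le power_le_one)
  ultimately show False using assms by simp
qed

text \<open>Up to the factor \<open>|1 - r z\<^sup>2|\<^sup>2\<close>, the condition \<open>|s - cnj s p| < 1 - |p|\<^sup>2\<close> becomes
  \<open>2 (1 - r) (1 - |z|\<^sup>2) |z + r cnj z| < (1 - r\<^sup>2) (1 - |z|\<^sup>4)\<close>, and
  \<open>2 |z + r cnj z| \<le> 2 (1 + r) |z| < (1 + r) (1 + |z|\<^sup>2)\<close>.\<close>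
lemma balanced_disc_mem:
  assumes r: "0 \<le> r" "r < 1" and z: "cmod z < 1" shows "balanced_disc r z \<in> symm_bidisc"
proof -
  define D where "D = 1 - complex_of_real r * z\<^sup>2"
  have D: "D \<noteq> 0" using balanced_disc_denom[of r z] assms by (simp add: D_def)
  have sq: "(cmod z)\<^sup>2 < 1" using z by (simp add: abs_square_less_1)
  have "complex_of_real ((cmod D)\<^sup>2 - (cmod (z\<^sup>2 - of_real r))\<^sup>2)
      = of_real ((1 - r * r) * (1 - (cmod z)\<^sup>2 * (cmod z)\<^sup>2))"
    unfolding D_def of_real_diff of_real_mult complex_norm_square of_real_1
    by (simp add: algebra_simps power2_eq_square)
  then have e1: "(cmod D)\<^sup>2 - (cmod (z\<^sup>2 - of_real r))\<^sup>2 = (1 - r\<^sup>2) * (1 - ((cmod z)\<^sup>2)\<^sup>2)"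
    by (simp only: of_real_eq_iff power2_eq_square)
  have e2: "D * cnj D * (balanced_disc r z $ 1 - cnj (balanced_disc r z $ 1) * balanced_disc r z $ 2)
      = 2 * (1 - of_real r) * of_real (1 - (cmod z)\<^sup>2) * (z + of_real r * cnj z)"
  proof -
    define s p where "s = balanced_disc r z $ 1" and "p = balanced_disc r z $ 2"
    have s: "D * s = 2 * (1 - of_real r) * z" and p: "D * p = z\<^sup>2 - of_real r"
      using D by (simp_all add: s_def p_def balanced_disc_nth D_def[symmetric])
    have cs: "cnj D * cnj s = 2 * (1 - of_real r) * cnj z"
      using arg_cong[OF s, of cnj] by simp
    have "D * cnj D * (s - cnj s * p) = cnj D * (D * s) - (cnj D * cnj s) * (D * p)"
      by (simp add: algebra_simps)
    then have "D * cnj D * (balanced_disc r z $ 1 - cnj (balanced_disc r z $ 1) * balanced_disc r z $ 2)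
      = 2 * (1 - of_real r) * (z * cnj D - cnj z * (z\<^sup>2 - of_real r))"
      unfolding s p cs unfolding s_def p_def by (simp add: algebra_simps)
    also have "z * cnj D - cnj z * (z\<^sup>2 - of_real r) = of_real (1 - (cmod z)\<^sup>2) * (z + of_real r * cnj z)"
      unfolding of_real_diff complex_norm_square D_def by (simp add: algebra_simps power2_eq_square)
    finally show ?thesis by simp
  qed
  have "(cmod D)\<^sup>2 * cmod (balanced_disc r z $ 1 - cnj (balanced_disc r z $ 1) * balanced_disc r z $ 2)
      = cmod (D * cnj D * (balanced_disc r z $ 1 - cnj (balanced_disc r z $ 1) * balanced_disc r z $ 2))"
    by (simp add: norm_mult power2_eq_square)
  also have "\<dots> = cmod (complex_of_real (2 * (1 - r) * (1 - (cmod z)\<^sup>2)) * (z + of_real r * cnj z))"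
    unfolding e2 by simp
  also have "\<dots> = 2 * (1 - r) * (1 - (cmod z)\<^sup>2) * cmod (z + of_real r * cnj z)"
    using r sq by (simp only: norm_mult norm_of_real) simp
  also have "\<dots> \<le> 2 * (1 - r) * (1 - (cmod z)\<^sup>2) * ((1 + r) * cmod z)"
  proof (rule mult_left_mono)
    show "cmod (z + of_real r * cnj z) \<le> (1 + r) * cmod z"
      using norm_triangle_ineq[of z "of_real r * cnj z"] r by (simp add: norm_mult algebra_simps)
  qed (use r sq in simp)
  also have "\<dots> = (1 - r\<^sup>2) * (1 - (cmod z)\<^sup>2) * (2 * cmod z)"
    by (simp add: algebra_simps power2_eq_square)
  also have "\<dots> < (1 - r\<^sup>2) * (1 - (cmod z)\<^sup>2) * (1 + (cmod z)\<^sup>2)"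
  proof (rule mult_strict_left_mono)
    have "0 < (1 - cmod z)\<^sup>2" using z by simp
    then show "2 * cmod z < 1 + (cmod z)\<^sup>2" by (simp add: power2_diff)
    show "0 < (1 - r\<^sup>2) * (1 - (cmod z)\<^sup>2)" using r sq by (simp add: abs_square_less_1)
  qed
  also have "\<dots> = (cmod D)\<^sup>2 - (cmod (z\<^sup>2 - of_real r))\<^sup>2"
    unfolding e1 by (simp add: algebra_simps power2_eq_square)
  also have "\<dots> = (cmod D)\<^sup>2 * (1 - (cmod (balanced_disc r z $ 2))\<^sup>2)"
    using D by (simp add: balanced_disc_nth D_def[symmetric] norm_divide power_divide right_diff_distrib)
  finally show ?thesis using D by (simp add: symm_bidisc_iff)
qed

lemma vec2_disc_deriv:
  assumes "((\<lambda>z. h z $ 1) has_field_derivative a) (at z)" "((\<lambda>z. h z $ 2) has_field_derivative b) (at z)"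
  shows "disc_deriv h z (vector [a, b])"
  using assms by (simp add: disc_deriv_iff forall_2)

lemma analytic_disc_balanced_disc:
  assumes "0 \<le> r" "r < 1" shows "analytic_disc (balanced_disc r)"
  unfolding analytic_disc_def
proof
  fix z assume z: "z \<in> \<bbbD>"
  have d: "1 - complex_of_real r * z\<^sup>2 \<noteq> 0" using balanced_disc_denom[of r z] assms z by simp
  have "\<forall>i. (\<lambda>z. balanced_disc r z $ i) holomorphic_on \<bbbD>"
    unfolding forall_2 balanced_disc_nth using balanced_disc_denom[of r] assms
      by (auto intro!: holomorphic_intros)
  then show "balanced_disc r z \<in> symm_bidisc \<and> (\<exists>d. disc_deriv (balanced_disc r) z d)"
    using balanced_disc_mem[of r z] assms z unfolding holomorphic_disc_iff by auto
qed

lemma balanced_disc_0: "balanced_disc r 0 = axis_point r"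
  by (rule vec2_eqI) (simp_all add: balanced_disc_nth)

lemma balanced_disc_deriv: "disc_deriv (balanced_disc r) 0 (vector [2 * (1 - of_real r), 0])"
  by (rule vec2_disc_deriv) (auto simp: balanced_disc_nth intro!: derivative_eq_intros)

section \<open>Automorphisms preserve the royal variety\<close>

text \<open>Equality in \<open>|\<alpha> u + \<beta> v| \<le> |u| + |v| \<le> 1\<close> forces the two terms to have the same phase. So if
  both \<open>u\<close> and \<open>v\<close> are nonzero, the functional \<open>(\<alpha>, \<beta>)\<close> is determined up to a factor: off the
  axes the \<open>l1\<close> unit ball of \<open>\<complex>\<^sup>2\<close> is smooth.\<close>
lemma supporting_functional:
  fixes u v \<alpha> \<beta> :: complex
  assumes "cmod u + cmod v \<le> 1" "cmod \<alpha> \<le> 1" "cmod \<beta> \<le> 1" "cmod (\<alpha> * u + \<beta> * v) = 1"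
  shows "cmod u * (\<beta> * v) = cmod v * (\<alpha> * u)" "cmod u + cmod v = 1"
proof -
  have le: "cmod (\<alpha> * u) \<le> cmod u" "cmod (\<beta> * v) \<le> cmod v"
    using assms(2,3) by (simp_all add: norm_mult mult_left_le_one_le)
  have "1 \<le> cmod (\<alpha> * u) + cmod (\<beta> * v)"
    using norm_triangle_ineq[of "\<alpha> * u" "\<beta> * v"] assms(4) by simp
  then have eq: "cmod (\<alpha> * u) = cmod u" "cmod (\<beta> * v) = cmod v" "cmod u + cmod v = 1"
    using le assms(1) by linarith+
  then have "cmod (\<alpha> * u + \<beta> * v) = cmod (\<alpha> * u) + cmod (\<beta> * v)" using assms(4)
    by simp
  from iffD1[OF norm_triangle_eq this, unfolded eq]
  show "cmod u * (\<beta> * v) = cmod v * (\<alpha> * u)" by (simp only: scaleR_conv_of_real)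
  show "cmod u + cmod v = 1" by (rule eq)
qed

text \<open>The chain rule for \<open>f = (f \<circ> H) \<circ> F\<close>.\<close>
lemma gradient_aut_pair:
  assumes FH: "aut_pair F H" and x: "x \<in> symm_bidisc"
    and M: "(F has_derivative (\<lambda>v. M *v v)) (at x)"
    and f: "gradient f x a b" and g: "gradient (\<lambda>y. f (H y)) (F x) \<alpha> \<beta>"
  shows "a = \<alpha> * M$1$1 + \<beta> * M$2$1" "b = \<alpha> * M$1$2 + \<beta> * M$2$2"
proof -
  have "f (H (F y)) = f y" if "y \<in> symm_bidisc" for y using aut_pairD[OF FH that] by simp
  from has_derivative_transform_within_open[OF map_gradient[OF M g, unfolded gradient_def] open_symm_bidisc x this]
  have "gradient f x (\<alpha> * M$1$1 + \<beta> * M$2$1) (\<alpha> * M$1$2 + \<beta> * M$2$2)"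
    unfolding gradient_def by simp
  from gradient_unique[OF f this]
  show "a = \<alpha> * M$1$1 + \<beta> * M$2$1" "b = \<alpha> * M$1$2 + \<beta> * M$2$2" .
qed

lemma holomorphic_cvec_comp:
  assumes "holomorphic_cvec f symm_bidisc" "holomorphic_map H symm_bidisc" "H ` symm_bidisc \<subseteq> symm_bidisc"
  shows "holomorphic_cvec (\<lambda>x. f (H x)) symm_bidisc"
  unfolding holomorphic_cvec_iff
proof
  fix x assume x: "x \<in> symm_bidisc"
  obtain M where M: "(H has_derivative (\<lambda>v. M *v v)) (at x)"
    using assms(2) x unfolding holomorphic_map_iff by blast
  obtain a b where "gradient f (H x) a b"
    using assms(1,3) x unfolding holomorphic_cvec_iff by blast
  from map_gradient[OF M this] show "\<exists>a b. gradient (\<lambda>x. f (H x)) x a b" by blast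
qed

lemma analytic_disc_royal: "analytic_disc (\<lambda>z. vector [2 * z, z\<^sup>2])"
  and royal_disc_deriv: "disc_deriv (\<lambda>z. vector [2 * z, z\<^sup>2]) z (vector [2, 2 * z])"
proof -
  show d: "disc_deriv (\<lambda>z. vector [2 * z, z\<^sup>2]) z (vector [2, 2 * z])" for z
    by (rule vec2_disc_deriv) (auto intro!: derivative_eq_intros)
  have "vector [2 * z, z\<^sup>2] = symm z z" for z
    by (rule vec2_eqI) (simp_all add: power2_eq_square)
  then show "analytic_disc (\<lambda>z. vector [2 * z, z\<^sup>2])"
    unfolding analytic_disc_def using d symm_mem by auto
qed

lemma analytic_disc_vertical:
  assumes "m holomorphic_on \<bbbD>" "m ` \<bbbD> \<subseteq> \<bbbD>"
  shows "analytic_disc (\<lambda>z. vector [0, m z])"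
  unfolding analytic_disc_def
proof
  fix z assume z: "z \<in> \<bbbD>"
  have "(m has_field_derivative deriv m z) (at z)" using assms z by (auto intro: holomorphic_derivI)
  then have "disc_deriv (\<lambda>z. vector [0, m z]) z (vector [0, deriv m z])"
    by (intro vec2_disc_deriv) simp_all
  moreover have "m z \<in> \<bbbD>" using assms z by blast
  ultimately show "vector [0, m z] \<in> symm_bidisc \<and> (\<exists>d. disc_deriv (\<lambda>z. vector [0, m z]) z d)"
    by (auto simp: symm_bidisc_iff abs_square_less_1)
qed

lemma symm_disc_deriv:
  assumes "(m has_field_derivative c) (at z)" "(n has_field_derivative d) (at z)"
  shows "disc_deriv (\<lambda>z. symm (m z) (n z)) z (vector [c + d, m z * d + c * n z])"
  by (rule vec2_disc_deriv) (auto intro!: derivative_eq_intros assms)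

lemma analytic_disc_symm:
  assumes "m holomorphic_on \<bbbD>" "m ` \<bbbD> \<subseteq> \<bbbD>" "n holomorphic_on \<bbbD>" "n ` \<bbbD> \<subseteq> \<bbbD>"
  shows "analytic_disc (\<lambda>z. symm (m z) (n z))"
  unfolding analytic_disc_def
proof
  fix z assume z: "z \<in> \<bbbD>"
  have "(m has_field_derivative deriv m z) (at z)" "(n has_field_derivative deriv n z) (at z)"
    using assms z by (auto intro: holomorphic_derivI)
  moreover have "m z \<in> \<bbbD>" "n z \<in> \<bbbD>" using assms z by blast+
  ultimately show "symm (m z) (n z) \<in> symm_bidisc \<and> (\<exists>d. disc_deriv (\<lambda>z. symm (m z) (n z)) z d)"
    using symm_disc_deriv symm_mem by fastforce
qed

text \<open>For \<open>\<omega> = 1\<close> and \<open>\<omega> = -1\<close> the function \<open>\<Phi>\<^sub>\<omega>\<close> is extremal at \<open>x = (0, -r)\<close> in both directions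
  \<open>(1, 0)\<close> and \<open>(0, 1)\<close>, and the two derivatives are linearly independent. Pulled back to the
  origin along the supposed automorphism they become supporting functionals of the \<open>l1\<close> ball at
  the images of these directions, so by \<open>supporting_functional\<close> these images lie on the axes.
  Thus the derivative \<open>M\<close> of \<open>F\<close> at \<open>x\<close> is diagonal or antidiagonal and turns the \<open>l1\<close> norm at
  the origin into \<open>|ds| / (2 (1 - r)) + |dp| / (1 - r\<^sup>2)\<close> at \<open>x\<close>. For \<open>r = a\<^sup>2\<close> and \<open>|\<epsilon>| = 1\<close>,
  the symmetrization of two Moebius discs through \<open>a\<close> and \<open>-a\<close>, with derivatives \<open>1 - r\<close> and
  \<open>(1 - r) \<epsilon>\<close>, has norm \<open>|1 + \<epsilon>| / 2 + a |\<epsilon> - 1| / (1 + r)\<close>, which exceeds 1 for suitable \<open>\<epsilon>\<close>.\<close>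
lemma no_aut_to_origin:
  assumes r: "0 < r" "r < 1" and FH: "aut_pair F H" and Fx: "F (axis_point r) = axis_point 0"
  shows False
proof -
  let ?x = "axis_point r"
  have x: "?x \<in> symm_bidisc" using r by (simp add: axis_point_mem)
  have r2: "0 < 1 - r\<^sup>2" using r by (simp add: abs_square_less_1)
  have F: "holomorphic_map F symm_bidisc" "F ` symm_bidisc \<subseteq> symm_bidisc"
    and H: "holomorphic_map H symm_bidisc" "H ` symm_bidisc \<subseteq> symm_bidisc"
    using FH unfolding aut_pair_def by auto
  have H0: "H (axis_point 0) = ?x" using aut_pairD(3)[OF FH x] Fx by simp
  obtain M where M: "(F has_derivative (\<lambda>v. M *v v)) (at ?x)" using aut_pairD[OF FH x] by blast
  have len: "cmod ((M *v d)$1) / 2 + cmod ((M *v d)$2) \<le> 1"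
    if "analytic_disc h" "h 0 = ?x" "disc_deriv h 0 d" for h d
  proof (rule origin_disc_bound)
    show "analytic_disc (\<lambda>z. F (h z))" by (rule analytic_disc_map[OF that(1) F])
    show "F (h 0) = axis_point 0" using that(2) Fx by simp
    show "disc_deriv (\<lambda>z. F (h z)) 0 (M *v d)" using map_disc_deriv[of F M h 0 d] M that by simp
  qed
  have fn: "\<exists>\<alpha> \<beta>. cmod \<alpha> \<le> 1 \<and> cmod \<beta> \<le> 1 \<and> - (1 + of_real r) / 2 = (1 - r\<^sup>2) * (\<alpha> * M$1$1 / 2 + \<beta> * M$2$1) \<and>
      \<omega> = (1 - r\<^sup>2) * (\<alpha> * M$1$2 / 2 + \<beta> * M$2$2)" if om: "cmod \<omega> = 1" "\<omega>\<^sup>2 = 1" for \<omega>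
  proof -
    let ?f = "\<lambda>y. magic \<omega> (H y)"
    have hol: "holomorphic_cvec ?f symm_bidisc"
      by (rule holomorphic_cvec_comp[OF holomorphic_magic[OF om(1)] H])
    have b0: "axis_point 0 \<in> symm_bidisc" by (simp add: axis_point_mem)
    then obtain \<alpha> \<beta> where g: "gradient ?f (axis_point 0) \<alpha> \<beta>" using hol
      unfolding holomorphic_cvec_iff by blast
    have f1: "cmod (?f y) < 1" if "y \<in> symm_bidisc" for y
      using H that by (intro magic_in_disc om) auto
    have val: "cmod (?f (axis_point 0)) = r" unfolding H0 magic_axis_point using om r by (simp add: norm_mult)
    have fd: "cmod (\<alpha> * d$1 + \<beta> * d$2) \<le> 1 - r\<^sup>2" if "analytic_disc h" "h 0 = axis_point 0" "disc_deriv h 0 d" for h d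
      using Schwarz_Pick_disc[OF that(1) hol f1 that(3), unfolded that(2), OF _ g] val by simp
    have "cmod (2 * \<alpha>) \<le> 1 - r\<^sup>2"
      using fd[OF analytic_disc_royal _ royal_disc_deriv] by (simp add: axis_point_def mult.commute)
    moreover have "cmod \<beta> \<le> 1 - r\<^sup>2"
      using fd[OF analytic_disc_vertical[of "\<lambda>z. z"] _ vec2_disc_deriv[of _ 0 0 1]]
        by (simp add: axis_point_def)
    ultimately have le: "cmod (2 * \<alpha> / (1 - r\<^sup>2)) \<le> 1" "cmod (\<beta> / (1 - r\<^sup>2)) \<le> 1"
      using r2 by (simp_all only: norm_divide norm_of_real) (simp_all add: divide_le_eq)
    have k: "complex_of_real (1 - r\<^sup>2) \<noteq> 0" using r2 unfolding of_real_eq_0_iff by simp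
    have key: "(1 - r\<^sup>2) * (2 * \<alpha> / (1 - r\<^sup>2) * m / 2 + \<beta> / (1 - r\<^sup>2) * n) = \<alpha> * m + \<beta> * n" for m n
      using k by (simp add: distrib_left del: of_real_diff of_real_power)
    note grad = gradient_aut_pair[OF FH x M gradient_magic_axis_point, unfolded Fx, OF g]
    show ?thesis
    proof (rule exI[of _ "2 * \<alpha> / (1 - r\<^sup>2)"], rule exI[of _ "\<beta> / (1 - r\<^sup>2)"], intro conjI)
    qed (unfold key, use le grad om(2) in simp_all)
  qed
  obtain \<alpha>1 \<beta>1 where p1: "cmod \<alpha>1 \<le> 1" "cmod \<beta>1 \<le> 1"
      "- (1 + of_real r) / 2 = (1 - r\<^sup>2) * (\<alpha>1 * M$1$1 / 2 + \<beta>1 * M$2$1)"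
      "1 = (1 - r\<^sup>2) * (\<alpha>1 * M$1$2 / 2 + \<beta>1 * M$2$2)" using fn[of 1] by auto
  obtain \<alpha>2 \<beta>2 where p2: "cmod \<alpha>2 \<le> 1" "cmod \<beta>2 \<le> 1"
      "- (1 + of_real r) / 2 = (1 - r\<^sup>2) * (\<alpha>2 * M$1$1 / 2 + \<beta>2 * M$2$1)"
      "- 1 = (1 - r\<^sup>2) * (\<alpha>2 * M$1$2 / 2 + \<beta>2 * M$2$2)" using fn[of "-1"] by auto
  have indep: "(\<alpha>1 * \<beta>2 - \<alpha>2 * \<beta>1) * (M$1$1 * M$2$2 - M$1$2 * M$2$1) \<noteq> 0"
  proof
    assume zero: "(\<alpha>1 * \<beta>2 - \<alpha>2 * \<beta>1) * (M$1$1 * M$2$2 - M$1$2 * M$2$1) = 0"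
    have "K * (\<alpha>1 * a / 2 + \<beta>1 * c) * (K * (\<alpha>2 * b / 2 + \<beta>2 * d))
       - K * (\<alpha>2 * a / 2 + \<beta>2 * c) * (K * (\<alpha>1 * b / 2 + \<beta>1 * d))
       = K * K / 2 * ((\<alpha>1 * \<beta>2 - \<alpha>2 * \<beta>1) * (a * d - b * c))" for K a b c d
      by (simp add: field_simps)
    from this[of "of_real (1 - r\<^sup>2)" "M$1$1" "M$2$1" "M$1$2" "M$2$2"]
    have "(1 - r\<^sup>2) * (\<alpha>1 * M$1$1 / 2 + \<beta>1 * M$2$1) * ((1 - r\<^sup>2) * (\<alpha>2 * M$1$2 / 2 + \<beta>2 * M$2$2))
       - (1 - r\<^sup>2) * (\<alpha>2 * M$1$1 / 2 + \<beta>2 * M$2$1) * ((1 - r\<^sup>2) * (\<alpha>1 * M$1$2 / 2 + \<beta>1 * M$2$2))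
       = (1 - r\<^sup>2) * (1 - r\<^sup>2) / 2 * ((\<alpha>1 * \<beta>2 - \<alpha>2 * \<beta>1) * (M$1$1 * M$2$2 - M$1$2 * M$2$1))"
      by simp
    then have "- (1 + complex_of_real r) / 2 * - 1 - (- (1 + of_real r) / 2) * 1 = 0"
      unfolding p1(3,4)[symmetric] p2(3,4)[symmetric] zero by simp
    then have "complex_of_real (1 + r) = 0" by (simp add: add.commute)
    then show False using r unfolding of_real_eq_0_iff by simp
  qed
  have axis: "u = 0 \<or> v = 0" "cmod u + cmod v = 1"
    if "cmod u + cmod v \<le> 1" "cmod (\<alpha>1 * u + \<beta>1 * v) = 1" "cmod (\<alpha>2 * u + \<beta>2 * v) = 1" for u v
  proof -
    note s1 = supporting_functional[OF that(1) p1(1,2) that(2)]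
    note s2 = supporting_functional[OF that(1) p2(1,2) that(3)]
    show "cmod u + cmod v = 1" by (rule s1)
    show "u = 0 \<or> v = 0"
    proof (rule ccontr)
      assume nz: "\<not> (u = 0 \<or> v = 0)"
      have "cmod u * v * cmod v * u * (\<alpha>1 * \<beta>2 - \<alpha>2 * \<beta>1)
        = (cmod v * (\<alpha>1 * u)) * (cmod u * (\<beta>2 * v)) - (cmod v * (\<alpha>2 * u)) * (cmod u * (\<beta>1 * v))"
        by (simp add: algebra_simps)
      also have "\<dots> = 0" unfolding s1(1)[symmetric] s2(1)[symmetric] by simp
      finally show False using nz indep by simp
    qed
  qed
  have r1: "(1 - r\<^sup>2) = (1 - r) * (1 + r)" by (simp add: algebra_simps power2_eq_square)
  have c1: "M$1$1 = 0 \<or> M$2$1 = 0" "cmod (M$1$1) / 2 + cmod (M$2$1) = 1 / (2 * (1 - r))"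
  proof -
    have e: "(M *v vector [2 * (1 - of_real r), 0]) $ 1 = 2 * ((1 - r) * M$1$1)"
      "(M *v vector [2 * (1 - of_real r), 0]) $ 2 = 2 * (1 - r) * M$2$1"
      by (simp_all add: matrix_vec2)
    have "cmod ((1 - r) * M$1$1) + cmod (2 * (1 - r) * M$2$1) \<le> 1"
      using len[OF analytic_disc_balanced_disc balanced_disc_0 balanced_disc_deriv] r unfolding e
        by (simp add: norm_mult)
    moreover have "\<alpha> * ((1 - r) * M$1$1) + \<beta> * (2 * (1 - r) * M$2$1) = -1"
      if "- (1 + of_real r) / 2 = (1 - r\<^sup>2) * (\<alpha> * M$1$1 / 2 + \<beta> * M$2$1)"
        for \<alpha> \<beta>
    proof -
      have "(1 + r) * (\<alpha> * ((1 - r) * M$1$1) + \<beta> * (2 * (1 - r) * M$2$1)) = complex_of_real (1 + r) * - 1"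
      proof -
        have "(1 + r) * (\<alpha> * ((1 - r) * M$1$1) + \<beta> * (2 * (1 - r) * M$2$1))
          = 2 * ((1 - r\<^sup>2) * (\<alpha> * M$1$1 / 2 + \<beta> * M$2$1))"
          by (simp add: field_simps power2_eq_square)
        also have "\<dots> = 2 * (- (1 + of_real r) / 2)" unfolding that ..
        also have "\<dots> = complex_of_real (1 + r) * - 1" by simp
        finally show ?thesis .
      qed
      moreover have "complex_of_real (1 + r) \<noteq> 0" using r unfolding of_real_eq_0_iff by simp
      ultimately show ?thesis using mult_left_cancel by blast
    qed
    ultimately have "(1 - r) * M$1$1 = 0 \<or> 2 * (1 - r) * M$2$1 = 0"
      "cmod ((1 - r) * M$1$1) + cmod (2 * (1 - r) * M$2$1) = 1"
      using axis p1(3) p2(3) by (metis norm_minus_cancel norm_one)+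
    moreover have n: "cmod (of_real (1 - r)) = 1 - r" "cmod (of_real (2 * (1 - r))) = 2 * (1 - r)"
      using r by (simp_all only: norm_of_real) simp_all
    ultimately have "(1 - r) * cmod (M$1$1) + 2 * (1 - r) * cmod (M$2$1) = 1"
    and or: "M$1$1 = 0 \<or> M$2$1 = 0"
      using r by (simp_all only: norm_mult n) simp_all
    moreover have "(cmod (M$1$1) / 2 + cmod (M$2$1)) * (2 * (1 - r)) = (1 - r) * cmod (M$1$1) + 2 * (1 - r) * cmod (M$2$1)"
      by (simp add: field_simps)
    ultimately have "(cmod (M$1$1) / 2 + cmod (M$2$1)) * (2 * (1 - r)) = 1" by (simp only:)
    then show "cmod (M$1$1) / 2 + cmod (M$2$1) = 1 / (2 * (1 - r))"
      using r by (intro eq_divide_imp) simp_all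
    show "M$1$1 = 0 \<or> M$2$1 = 0" by (rule or)
  qed
  have c2: "M$1$2 = 0 \<or> M$2$2 = 0" "cmod (M$1$2) / 2 + cmod (M$2$2) = 1 / (1 - r\<^sup>2)"
  proof -
    let ?m = "mob 1 (- of_real r)"
    have rr: "cmod (- of_real r) < cmod 1" using r by simp
    have "analytic_disc (\<lambda>z. vector [0, ?m z])"
      using mob_norm(1)[OF rr] by (intro analytic_disc_vertical mob_holomorphic[OF rr]) auto
    moreover have "(?m has_field_derivative (1 - r\<^sup>2)) (at 0)"
      using mob_deriv[of "- of_real r" 0 1] by (simp add: power2_eq_square)
    then have "disc_deriv (\<lambda>z. vector [0, ?m z]) 0 (vector [0, of_real (1 - r\<^sup>2)])"
      by (intro vec2_disc_deriv) simp_all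
    ultimately have "cmod ((1 - r\<^sup>2) * M$1$2 / 2) + cmod ((1 - r\<^sup>2) * M$2$2) \<le> 1"
      using len[of "\<lambda>z. vector [0, ?m z]" "vector [0, of_real (1 - r\<^sup>2)]"]
      by (simp add: matrix_vec2 norm_mult axis_point_def mob_def norm_divide mult.commute)
    moreover have "cmod (\<alpha> * ((1 - r\<^sup>2) * M$1$2 / 2) + \<beta> * ((1 - r\<^sup>2) * M$2$2)) = 1"
      if "\<omega> = (1 - r\<^sup>2) * (\<alpha> * M$1$2 / 2 + \<beta> * M$2$2)" "cmod \<omega> = 1"
        for \<alpha> \<beta> \<omega>
    proof -
      have "\<alpha> * ((1 - r\<^sup>2) * M$1$2 / 2) + \<beta> * ((1 - r\<^sup>2) * M$2$2) = \<omega>"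
        using that(1) by (simp add: algebra_simps)
      then show ?thesis using that(2) by simp
    qed
    note val = this
    from axis[OF \<open>cmod ((1 - r\<^sup>2) * M$1$2 / 2) + cmod ((1 - r\<^sup>2) * M$2$2) \<le> 1\<close> val[OF p1(4)] val[OF p2(4)]]
    have "(1 - r\<^sup>2) * M$1$2 / 2 = 0 \<or> (1 - r\<^sup>2) * M$2$2 = 0"
      "cmod ((1 - r\<^sup>2) * M$1$2 / 2) + cmod ((1 - r\<^sup>2) * M$2$2) = 1"
      by (simp_all only: norm_minus_cancel norm_one)
    moreover have n: "cmod (of_real (1 - r\<^sup>2)) = 1 - r\<^sup>2"
      using r2 by (simp only: norm_of_real)
    moreover have k: "complex_of_real (1 - r\<^sup>2) \<noteq> 0" using r2 unfolding of_real_eq_0_iff by simp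
    ultimately have "(1 - r\<^sup>2) * cmod (M$1$2) / 2 + (1 - r\<^sup>2) * cmod (M$2$2) = 1"
    and or: "M$1$2 = 0 \<or> M$2$2 = 0"
      using k unfolding norm_mult norm_divide n by (auto simp del: of_real_diff of_real_power)
    moreover have "(cmod (M$1$2) / 2 + cmod (M$2$2)) * (1 - r\<^sup>2)
        = (1 - r\<^sup>2) * cmod (M$1$2) / 2 + (1 - r\<^sup>2) * cmod (M$2$2)"
      by (simp add: field_simps)
    ultimately have "(cmod (M$1$2) / 2 + cmod (M$2$2)) * (1 - r\<^sup>2) = 1" by (simp only:)
    then show "cmod (M$1$2) / 2 + cmod (M$2$2) = 1 / (1 - r\<^sup>2)"
      using r2 by (intro eq_divide_imp) simp_all
    show "M$1$2 = 0 \<or> M$2$2 = 0" by (rule or)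
  qed
  have l1: "cmod ((M *v d)$1) / 2 + cmod ((M *v d)$2) = cmod (d$1) / (2 * (1 - r)) + cmod (d$2) / (1 - r\<^sup>2)" for d
  proof -
    have "(M$1$2 = 0 \<and> M$2$1 = 0) \<or> (M$1$1 = 0 \<and> M$2$2 = 0)" using c1(1) c2(1) indep by auto
    then have "cmod ((M *v d)$1) / 2 + cmod ((M *v d)$2)
       = cmod (d$1) * (cmod (M$1$1) / 2 + cmod (M$2$1)) + cmod (d$2) * (cmod (M$1$2) / 2 + cmod (M$2$2))"
      by (auto simp: matrix_vec2 norm_mult algebra_simps)
    then show ?thesis unfolding c1 c2 by simp
  qed
  define a where "a = sqrt r"
  have a: "0 < a" "a < 1" "a * a = r" using r by (auto simp: a_def)
  have ca: "complex_of_real a * of_real a = of_real r" using a(3) by (simp flip: of_real_mult)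
  \<comment> \<open>With \<open>\<epsilon> = exp (2 i \<phi>)\<close> the norm is \<open>cos \<phi> + 2 a / (1 + r) sin \<phi>\<close>, and this choice is \<open>tan (\<phi> / 2) = a\<close>.\<close>
  define \<epsilon> where "\<epsilon> = ((1 + \<i> * of_real a) / (1 - \<i> * of_real a))\<^sup>2"
  define D where "D = (1 - \<i> * of_real a)\<^sup>2"
  have nm: "(cmod (1 - \<i> * of_real a))\<^sup>2 = 1 + r" "cmod (1 + \<i> * of_real a) = cmod (1 - \<i> * of_real a)"
    using a(3) r by (simp_all add: cmod_def power2_eq_square)
  have D: "cmod D = 1 + r" unfolding D_def norm_power nm ..
  then have D0: "D \<noteq> 0" using r by auto
  have "1 - \<i> * of_real a \<noteq> 0" using D0 unfolding D_def by auto
  then have e1: "cmod \<epsilon> = 1" by (simp add: \<epsilon>_def norm_power norm_divide nm)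
  have "D * \<epsilon> = (1 + \<i> * of_real a)\<^sup>2" using D0 unfolding D_def \<epsilon>_def
    by (simp add: power_divide)
  then have "D * (1 + \<epsilon>) = of_real (2 * (1 - r))" "D * (\<epsilon> - 1) = 4 * \<i> * of_real a"
    unfolding ring_distribs by (simp_all add: D_def power2_eq_square algebra_simps flip: ca)
  from arg_cong[OF this(1), of cmod] arg_cong[OF this(2), of cmod]
  have e2: "(1 + r) * cmod (1 + \<epsilon>) = 2 * (1 - r)" "(1 + r) * cmod (\<epsilon> - 1) = 4 * a"
    using r a by (simp_all only: norm_mult D norm_of_real) simp_all
  let ?m = "mob 1 (of_real a)" and ?n = "\<lambda>z. mob 1 (- of_real a) (\<epsilon> * z)"
  have aa: "cmod (of_real a) < cmod 1" "cmod (- of_real a) < cmod 1" using a by simp_all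
  have h: "analytic_disc (\<lambda>z. symm (?m z) (?n z))"
  proof (rule analytic_disc_symm)
    have "((\<lambda>z. \<epsilon> * z) ` \<bbbD>) \<subseteq> \<bbbD>" using e1 by (auto simp: norm_mult)
    then show "?n holomorphic_on \<bbbD>"
      using holomorphic_on_compose_gen[OF _ mob_holomorphic[OF aa(2)], of "\<lambda>z. \<epsilon> * z" \<bbbD>]
      unfolding o_def by (auto intro: holomorphic_intros)
    show "?n ` \<bbbD> \<subseteq> \<bbbD>" using mob_norm(1)[OF aa(2)] e1 by (auto simp: norm_mult)
    show "?m ` \<bbbD> \<subseteq> \<bbbD>" using mob_norm(1)[OF aa(1)] by auto
  qed (rule mob_holomorphic[OF aa(1)])
  have h0: "symm (?m 0) (?n 0) = axis_point r"
    by (rule vec2_eqI) (simp_all add: mob_def ca)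
  have "(?m has_field_derivative (1 - r)) (at 0)"
    using mob_deriv[of "of_real a" 0 1] by (simp add: ca)
  moreover have "(mob 1 (- of_real a) has_field_derivative (1 - r)) (at (\<epsilon> * 0))"
    using mob_deriv[of "- of_real a" 0 1] by (simp add: ca)
  from DERIV_chain2[where f = "mob 1 (- of_real a)" and g = "\<lambda>z. \<epsilon> * z"
  and x = 0, OF this, of \<epsilon> UNIV]
  have "(?n has_field_derivative ((1 - r) * \<epsilon>)) (at 0)" by (simp add: DERIV_cmult_Id)
  ultimately have "disc_deriv (\<lambda>z. symm (?m z) (?n z)) 0
      (vector [(1 - r) + (1 - r) * \<epsilon>, ?m 0 * ((1 - r) * \<epsilon>) + (1 - r) * ?n 0])"
    by (rule symm_disc_deriv)
  moreover have "(1 - r) + (1 - r) * \<epsilon> = of_real (1 - r) * (1 + \<epsilon>)"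
    "?m 0 * ((1 - r) * \<epsilon>) + (1 - r) * ?n 0 = of_real (a * (1 - r)) * (\<epsilon> - 1)"
    by (simp_all add: mob_def algebra_simps)
  ultimately have hd: "disc_deriv (\<lambda>z. symm (?m z) (?n z)) 0
      (vector [of_real (1 - r) * (1 + \<epsilon>), of_real (a * (1 - r)) * (\<epsilon> - 1)])" by simp
  have n: "cmod (of_real (1 - r) * (1 + \<epsilon>)) = (1 - r) * cmod (1 + \<epsilon>)"
    "cmod (of_real (a * (1 - r)) * (\<epsilon> - 1)) = a * (1 - r) * cmod (\<epsilon> - 1)"
    using r a by (simp_all only: norm_mult norm_of_real) simp_all
  have "(1 - r) * cmod (1 + \<epsilon>) / (2 * (1 - r)) + a * (1 - r) * cmod (\<epsilon> - 1) / (1 - r\<^sup>2) \<le> 1"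
    using len[OF h h0 hd] unfolding l1 vector_2 n .
  moreover have "cmod (1 + \<epsilon>) = 2 * (1 - r) / (1 + r)"
    using e2(1) r by (simp add: field_simps)
  then have "(1 - r) * cmod (1 + \<epsilon>) / (2 * (1 - r)) = (1 - r) / (1 + r)"
    using r by simp
  moreover have "a * (1 - r) * cmod (\<epsilon> - 1) / (1 - r\<^sup>2) = 4 * r / (1 + r)\<^sup>2"
  proof -
    have e3: "cmod (\<epsilon> - 1) = 4 * a / (1 + r)" using e2(2) r by (simp add: field_simps)
    have "a * (1 - r) * cmod (\<epsilon> - 1) / (1 - r\<^sup>2) = a * cmod (\<epsilon> - 1) / (1 + r)"
      unfolding r1 using r by simp
    also have "\<dots> = a * (4 * a / (1 + r)) / (1 + r)" unfolding e3 ..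
    also have "a * (4 * a / (1 + r)) / (1 + r) = 4 * (a * a) / (1 + r)\<^sup>2" by (simp add: power2_eq_square)
    finally show ?thesis unfolding a(3) .
  qed
  ultimately have "(1 - r) / (1 + r) + 4 * r / (1 + r)\<^sup>2 \<le> 1" by simp
  then have "(1 - r) / (1 + r) * (1 + r)\<^sup>2 + 4 * r / (1 + r)\<^sup>2 * (1 + r)\<^sup>2 \<le> (1 + r)\<^sup>2"
    using mult_right_mono[of "(1 - r) / (1 + r) + 4 * r / (1 + r)\<^sup>2" 1 "(1 + r)\<^sup>2"]
      by (simp add: distrib_right)
  then have "(1 - r) * (1 + r) + 4 * r \<le> (1 + r)\<^sup>2" using r by (simp add: power2_eq_square)
  then have "r \<le> r * r" by (simp add: power2_eq_square algebra_simps)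
  then show False using r by simp
qed

lemma royal_iff: "x \<in> royal \<longleftrightarrow> (\<exists>z. cmod z < 1 \<and> x = symm z z)"
proof -
  have "vector [2 * z, z\<^sup>2] = symm z z" for z
    by (rule vec2_eqI) (simp_all add: power2_eq_square)
  then show ?thesis unfolding royal_def by auto
qed

lemma royal_subset: "royal \<subseteq> symm_bidisc"
  by (auto simp: royal_iff intro: symm_mem)

lemma lift_mob_royal: "cmod B < cmod A \<Longrightarrow> x \<in> royal \<Longrightarrow> lift_mob A B x \<in> royal"
  using mob_norm(1)[of B A] by (fastforce simp: royal_iff lift_mob_symm)

lemma axis_point_royal_iff: "0 \<le> r \<Longrightarrow> axis_point r \<in> royal \<longleftrightarrow> r = 0"
proof
  assume "axis_point r \<in> royal"
  then obtain z where z: "axis_point r = symm z z" by (auto simp: royal_iff)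
  from arg_cong[OF z, of "\<lambda>x. x$1"] arg_cong[OF z, of "\<lambda>x. x$2"] show "r = 0" by auto
next
  assume "r = 0"
  then have "axis_point r = symm 0 0" by (intro vec2_eqI) simp_all
  then show "axis_point r \<in> royal" unfolding royal_iff by (intro exI[of _ 0]) simp
qed

text \<open>Moebius maps act transitively on the royal variety. So if an automorphism moved one of its
  points off it, composing with Moebius maps would give an automorphism taking the origin to
  some \<open>(0, -r)\<close> with \<open>r > 0\<close>, and its inverse contradicts \<open>no_aut_to_origin\<close>.\<close>
lemma aut_royal:
  assumes FH: "aut_pair F H" and x: "x \<in> royal" shows "F x \<in> royal"
proof -
  have xG: "x \<in> symm_bidisc" using x royal_subset by blast
  obtain A B r where 1: "cmod B < cmod A" "0 \<le> r" "lift_mob A B x = axis_point r"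
    using normal_form[OF xG] by blast
  have "r = 0" using lift_mob_royal[OF 1(1) x] 1 axis_point_royal_iff by simp
  note S1 = aut_pair_lift_mob[OF 1(1)]
  have yG: "F x \<in> symm_bidisc" by (rule aut_pairD[OF FH xG])
  obtain A' B' r' where 2: "cmod B' < cmod A'" "0 \<le> r'" "r' < 1" "lift_mob A' B' (F x) = axis_point r'"
    using normal_form[OF yG] by blast
  note S2 = aut_pair_lift_mob[OF 2(1)]
  have y: "lift_mob (cnj A') (- B') (axis_point r') = F x" using aut_pairD(3)[OF S2 yG] 2 by simp
  have "lift_mob A B (H (lift_mob (cnj A') (- B') (axis_point r'))) = axis_point 0"
    using aut_pairD(3)[OF FH xG] 1(3) \<open>r = 0\<close> unfolding y by simp
  then have "\<not> 0 < r'"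
    using no_aut_to_origin[OF _ 2(3) aut_pair_comp[OF aut_pair_comp[OF aut_pair_sym[OF S2] aut_pair_sym[OF FH]] S1]] by blast
  then have "r' = 0" using 2(2) by simp
  then have "axis_point r' \<in> royal" using axis_point_royal_iff by simp
  then show ?thesis using lift_mob_royal[of "- B'" "cnj A'"] 2(1) unfolding y[symmetric] by simp
qed

section \<open>Orbits of points off the royal variety\<close>

lemma rotate_axis:
  assumes "cmod z = r" shows "\<exists>e. cmod e = 1 \<and> lift_mob e 0 (axis_point r) = vector [0, z]"
proof -
  obtain u where u: "cmod u = 1" "- u * of_real r = z"
  proof (cases "r = 0")
    case True
    then show ?thesis using that[of 1] assms by simp
  next
    case False
    have "0 \<le> r" using assms by auto
    show ?thesis
      by (rule that[of "- z / of_real r"]) (use False \<open>0 \<le> r\<close> assms in \<open>simp_all add: norm_divide\<close>)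
  qed
  obtain e where e1: "cmod e = 1" and e4: "(e * e) / (cnj e * cnj e) = u"
    using rotation_root[OF u(1)] by auto
  have "(e * e) / (cnj e * cnj e) * (- of_real r) = z" unfolding e4 using u(2) by simp
  then have "lift_mob e 0 (axis_point r) = vector [0, z]"
    by (intro vec2_eqI) (simp_all add: lift_mob_nth lift_mob_den_def)
  with e1 show ?thesis by blast
qed

text \<open>The competitors for the Moebius-type distance from the royal variety. The class is invariant
  under automorphisms because the royal variety is.\<close>
definition royal_null :: "(complex^2 \<Rightarrow> complex) set" where
  "royal_null = {f. holomorphic_cvec f symm_bidisc \<and> (\<forall>y\<in>symm_bidisc. cmod (f y) \<le> 1) \<and> (\<forall>y\<in>royal. f y = 0)}"

lemma royal_null_comp:
  assumes "f \<in> royal_null" "aut_pair F H" shows "(\<lambda>x. f (F x)) \<in> royal_null"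
  using assms holomorphic_cvec_comp[of f F] aut_royal[OF assms(2)]
  unfolding royal_null_def aut_pair_def by auto

lemma royal_null_nonzero: "\<exists>f\<in>royal_null. \<forall>r>0. f (axis_point r) \<noteq> 0"
proof
  let ?f = "\<lambda>x :: complex^2. (x$1 * x$1 - 4 * x$2) * (1 / 4)"
  have "\<exists>a b. gradient ?f x a b" for x
    using gradient_mult[OF gradient_diff[OF gradient_mult[OF gradient_nth1 gradient_nth1]
        gradient_mult[OF gradient_const[of 4] gradient_nth2]] gradient_const[of "1/4"]] by blast
  moreover have f: "?f (symm z w) = (z - w) * (z - w) / 4" for z w
    by (simp add: algebra_simps)
  have "cmod (?f y) \<le> 1" if yG: "y \<in> symm_bidisc" for y
  proof -
    obtain z w where y: "y = symm z w" "cmod z < 1" "cmod w < 1" using yG unfolding mem_symm_bidisc by blast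
    have "cmod (z - w) \<le> 2" using norm_triangle_ineq4[of z w] y by simp
    then have "cmod (z - w) * cmod (z - w) \<le> 2 * 2" by (intro mult_mono) auto
    then show ?thesis unfolding y(1) f by (simp add: norm_mult norm_divide)
  qed
  moreover have "?f y = 0" if "y \<in> royal" for y using that unfolding royal_iff by auto
  ultimately show "?f \<in> royal_null" unfolding royal_null_def holomorphic_cvec_iff by auto
  show "\<forall>r>0. ?f (axis_point r) \<noteq> 0" by simp
qed

text \<open>Restrict \<open>f\<close> to the vertical disc \<open>z \<mapsto> (0, z)\<close>, where it vanishes at \<open>0\<close>. On the circle
  \<open>|z| = r'\<close> it is bounded by \<open>N\<close>, since rotations carry \<open>(0, -r')\<close> to every point of that
  circle.\<close>
lemma royal_null_Schwarz:
  assumes f: "f \<in> royal_null" and r: "0 < r" "r < r'" "r' < 1"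
    and N: "\<And>g. g \<in> royal_null \<Longrightarrow> cmod (g (axis_point r')) \<le> N"
  shows "cmod (f (axis_point r)) \<le> r / r' * N"
proof -
  have f': "holomorphic_cvec f symm_bidisc" using f by (simp add: royal_null_def)
  define \<phi> where "\<phi> = (\<lambda>z. f (vector [0, z]))"
  have hol: "\<phi> holomorphic_on \<bbbD>"
    unfolding \<phi>_def using holomorphic_along_disc[OF analytic_disc_vertical[of "\<lambda>z. z"] f'] by simp
  have "f (axis_point 0) = 0" using f axis_point_royal_iff[of 0] by (simp add: royal_null_def)
  then have "\<phi> 0 = 0" by (simp add: \<phi>_def axis_point_def)
  then obtain h where h: "h holomorphic_on \<bbbD>" "\<And>z. cmod z < 1 \<Longrightarrow> \<phi> z = z * h z"
    using Schwarz3[OF hol] by metis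
  have \<phi>N: "cmod (\<phi> z) \<le> N" if z: "cmod z = r'" for z
  proof -
    obtain e where e: "cmod e = 1" "lift_mob e 0 (axis_point r') = vector [0, z]" using rotate_axis[OF z]
      by blast
    have "(\<lambda>x. f (lift_mob e 0 x)) \<in> royal_null"
      using royal_null_comp[OF f aut_pair_lift_mob[of 0 e]] e(1) by simp
    from N[OF this] show ?thesis unfolding e(2) \<phi>_def .
  qed
  have bd: "cmod (h z) \<le> N / r'" if "cmod z = r'" for z
    using \<phi>N[OF that] h(2)[of z] that r by (simp add: norm_mult le_divide_eq mult.commute)
  have "cmod (h (- of_real r)) \<le> N / r'"
  proof (rule maximum_modulus_frontier[where S = "cball 0 r'" and f = h and \<xi> = "- complex_of_real r"])
    show "h holomorphic_on interior (cball 0 r')" using r by (intro holomorphic_on_subset[OF h(1)]) auto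
    show "continuous_on (closure (cball 0 r')) h"
      using r by (intro continuous_on_subset[OF holomorphic_on_imp_continuous_on[OF h(1)]]) auto
    show "- complex_of_real r \<in> cball 0 r'" using r by simp
  qed (use bd r in \<open>auto simp: frontier_cball\<close>)
  then have "r * cmod (h (- of_real r)) \<le> r * (N / r')" using r by (intro mult_left_mono) auto
  moreover have "f (axis_point r) = \<phi> (- of_real r)" by (simp add: \<phi>_def axis_point_def)
  ultimately show ?thesis using h(2)[of "- of_real r"] r by (simp add: norm_mult)
qed

text \<open>The supremum over the invariant class \<open>royal_null\<close> at \<open>(0, -r')\<close> is at most its value at
  \<open>(0, -r)\<close>, which for \<open>r < r'\<close> would be smaller by the factor \<open>r / r'\<close>.\<close>
lemma aut_radius_le:
  assumes FH: "aut_pair F H" and r: "0 < r" "r < 1" "r' < 1" and F: "F (axis_point r) = axis_point r'"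
  shows "r' \<le> r"
proof (rule ccontr)
  assume "\<not> r' \<le> r"
  then have rr: "r < r'" by simp
  define N where "N = (SUP f\<in>royal_null. cmod (f (axis_point r')))"
  have "axis_point r' \<in> symm_bidisc" using rr r by (intro axis_point_mem) auto
  then have bdd: "bdd_above ((\<lambda>f. cmod (f (axis_point r'))) ` royal_null)"
    unfolding royal_null_def by (intro bdd_aboveI2[of _ _ 1]) auto
  have up: "cmod (f (axis_point r')) \<le> N" if "f \<in> royal_null" for f
    unfolding N_def by (rule cSUP_upper[OF that bdd])
  obtain f0 where f0: "f0 \<in> royal_null" "f0 (axis_point r') \<noteq> 0" using royal_null_nonzero rr r by
    force
  have "0 < cmod (f0 (axis_point r'))" using f0 by simp
  also have "\<dots> \<le> N" by (rule up[OF f0(1)])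
  finally have N0: "0 < N" .
  have "N \<le> r / r' * N"
    unfolding N_def
  proof (rule cSUP_least, goal_cases)
    case (2 f)
    have "cmod (f (F (axis_point r))) \<le> r / r' * N"
      by (rule royal_null_Schwarz[OF royal_null_comp[OF 2 FH] r(1) rr r(3)]) (rule up)
    then show ?case unfolding F N_def .
  qed (use f0 in auto)
  also have "\<dots> < 1 * N" using N0 rr r by (intro mult_strict_right_mono) simp_all
  finally show False by simp
qed

lemma aut_radius:
  assumes "aut_pair F H" "0 < r" "r < 1" "0 < r'" "r' < 1" "F (axis_point r) = axis_point r'"
  shows "r = r'"
proof -
  have "H (axis_point r') = axis_point r" using aut_pairD(3)[OF assms(1) axis_point_mem[of r]] assms by simp
  then show ?thesis
    using aut_radius_le[OF assms(1,2,3,5,6)] aut_radius_le[OF aut_pair_sym[OF assms(1)] assms(4,5,3)] by simp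
qed

text \<open>The normal form of a point of the orbit has the same \<open>r\<close>; so the Moebius maps alone already give
  the whole orbit.\<close>
lemma Orb_axis_point:
  assumes r: "0 < r" "r < 1" and y: "y \<in> Orb (axis_point r)"
  shows "\<exists>A B. cmod B < cmod A \<and> y = lift_mob A B (axis_point r)"
proof -
  obtain F H where FH: "aut_pair F H" "y = F (axis_point r)" using y unfolding Orb_def Aut_G_iff by blast
  have x: "axis_point r \<in> symm_bidisc" using r by (simp add: axis_point_mem)
  have yG: "y \<in> symm_bidisc" unfolding FH(2) by (rule aut_pairD[OF FH(1) x])
  obtain A B r' where 1: "cmod B < cmod A" "0 \<le> r'" "r' < 1" "lift_mob A B y = axis_point r'"
    using normal_form[OF yG] by blast
  note S = aut_pair_lift_mob[OF 1(1)]
  have y': "y = lift_mob (cnj A) (- B) (axis_point r')" using aut_pairD(3)[OF S yG] 1 by simp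
  have "r' \<noteq> 0"
  proof
    assume "r' = 0"
    then have "axis_point r' \<in> royal" using axis_point_royal_iff by simp
    then have "y \<in> royal" using lift_mob_royal[of "- B" "cnj A"] 1(1) unfolding y' by simp
    then have "H y \<in> royal" by (rule aut_royal[OF aut_pair_sym[OF FH(1)]])
    moreover have "H y = axis_point r" using aut_pairD(3)[OF FH(1) x] FH(2) by simp
    ultimately show False using axis_point_royal_iff[of r] r by simp
  qed
  then have "r = r'"
    using aut_radius[OF aut_pair_comp[OF FH(1) S] r, of r'] 1 FH(2) by simp
  then show ?thesis using y' 1(1) by (intro exI[of _ "cnj A"] exI[of _ "- B"]) simp
qed

text \<open>Both \<open>|s\<^sup>2 - 4 p| = |z - w|\<^sup>2\<close> and \<open>2 + 2 |p|\<^sup>2 - |s|\<^sup>2\<close> are multiplied by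
  \<open>(|A|\<^sup>2 - |B|\<^sup>2)\<^sup>2 / |D|\<^sup>2\<close> with \<open>D\<close> the common denominator; their quotient is a function of
  the pseudohyperbolic distance of \<open>z\<close> and \<open>w\<close>.\<close>
lemma lift_mob_axis_point_level:
  assumes AB: "cmod B < cmod A" and r: "0 \<le> r" "r < 1" and y: "y = lift_mob A B (axis_point r)"
  shows "cmod ((y$1)\<^sup>2 - 4 * y$2) * (1 + r\<^sup>2) = 2 * r * (2 + 2 * (cmod (y$2))\<^sup>2 - (cmod (y$1))\<^sup>2)"
proof -
  define D where "D = lift_mob_den A B (axis_point r)"
  define N1 where "N1 = 2 * B * cnj A - 2 * of_real r * A * cnj B"
  define N2 where "N2 = B * B - of_real r * A * A"
  define \<Delta> where "\<Delta> = (cmod A)\<^sup>2 - (cmod B)\<^sup>2"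
  have D0: "D \<noteq> 0" unfolding D_def by (rule lift_mob_den_nz[OF AB axis_point_mem[OF r]])
  have Deq: "D = cnj A * cnj A - of_real r * cnj B * cnj B" by (simp add: D_def lift_mob_den_def algebra_simps)
  have y12: "y$1 = N1 / D" "y$2 = N2 / D"
    unfolding y lift_mob_nth D_def[symmetric] by (simp_all add: N1_def N2_def algebra_simps)
  have cD: "complex_of_real \<Delta> = A * cnj A - B * cnj B"
    unfolding \<Delta>_def of_real_diff complex_norm_square ..
  have 1: "N1\<^sup>2 - 4 * N2 * D = of_real (4 * r * \<Delta>\<^sup>2)"
    unfolding of_real_mult of_real_power cD N1_def N2_def Deq
    by (simp add: algebra_simps power2_eq_square)
  have "complex_of_real (2 * (cmod D)\<^sup>2 + 2 * (cmod N2)\<^sup>2 - (cmod N1)\<^sup>2) = of_real (2 * (\<Delta> * \<Delta>) * (1 + r * r))"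
    unfolding of_real_diff of_real_add of_real_mult of_real_1 complex_norm_square cD
    unfolding N1_def N2_def Deq
    by (simp add: algebra_simps)
  then have 2: "2 * (cmod D)\<^sup>2 + 2 * (cmod N2)\<^sup>2 - (cmod N1)\<^sup>2 = 2 * \<Delta>\<^sup>2 * (1 + r\<^sup>2)"
    unfolding of_real_eq_iff by (simp add: power2_eq_square)
  have "(y$1)\<^sup>2 - 4 * y$2 = (N1\<^sup>2 - 4 * N2 * D) / D\<^sup>2"
    unfolding y12 using D0 by (simp add: field_simps power2_eq_square)
  then have "cmod ((y$1)\<^sup>2 - 4 * y$2) = \<bar>4 * r * \<Delta>\<^sup>2\<bar> / (cmod D)\<^sup>2"
    by (simp only: 1 norm_divide norm_power norm_of_real)
  then have "cmod ((y$1)\<^sup>2 - 4 * y$2) = 4 * r * \<Delta>\<^sup>2 / (cmod D)\<^sup>2" using r by simp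
  moreover have "2 + 2 * (cmod (y$2))\<^sup>2 - (cmod (y$1))\<^sup>2 = (2 * (cmod D)\<^sup>2 + 2 * (cmod N2)\<^sup>2 - (cmod N1)\<^sup>2) / (cmod D)\<^sup>2"
    unfolding y12 using D0 by (simp add: norm_divide power_divide field_simps)
  ultimately show ?thesis unfolding 2 by simp
qed

section \<open>The sharp direction\<close>

definition cline :: "complex^2 \<Rightarrow> (complex^2) set" where
  "cline v = range (\<lambda>c. c *s v)"

lemma dim_one_iff_cline:
  "vec.subspace M \<and> vec.dim M = 1 \<longleftrightarrow> (\<exists>u. u \<noteq> 0 \<and> M = cline u)"
proof
  assume M: "vec.subspace M \<and> vec.dim M = 1"
  obtain B where B: "B \<subseteq> M" "vec.independent B" "M \<subseteq> vec.span B" "card B = vec.dim M"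
    using vec.basis_exists[of M] by blast
  then obtain u where u: "B = {u}" using M by (auto simp: card_1_singleton_iff)
  have "M = vec.span {u}" using B M u by (metis vec.span_minimal subset_antisym)
  moreover have "u \<noteq> 0" using B(2) u vec.dependent_zero by blast
  ultimately show "\<exists>u. u \<noteq> 0 \<and> M = cline u" unfolding cline_def vec.span_singleton by blast
next
  assume "\<exists>u. u \<noteq> 0 \<and> M = cline u"
  then obtain u where u: "u \<noteq> 0" "M = vec.span {u}" unfolding cline_def vec.span_singleton by blast
  then have "vec.dim M = card {u}" by (simp only: vec.dim_span) (intro vec.dim_eq_card_independent, simp)
  then show "vec.subspace M \<and> vec.dim M = 1" using u by simp
qed

lemma cline_scale:
  assumes "c \<noteq> 0" shows "cline (c *s v) = cline v"
proof -
  have "a *s (c *s v) \<in> cline v" "a *s v \<in> cline (c *s v)" for a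
    unfolding cline_def using assms
    by (auto intro: range_eqI[of _ _ "a * c"] range_eqI[of _ _ "a / c"] simp: vector_smult_assoc)
  then show ?thesis unfolding cline_def by blast
qed

lemma cline_self: "v \<in> cline v"
  unfolding cline_def by (intro range_eqI[of _ _ 1]) simp

text \<open>The content of \<open>sharp x = cline u\<close>, in a form that can be transported by automorphisms.\<close>
definition sharp_dir :: "complex^2 \<Rightarrow> complex^2 \<Rightarrow> bool" where
  "sharp_dir x u \<longleftrightarrow> u \<noteq> 0 \<and> cline u \<subseteq> real_tangent_space (Orb x) x \<and>
     (\<forall>w. w \<noteq> 0 \<and> cline w \<subseteq> real_tangent_space (Orb x) x \<longrightarrow> cline w = cline u)"

lemma sharp_dir_sharp:
  assumes "sharp_dir x u" shows "sharp x = cline u"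
  unfolding sharp_def
proof (rule the_equality)
  have "vec.subspace (cline u) \<and> vec.dim (cline u) = 1"
    using assms dim_one_iff_cline unfolding sharp_dir_def by blast
  then show "vec.subspace (cline u) \<and> vec.dim (cline u) = 1 \<and> cline u \<subseteq> real_tangent_space (Orb x) x"
    using assms unfolding sharp_dir_def by blast
next
  fix M assume "vec.subspace M \<and> vec.dim M = 1 \<and> M \<subseteq> real_tangent_space (Orb x) x"
  then show "M = cline u" using dim_one_iff_cline[of M] assms unfolding sharp_dir_def by blast
qed

lemma has_vector_derivative_zero_unique:
  assumes "(g has_vector_derivative d) (at 0)" "0 < e" "\<And>t. t \<in> {-e<..<e} \<Longrightarrow> g t = 0"
  shows "d = 0"
proof -
  have "((\<lambda>t. 0) has_vector_derivative d) (at 0)"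
    by (rule has_vector_derivative_transform_within_open[OF assms(1), of "{-e<..<e}"]) (use assms in auto)
  then show ?thesis using vector_derivative_unique_at has_vector_derivative_const by blast
qed

lemma has_vector_derivative_nth:
  "(\<gamma> has_vector_derivative v) (at t) \<Longrightarrow> ((\<lambda>t. \<gamma> t $ i) has_vector_derivative v $ i) (at t)"
  by (rule bounded_linear.has_vector_derivative[OF bounded_linear_vec_nth])

lemma Orb_iff: "y \<in> Orb x \<longleftrightarrow> (\<exists>F H. aut_pair F H \<and> y = F x)"
  unfolding Orb_def Aut_G_iff by blast

lemma aut_pair_id: "aut_pair (\<lambda>x. x) (\<lambda>x. x)"
proof -
  have "((\<lambda>x. x) has_derivative (\<lambda>v. mat 1 *v v)) (at x)" for x :: "complex^2"
    by simp
  then show ?thesis unfolding aut_pair_def holomorphic_map_iff by blast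
qed

lemma Orb_self: "x \<in> Orb x"
  using aut_pair_id unfolding Orb_iff by fastforce

lemma Orb_aut:
  assumes "aut_pair F H" "x \<in> symm_bidisc" shows "Orb (F x) = Orb x"
proof -
  have sub: "Orb (F x) \<subseteq> Orb x" if FH: "aut_pair F H" for F H x
  proof
    fix y assume "y \<in> Orb (F x)"
    then obtain F' H' where "aut_pair F' H'" "y = F' (F x)" unfolding Orb_iff by blast
    then show "y \<in> Orb x" using aut_pair_comp[OF FH, of F' H'] unfolding Orb_iff
      by (intro exI[of _ "\<lambda>x. F' (F x)"] exI[of _ "\<lambda>x. H (H' x)"]) simp
  qed
  show ?thesis
    using sub[OF assms(1), of x] sub[OF aut_pair_sym[OF assms(1)], of "F x"] aut_pairD(3)[OF assms] by auto
qed

lemma royal_normal_form: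
  assumes "x \<in> royal" shows "\<exists>A B. cmod B < cmod A \<and> lift_mob A B x = axis_point 0"
proof -
  obtain A B r where 1: "cmod B < cmod A" "0 \<le> r" "lift_mob A B x = axis_point r"
    using normal_form assms royal_subset by blast
  then have "r = 0" using lift_mob_royal[OF 1(1) assms] axis_point_royal_iff by simp
  with 1 show ?thesis by blast
qed

lemma Orb_royal:
  assumes x: "x \<in> royal" shows "Orb x = royal"
proof
  show "Orb x \<subseteq> royal" using aut_royal[OF _ x] by (auto simp: Orb_iff)
  have "Orb y = Orb (axis_point 0)" if y: "y \<in> royal" for y
  proof -
    obtain A B where "cmod B < cmod A" "lift_mob A B y = axis_point 0" using royal_normal_form[OF y] by blast
    moreover have "y \<in> symm_bidisc" using y royal_subset by blast
    ultimately show ?thesis using Orb_aut[OF aut_pair_lift_mob[of B A], of y] by simp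
  qed
  then show "royal \<subseteq> Orb x" using Orb_self x by blast
qed

lemma has_vector_derivative_vecI:
  fixes \<gamma> :: "real \<Rightarrow> 'b::euclidean_space^'n"
  assumes "\<And>i. ((\<lambda>t. \<gamma> t $ i) has_vector_derivative v $ i) (at t)"
  shows "(\<gamma> has_vector_derivative v) (at t)"
  using assms unfolding has_vector_derivative_def by (intro has_derivative_vecI) simp

lemma C1_vecI:
  fixes \<gamma> :: "real \<Rightarrow> 'b::euclidean_space^'n"
  assumes "\<And>i. (\<lambda>t. \<gamma> t $ i) C1_differentiable_on S" shows "\<gamma> C1_differentiable_on S"
proof -
  have "\<forall>i. \<exists>D. (\<forall>t\<in>S. ((\<lambda>t. \<gamma> t $ i) has_vector_derivative D t) (at t)) \<and> continuous_on S D"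
    using assms unfolding C1_differentiable_on_def by simp
  from choice[OF this] obtain D where
    D: "\<forall>i. (\<forall>t\<in>S. ((\<lambda>t. \<gamma> t $ i) has_vector_derivative D i t) (at t)) \<and> continuous_on S (D i)" ..
  have "\<forall>t\<in>S. (\<gamma> has_vector_derivative (\<chi> i. D i t)) (at t)"
    using D by (intro ballI has_vector_derivative_vecI) simp
  moreover have "continuous_on S (\<lambda>t. \<chi> i. D i t)" using D by (intro continuous_on_vec_lambda) simp
  ultimately show ?thesis unfolding C1_differentiable_on_def
    by (intro exI[of _ "\<lambda>t. \<chi> i. D i t"] conjI)
qed

lemma C1_nth:
  assumes "\<gamma> C1_differentiable_on S" shows "(\<lambda>t. \<gamma> t $ i) C1_differentiable_on S"
proof -
  obtain D where D: "\<forall>t\<in>S. (\<gamma> has_vector_derivative D t) (at t)" "continuous_on S D"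
    using assms unfolding C1_differentiable_on_def by blast
  have "continuous_on S (\<lambda>t. D t $ i)"
    by (rule bounded_linear.continuous_on[OF bounded_linear_vec_nth D(2)])
  moreover have "\<forall>t\<in>S. ((\<lambda>t. \<gamma> t $ i) has_vector_derivative D t $ i) (at t)"
    using D(1) has_vector_derivative_nth by blast
  ultimately show ?thesis unfolding C1_differentiable_on_def by (intro exI[of _ "\<lambda>t. D t $ i"] conjI)
qed

lemma C1_divide:
  fixes f g :: "real \<Rightarrow> complex"
  assumes "f C1_differentiable_on S" "g C1_differentiable_on S" "\<And>t. t \<in> S \<Longrightarrow> g t \<noteq> 0"
  shows "(\<lambda>t. f t / g t) C1_differentiable_on S"
proof -
  obtain D where D: "\<forall>t\<in>S. (g has_vector_derivative D t) (at t)" "continuous_on S D"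
    using assms(2) unfolding C1_differentiable_on_def by blast
  have cg: "continuous_on S g"
    using D(1) by (intro continuous_at_imp_continuous_on ballI has_vector_derivative_continuous) blast
  let ?E = "\<lambda>t. D t * (- (inverse (g t) ^ Suc (Suc 0)))"
  have "\<forall>t\<in>S. ((\<lambda>t. inverse (g t)) has_vector_derivative ?E t) (at t)"
    using field_vector_diff_chain_at[OF bspec[OF D(1)] DERIV_inverse[OF assms(3)]] by (simp add: o_def)
  moreover have "continuous_on S ?E"
    using assms(3) by (intro continuous_intros cg D(2)) auto
  ultimately have "(\<lambda>t. inverse (g t)) C1_differentiable_on S"
    unfolding C1_differentiable_on_def by (intro exI[of _ ?E] conjI)
  from C1_differentiable_on_mult[OF assms(1) this] show ?thesis by (simp add: divide_inverse)
qed

lemma C1_lift_mob: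
  fixes A B :: "real \<Rightarrow> complex"
  assumes "A C1_differentiable_on S" "(\<lambda>t. cnj (A t)) C1_differentiable_on S"
    "B C1_differentiable_on S" "(\<lambda>t. cnj (B t)) C1_differentiable_on S"
    "\<gamma> C1_differentiable_on S" "\<And>t. t \<in> S \<Longrightarrow> cmod (B t) < cmod (A t)" "\<gamma> ` S \<subseteq> symm_bidisc"
  shows "(\<lambda>t. lift_mob (A t) (B t) (\<gamma> t)) C1_differentiable_on S"
proof (rule C1_vecI)
  fix i :: 2
  note [simp] = assms(1-4) C1_nth[OF assms(5)]
  have den: "(\<lambda>t. lift_mob_den (A t) (B t) (\<gamma> t)) C1_differentiable_on S"
    unfolding lift_mob_den_def by simp
  have nz: "lift_mob_den (A t) (B t) (\<gamma> t) \<noteq> 0" if "t \<in> S" for t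
    using lift_mob_den_nz[OF assms(6)[OF that]] assms(7) that by blast
  have "(\<lambda>t. lift_mob (A t) (B t) (\<gamma> t) $ 1) C1_differentiable_on S"
    unfolding lift_mob_nth by (rule C1_divide[OF _ den nz]) simp_all
  moreover have "(\<lambda>t. lift_mob (A t) (B t) (\<gamma> t) $ 2) C1_differentiable_on S"
    unfolding lift_mob_nth by (rule C1_divide[OF _ den nz]) simp_all
  ultimately show "(\<lambda>t. lift_mob (A t) (B t) (\<gamma> t) $ i) C1_differentiable_on S"
    using exhaust_2[of i] by auto
qed

lemma real_tangent_spaceI:
  assumes "0 < e" "\<gamma> C1_differentiable_on {-e<..<e}" "\<And>t. \<bar>t\<bar> < e \<Longrightarrow> \<gamma> t \<in> S"
    "\<gamma> 0 = x" "(\<gamma> has_vector_derivative v) (at 0)"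
  shows "v \<in> real_tangent_space S x"
proof -
  have "\<gamma> ` {-e<..<e} \<subseteq> S" using assms(3) by (auto simp: abs_less_iff)
  then show ?thesis using assms unfolding real_tangent_space_def by blast
qed

text \<open>On the orbit, which is the royal variety, \<open>s\<^sup>2 = 4 p\<close>; differentiating at \<open>(2 z, z\<^sup>2)\<close> gives
  \<open>dp = z ds\<close>.\<close>
lemma sharp_dir_royal:
  assumes z: "cmod z < 1" shows "sharp_dir (symm z z) (vector [2, 2 * z])"
  unfolding sharp_dir_def
proof (intro conjI allI impI)
  have royal: "symm z z \<in> royal" using z royal_iff by blast
  show "vector [2, 2 * z] \<noteq> (0 :: complex^2)" by (metis vector_2(1) zero_index zero_neq_numeral)
  show "cline (vector [2, 2 * z]) \<subseteq> real_tangent_space (Orb (symm z z)) (symm z z)"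
  proof
    fix v :: "complex^2" assume "v \<in> cline (vector [2, 2 * z])"
    then obtain c where v: "v = c *s vector [2, 2 * z]" unfolding cline_def by blast
    define \<gamma> where "\<gamma> = (\<lambda>t. symm (z + of_real t * c) (z + of_real t * c))"
    define e where "e = (1 - cmod z) / (cmod c + 1)"
    have e: "e > 0" using z by (simp add: e_def add_nonneg_pos)
    have C1: "\<gamma> C1_differentiable_on {-e<..<e}"
    proof (rule C1_vecI)
      have m: "(\<lambda>t. z + of_real t * c) C1_differentiable_on {-e<..<e}"
        by (intro C1_differentiable_on_add C1_differentiable_on_mult C1_differentiable_on_of_real
            C1_differentiable_on_const)
      have "(\<lambda>t. \<gamma> t $ 1) C1_differentiable_on {-e<..<e}" "(\<lambda>t. \<gamma> t $ 2) C1_differentiable_on {-e<..<e}"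
        unfolding \<gamma>_def symm_nth
          by (rule C1_differentiable_on_add[OF m m] C1_differentiable_on_mult[OF m m])+
      then show "(\<lambda>t. \<gamma> t $ i) C1_differentiable_on {-e<..<e}" for i
        using exhaust_2[of i] by metis
    qed
    have der: "(\<gamma> has_vector_derivative v) (at 0)"
    proof (rule has_vector_derivative_vecI)
      fix i :: 2
      have "((\<lambda>t. z + of_real t * c) has_vector_derivative c) (at 0)"
        by (auto intro!: derivative_eq_intros)
      from has_vector_derivative_add[OF this this] has_vector_derivative_mult[OF this this]
      have "((\<lambda>t. \<gamma> t $ 1) has_vector_derivative v $ 1) (at 0)"
        "((\<lambda>t. \<gamma> t $ 2) has_vector_derivative v $ 2) (at 0)"
        by (simp_all add: \<gamma>_def v algebra_simps)
      then show "((\<lambda>t. \<gamma> t $ i) has_vector_derivative v $ i) (at 0)"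
        using exhaust_2[of i] by metis
    qed
    have in_royal: "\<gamma> t \<in> royal" if "\<bar>t\<bar> < e" for t
    proof -
      have pos: "0 < cmod c + 1" by (simp add: add_nonneg_pos)
      have "\<bar>t\<bar> * (cmod c + 1) < e * (cmod c + 1)" using that pos by (rule mult_strict_right_mono)
      also have "e * (cmod c + 1) = 1 - cmod z" using pos by (simp add: e_def)
      finally have "\<bar>t\<bar> * cmod c < 1 - cmod z" by (simp add: distrib_left)
      then have "cmod (z + of_real t * c) < 1" using norm_triangle_ineq[of z "of_real t * c"]
        by (simp add: norm_mult)
      then show ?thesis unfolding \<gamma>_def royal_iff
        by (intro exI[of _ "z + of_real t * c"] conjI) (rule refl | assumption)+
    qed
    have \<gamma>0: "\<gamma> 0 = symm z z" by (simp add: \<gamma>_def)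
    show "v \<in> real_tangent_space (Orb (symm z z)) (symm z z)"
      unfolding Orb_royal[OF royal] by (rule real_tangent_spaceI[OF e C1 in_royal \<gamma>0 der])
  qed
  fix w :: "complex^2" assume "w \<noteq> 0 \<and> cline w \<subseteq> real_tangent_space (Orb (symm z z)) (symm z z)"
  then have w: "w \<noteq> 0" "cline w \<subseteq> real_tangent_space (Orb (symm z z)) (symm z z)" by simp_all
  have "w \<in> real_tangent_space royal (symm z z)"
    using subsetD[OF w(2) cline_self] unfolding Orb_royal[OF royal] .
  then obtain \<gamma> e
    where \<gamma>: "0 < e" "\<gamma> ` {-e<..<e} \<subseteq> royal" "\<gamma> 0 = symm z z" "(\<gamma> has_vector_derivative w) (at 0)"
    unfolding real_tangent_space_def by blast
  have "((\<lambda>t. \<gamma> t $ 1 * \<gamma> t $ 1 - 4 * \<gamma> t $ 2) has_vector_derivative (\<gamma> 0 $ 1 * w $ 1 + w $ 1 * \<gamma> 0 $ 1 - 4 * w $ 2)) (at 0)"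
    by (intro has_vector_derivative_diff has_vector_derivative_mult has_vector_derivative_mult_right
        has_vector_derivative_nth[OF \<gamma>(4)])
  moreover have "\<gamma> t $ 1 * \<gamma> t $ 1 - 4 * \<gamma> t $ 2 = 0" if "t \<in> {-e<..<e}" for t
    using \<gamma>(2) that royal_iff[of "\<gamma> t"] by (auto simp: image_subset_iff)
  ultimately have "\<gamma> 0 $ 1 * w $ 1 + w $ 1 * \<gamma> 0 $ 1 - 4 * w $ 2 = 0"
    using has_vector_derivative_zero_unique[OF _ \<gamma>(1)] by blast
  then have "w$2 = z * w$1" using \<gamma>(3) by (simp add: algebra_simps)
  then have eq: "w = (w$1 / 2) *s vector [2, 2 * z]" by (intro vec2_eqI) simp_all
  then have "w$1 / 2 \<noteq> 0" using w(1) by (metis vector_smult_lzero)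
  then show "cline w = cline (vector [2, 2 * z])" using cline_scale eq by metis
qed

text \<open>Differentiate the square of the level equation of the orbit along a curve; squaring makes both
  sides polynomial in the real coordinates.\<close>
lemma tangent_Orb_axis_point:
  assumes r: "0 < r" "r < 1" and v: "v \<in> real_tangent_space (Orb (axis_point r)) (axis_point r)"
  shows "Re (v$2) = 0"
proof -
  obtain \<gamma> e where \<gamma>: "0 < e" "\<gamma> ` {-e<..<e} \<subseteq> Orb (axis_point r)" "\<gamma> 0 = axis_point r" "(\<gamma> has_vector_derivative v) (at 0)"
    using v unfolding real_tangent_space_def by blast
  define a b c d where "a = (\<lambda>t. Re (\<gamma> t $ 1))" and "b = (\<lambda>t. Im (\<gamma> t $ 1))"
    and "c = (\<lambda>t. Re (\<gamma> t $ 2))" and "d = (\<lambda>t. Im (\<gamma> t $ 2))"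
  have der: "(a has_real_derivative Re (v$1)) (at 0)" "(b has_real_derivative Im (v$1)) (at 0)"
    "(c has_real_derivative Re (v$2)) (at 0)" "(d has_real_derivative Im (v$2)) (at 0)"
    unfolding a_def b_def c_def d_def has_real_derivative_iff_has_vector_derivative
    using has_vector_derivative_nth[OF \<gamma>(4)]
    by (auto intro!: bounded_linear.has_vector_derivative[OF bounded_linear_Re] bounded_linear.has_vector_derivative[OF bounded_linear_Im])
  have at0: "a 0 = 0" "b 0 = 0" "c 0 = - r" "d 0 = 0" by (simp_all add: a_def b_def c_def d_def \<gamma>(3))
  define g where "g = (\<lambda>t. ((a t * a t - b t * b t - 4 * c t)\<^sup>2 + (2 * a t * b t - 4 * d t)\<^sup>2) * (1 + r\<^sup>2)\<^sup>2
      - (2 * r)\<^sup>2 * (2 + 2 * (c t * c t + d t * d t) - (a t * a t + b t * b t))\<^sup>2)"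
  have "(g has_real_derivative (2 * (4 * r) * (- 4 * Re (v$2)) * (1 + r\<^sup>2)\<^sup>2
      - (2 * r)\<^sup>2 * (2 * (2 + 2 * r\<^sup>2) * (- 4 * r * Re (v$2))))) (at 0)"
    unfolding g_def by (rule derivative_eq_intros der refl)+ (simp add: at0 power2_eq_square algebra_simps)
  then have "(g has_vector_derivative (2 * (4 * r) * (- 4 * Re (v$2)) * (1 + r\<^sup>2)\<^sup>2
      - (2 * r)\<^sup>2 * (2 * (2 + 2 * r\<^sup>2) * (- 4 * r * Re (v$2))))) (at 0)"
    unfolding has_real_derivative_iff_has_vector_derivative .
  moreover have "g t = 0" if "t \<in> {-e<..<e}" for t
  proof -
    have "\<gamma> t \<in> Orb (axis_point r)" using \<gamma>(2) that by blast
    then obtain A B where "cmod B < cmod A" "\<gamma> t = lift_mob A B (axis_point r)"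
      using Orb_axis_point[OF r] by blast
    then have "cmod ((\<gamma> t$1)\<^sup>2 - 4 * \<gamma> t$2) * (1 + r\<^sup>2) = 2 * r * (2 + 2 * (cmod (\<gamma> t$2))\<^sup>2 - (cmod (\<gamma> t$1))\<^sup>2)"
      using lift_mob_axis_point_level[of B A r "\<gamma> t"] r by simp
    then have "(cmod ((\<gamma> t$1)\<^sup>2 - 4 * \<gamma> t$2))\<^sup>2 * (1 + r\<^sup>2)\<^sup>2 = (2 * r)\<^sup>2 * (2 + 2 * (cmod (\<gamma> t$2))\<^sup>2 - (cmod (\<gamma> t$1))\<^sup>2)\<^sup>2"
      by (metis power_mult_distrib)
    moreover have "(cmod ((\<gamma> t$1)\<^sup>2 - 4 * \<gamma> t$2))\<^sup>2 = (a t * a t - b t * b t - 4 * c t)\<^sup>2 + (2 * a t * b t - 4 * d t)\<^sup>2"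
      unfolding cmod_power2 a_def b_def c_def d_def by (simp add: power2_eq_square algebra_simps)
    moreover have "(cmod (\<gamma> t$2))\<^sup>2 = c t * c t + d t * d t" "(cmod (\<gamma> t$1))\<^sup>2 = a t * a t + b t * b t"
      unfolding cmod_power2 a_def b_def c_def d_def by (simp_all add: power2_eq_square)
    ultimately show ?thesis unfolding g_def by simp
  qed
  ultimately have "2 * (4 * r) * (- 4 * Re (v$2)) * (1 + r\<^sup>2)\<^sup>2
      - (2 * r)\<^sup>2 * (2 * (2 + 2 * r\<^sup>2) * (- 4 * r * Re (v$2))) = 0"
    using has_vector_derivative_zero_unique[OF _ \<gamma>(1)] by blast
  also have "2 * (4 * r) * (- 4 * Re (v$2)) * (1 + r\<^sup>2)\<^sup>2
      - (2 * r)\<^sup>2 * (2 * (2 + 2 * r\<^sup>2) * (- 4 * r * Re (v$2))) = - 32 * r * (1 + r\<^sup>2) * (1 - r\<^sup>2) * Re (v$2)"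
    by (simp add: power2_eq_square algebra_simps)
  finally have "r * (1 + r\<^sup>2) * (1 - r\<^sup>2) * Re (v$2) = 0" by simp
  moreover have "1 + r\<^sup>2 \<noteq> 0" "1 - r\<^sup>2 \<noteq> 0"
    using r abs_square_less_1[of r] by (auto simp: power2_eq_1_iff add_nonneg_eq_0_iff)
  ultimately show ?thesis using r by simp
qed

text \<open>The Moebius maps with \<open>A = 1, B = t \<beta>\<close> move \<open>(0, -r)\<close> with velocity \<open>(2 \<beta> - 2 r cnj \<beta>, 0)\<close>, and
  \<open>\<beta>\<close> can be chosen to make the first entry any complex number. Conversely, a complex line on
  which \<open>Re dp = 0\<close> has \<open>dp = 0\<close>.\<close>
lemma sharp_dir_axis_point:
  assumes r: "0 < r" "r < 1" shows "sharp_dir (axis_point r) (vector [1, 0])"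
  unfolding sharp_dir_def
proof (intro conjI allI impI)
  show "vector [1, 0] \<noteq> (0 :: complex^2)" by (metis vector_2(1) zero_index zero_neq_one)
  have x: "axis_point r \<in> symm_bidisc" using r by (simp add: axis_point_mem)
  show "cline (vector [1, 0]) \<subseteq> real_tangent_space (Orb (axis_point r)) (axis_point r)"
  proof
    fix v :: "complex^2" assume "v \<in> cline (vector [1, 0])"
    then obtain c where c: "v = c *s vector [1, 0]" unfolding cline_def by blast
    \<comment> \<open>The solution of \<open>2 \<beta> - 2 r cnj \<beta> = c\<close>.\<close>
    define \<beta> where "\<beta> = (c + of_real r * cnj c) / (2 * (1 - of_real r * of_real r))"
    have "complex_of_real (1 - r * r) \<noteq> 0" unfolding of_real_eq_0_iff using r
      by (metis less_irrefl mult_strict_mono' mult_1 diff_eq_diff_eq diff_self less_imp_le right_minus_eq)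
    then have rr: "1 - complex_of_real r * of_real r \<noteq> 0" by simp
    have \<beta>: "2 * \<beta> - 2 * of_real r * cnj \<beta> = c"
      using rr unfolding \<beta>_def by (simp add: divide_simps) (simp add: algebra_simps)
    define \<gamma> where "\<gamma> = (\<lambda>t. lift_mob 1 (of_real t * \<beta>) (axis_point r))"
    \<comment> \<open>For \<open>|t| < e\<close> the coefficients satisfy \<open>|t \<beta>| < 1\<close>.\<close>
    define e where "e = 1 / (cmod \<beta> + 1)"
    have e: "e > 0" by (simp add: e_def add_nonneg_pos)
    have small: "cmod (of_real t * \<beta>) < cmod 1" if "\<bar>t\<bar> < e" for t
    proof -
      have pos: "0 < cmod \<beta> + 1" by (simp add: add_nonneg_pos)
      have "\<bar>t\<bar> * (cmod \<beta> + 1) < e * (cmod \<beta> + 1)" using that pos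
        by (rule mult_strict_right_mono)
      also have "e * (cmod \<beta> + 1) = 1" using pos by (simp add: e_def)
      finally show ?thesis by (simp add: norm_mult distrib_left)
    qed
    have C1: "\<gamma> C1_differentiable_on {-e<..<e}"
      unfolding \<gamma>_def
    proof (rule C1_lift_mob)
      show "(\<lambda>t. of_real t * \<beta>) C1_differentiable_on {-e<..<e}"
        "(\<lambda>t. cnj (of_real t * \<beta>)) C1_differentiable_on {-e<..<e}"
        unfolding complex_cnj_mult complex_cnj_complex_of_real
        by (intro C1_differentiable_on_mult C1_differentiable_on_of_real C1_differentiable_on_const)+
      show "cmod (of_real t * \<beta>) < cmod 1" if "t \<in> {-e<..<e}" for t
        using that by (intro small) auto
    qed (use x in auto)
    have in_orb: "\<gamma> t \<in> Orb (axis_point r)" if "\<bar>t\<bar> < e" for t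
      unfolding \<gamma>_def Orb_iff using aut_pair_lift_mob[OF small[OF that]] by blast
    have \<gamma>0: "\<gamma> 0 = axis_point r" unfolding \<gamma>_def
      by (rule vec2_eqI) (simp_all add: lift_mob_nth lift_mob_den_def)
    have der: "(\<gamma> has_vector_derivative v) (at 0)"
    proof (rule has_vector_derivative_vecI)
      fix i :: 2
      let ?D = "\<lambda>t. 1 - of_real r * (of_real t * cnj \<beta>) * (of_real t * cnj \<beta>)"
      have 1: "\<gamma> t $ 1 = of_real t * c / ?D t" for t
      proof -
        have "2 * cnj (of_real t * \<beta>) * - of_real r + 2 * (of_real t * \<beta>) = of_real t * (2 * \<beta> - 2 * of_real r * cnj \<beta>)"
          by (simp add: algebra_simps)
        then show ?thesis unfolding \<beta>
          by (simp add: \<gamma>_def lift_mob_nth lift_mob_den_def algebra_simps)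
      qed
      have 2: "\<gamma> t $ 2 = ((of_real t * \<beta>) * (of_real t * \<beta>) - of_real r) / ?D t" for t
        by (simp add: \<gamma>_def lift_mob_nth lift_mob_den_def algebra_simps)
      have q: "((\<lambda>t. n (of_real t) / ?D t) has_vector_derivative n') (at 0)"
        if "(n has_field_derivative n') (at 0)" for n n'
      proof -
        have "((\<lambda>z. n z / (1 - of_real r * (z * cnj \<beta>) * (z * cnj \<beta>))) has_field_derivative n') (at 0)"
          by (rule derivative_eq_intros that refl)+ simp_all
        then show ?thesis
          using has_vector_derivative_real_field[of "\<lambda>z. n z / (1 - of_real r * (z * cnj \<beta>) * (z * cnj \<beta>))" n' 0] by simp
      qed
      show "((\<lambda>t. \<gamma> t $ i) has_vector_derivative v $ i) (at 0)"
      proof (cases "i = 1")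
        case True
        have "((\<lambda>z. z * c) has_field_derivative c) (at 0)" by (auto intro!: derivative_eq_intros)
        from q[OF this] show ?thesis unfolding True 1 by (simp add: c)
      next
        case False
        then have i: "i = 2" using exhaust_2[of i] by blast
        have "((\<lambda>z. (z * \<beta>) * (z * \<beta>) - of_real r) has_field_derivative 0) (at 0)"
          by (auto intro!: derivative_eq_intros)
        from q[OF this] show ?thesis unfolding i 2 by (simp add: c)
      qed
    qed
    show "v \<in> real_tangent_space (Orb (axis_point r)) (axis_point r)"
      by (rule real_tangent_spaceI[OF e C1 in_orb \<gamma>0 der])
  qed
  fix w :: "complex^2" assume "w \<noteq> 0 \<and> cline w \<subseteq> real_tangent_space (Orb (axis_point r)) (axis_point r)"
  then have w: "w \<noteq> 0" "cline w \<subseteq> real_tangent_space (Orb (axis_point r)) (axis_point r)"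
    by simp_all
  have Re0: "Re (c * w$2) = 0" for c
  proof -
    have "c *s w \<in> cline w" unfolding cline_def by blast
    then show ?thesis using tangent_Orb_axis_point[OF r, of "c *s w"] w(2) by auto
  qed
  have "w$2 = 0" using Re0[of 1] Re0[of \<i>] by (simp add: complex_eq_iff)
  then have eq: "w = w$1 *s vector [1, 0]" by (intro vec2_eqI) simp_all
  then have "w$1 \<noteq> 0" using w(1) by (metis vector_smult_lzero)
  then show "cline w = cline (vector [1, 0])" using cline_scale eq by metis
qed

section \<open>Transport of tangent spaces by Moebius automorphisms\<close>

lemma aut_pair_deriv_inverse:
  assumes FH: "aut_pair F H" and x: "x \<in> symm_bidisc"
    and M: "(F has_derivative (\<lambda>v. M *v v)) (at x)"
    and N: "(H has_derivative (\<lambda>v. N *v v)) (at (F x))"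
  shows "N *v (M *v v) = v"
proof -
  have "H (F y) = y" if "y \<in> symm_bidisc" for y by (rule aut_pairD(3)[OF FH that])
  from has_derivative_transform_within_open[OF has_derivative_compose[OF M N] open_symm_bidisc x this]
  have "((\<lambda>y. y) has_derivative (\<lambda>v. N *v (M *v v))) (at x)" .
  from fun_cong[OF has_derivative_unique[OF this has_derivative_ident]] show ?thesis .
qed

lemma tangent_push:
  assumes AB: "cmod B < cmod A" and x: "x \<in> symm_bidisc"
    and M: "(lift_mob A B has_derivative (\<lambda>v. M *v v)) (at x)"
    and v: "v \<in> real_tangent_space (Orb x) x"
  shows "M *v v \<in> real_tangent_space (Orb (lift_mob A B x)) (lift_mob A B x)"
proof -
  note S = aut_pair_lift_mob[OF AB]
  obtain \<gamma> e where \<gamma>: "0 < e" "\<gamma> C1_differentiable_on {-e<..<e}" "\<gamma> ` {-e<..<e} \<subseteq> Orb x" "\<gamma> 0 = x"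
    "(\<gamma> has_vector_derivative v) (at 0)"
    using v unfolding real_tangent_space_def by blast
  have OG: "Orb x \<subseteq> symm_bidisc" using aut_pairD(1)[OF _ x] unfolding Orb_iff subset_iff by fastforce
  show ?thesis
  proof (rule real_tangent_spaceI[OF \<gamma>(1)])
    show "(\<lambda>t. lift_mob A B (\<gamma> t)) C1_differentiable_on {-e<..<e}"
      by (rule C1_lift_mob[OF _ _ _ _ \<gamma>(2)]) (use AB \<gamma>(3) OG in auto)
    show "lift_mob A B (\<gamma> t) \<in> Orb (lift_mob A B x)" if "\<bar>t\<bar> < e" for t
    proof -
      have "t \<in> {-e<..<e}" using that by auto
      then have "\<gamma> t \<in> Orb x" using \<gamma>(3) by blast
      then obtain F H where F: "aut_pair F H" "\<gamma> t = F x" unfolding Orb_iff by auto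
      then have "lift_mob A B (\<gamma> t) \<in> Orb x"
        unfolding Orb_iff F(2) by (intro exI conjI) (rule aut_pair_comp[OF F(1) S] refl)+
      then show ?thesis unfolding Orb_aut[OF S x] .
    qed
    show "lift_mob A B (\<gamma> 0) = lift_mob A B x" by (simp add: \<gamma>(4))
    have "((\<lambda>t. lift_mob A B (\<gamma> t)) has_derivative (\<lambda>s. M *v (s *\<^sub>R v))) (at 0)"
      using has_derivative_compose[OF \<gamma>(5)[unfolded has_vector_derivative_def], of "lift_mob A B" "\<lambda>v. M *v v"] M \<gamma>(4) by simp
    moreover have "M *v (s *\<^sub>R v) = s *\<^sub>R (M *v v)" for s
      by (rule vec2_eqI) (simp_all add: matrix_vec2 scaleR_add_right)
    ultimately show "((\<lambda>t. lift_mob A B (\<gamma> t)) has_vector_derivative M *v v) (at 0)"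
      unfolding has_vector_derivative_def by simp
  qed
qed

lemma cline_mult:
  assumes "w \<in> cline u" shows "M *v w \<in> cline (M *v u)"
proof -
  obtain c where "w = c *s u" using assms unfolding cline_def by auto
  then have "M *v w = c *s (M *v u)" by (simp add: vec.scale)
  then show ?thesis unfolding cline_def by (rule range_eqI)
qed

lemma cline_eqI:
  assumes "w \<in> cline u" "w \<noteq> 0" shows "cline w = cline u"
proof -
  obtain c where w: "w = c *s u" using assms unfolding cline_def by auto
  then have "c \<noteq> 0" using assms(2) by auto
  then show ?thesis unfolding w by (rule cline_scale)
qed

lemma sharp_dir_lift_mob:
  assumes AB: "cmod B < cmod A" and x: "x \<in> symm_bidisc"
    and M: "(lift_mob A B has_derivative (\<lambda>v. M *v v)) (at x)" and u: "sharp_dir x u"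
  shows "sharp_dir (lift_mob A B x) (M *v u)"
  unfolding sharp_dir_def
proof (intro conjI allI impI)
  note S = aut_pair_lift_mob[OF AB]
  let ?y = "lift_mob A B x"
  have y: "?y \<in> symm_bidisc" by (rule aut_pairD(1)[OF S x])
  have xy: "lift_mob (cnj A) (- B) ?y = x" by (rule aut_pairD(3)[OF S x])
  obtain N where N: "(lift_mob (cnj A) (- B) has_derivative (\<lambda>v. N *v v)) (at ?y)"
    using aut_pairD(6)[OF S y] by blast
  have NM: "N *v (M *v v) = v" for v by (rule aut_pair_deriv_inverse[OF S x M N])
  have MN: "M *v (N *v v) = v" for v
    by (rule aut_pair_deriv_inverse[OF aut_pair_sym[OF S] y N]) (simp add: xy M)
  have u': "u \<noteq> 0" "cline u \<subseteq> real_tangent_space (Orb x) x"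
    "\<And>w. w \<noteq> 0 \<Longrightarrow> cline w \<subseteq> real_tangent_space (Orb x) x \<Longrightarrow> cline w = cline u"
    using u unfolding sharp_dir_def by simp_all
  show "M *v u \<noteq> 0"
  proof
    assume "M *v u = 0"
    then show False using NM[of u] u'(1) by simp
  qed
  show "cline (M *v u) \<subseteq> real_tangent_space (Orb ?y) ?y"
  proof
    fix w assume "w \<in> cline (M *v u)"
    then have "N *v w \<in> cline u" using cline_mult[of w "M *v u" N] NM by simp
    then have "N *v w \<in> real_tangent_space (Orb x) x" using u'(2) by blast
    from tangent_push[OF AB x M this] show "w \<in> real_tangent_space (Orb ?y) ?y" unfolding MN .
  qed
  fix w assume "w \<noteq> 0 \<and> cline w \<subseteq> real_tangent_space (Orb ?y) ?y"
  then have w: "w \<noteq> 0" "cline w \<subseteq> real_tangent_space (Orb ?y) ?y" by simp_all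
  have AB': "cmod (- B) < cmod (cnj A)" using AB by simp
  have "cline (N *v w) \<subseteq> real_tangent_space (Orb x) x"
  proof
    fix v assume "v \<in> cline (N *v w)"
    then have "M *v v \<in> cline w" using cline_mult[of v "N *v w" M] MN by simp
    then have "M *v v \<in> real_tangent_space (Orb ?y) ?y" using w(2) by blast
    from tangent_push[OF AB' y N this] show "v \<in> real_tangent_space (Orb x) x" unfolding xy NM .
  qed
  moreover have "N *v w \<noteq> 0"
  proof
    assume "N *v w = 0"
    then show False using MN[of w] w(1) by simp
  qed
  ultimately have "cline (N *v w) = cline u" by (rule u'(3)[rotated])
  then have "N *v w \<in> cline u" using cline_self[of "N *v w"] by simp
  from cline_mult[OF this, of M] have "w \<in> cline (M *v u)" unfolding MN .
  then show "cline w = cline (M *v u)" using w(1) by (rule cline_eqI)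
qed

section \<open>Geodesics and their tangents\<close>

lemma geodesic_map_iff:
  "geodesic_map h \<longleftrightarrow> analytic_disc h \<and>
     (\<exists>\<Phi>. holomorphic_cvec \<Phi> symm_bidisc \<and> (\<forall>x\<in>symm_bidisc. cmod (\<Phi> x) < 1) \<and> (\<forall>z\<in>\<bbbD>. \<Phi> (h z) = z))"
  unfolding geodesic_map_def analytic_disc_def holomorphic_disc_iff image_subset_iff mem_ball_0 by blast

lemma geodesic_map_aut:
  assumes h: "geodesic_map h" and FH: "aut_pair F H" shows "geodesic_map (\<lambda>z. F (h z))"
proof -
  obtain \<Phi> where \<Phi>: "analytic_disc h" "holomorphic_cvec \<Phi> symm_bidisc" "\<forall>x\<in>symm_bidisc. cmod (\<Phi> x) < 1" "\<forall>z\<in>\<bbbD>. \<Phi> (h z) = z"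
    using h unfolding geodesic_map_iff by blast
  have F: "holomorphic_map F symm_bidisc" "F ` symm_bidisc \<subseteq> symm_bidisc"
    and H: "holomorphic_map H symm_bidisc" "H ` symm_bidisc \<subseteq> symm_bidisc"
    using FH unfolding aut_pair_def by auto
  have hG: "h z \<in> symm_bidisc" if "z \<in> \<bbbD>" for z using \<Phi>(1) that
    unfolding analytic_disc_def by blast
  have "analytic_disc (\<lambda>z. F (h z))" by (rule analytic_disc_map[OF \<Phi>(1) F])
  moreover have "holomorphic_cvec (\<lambda>x. \<Phi> (H x)) symm_bidisc"
    by (rule holomorphic_cvec_comp[OF \<Phi>(2) H])
  moreover have "\<forall>x\<in>symm_bidisc. cmod (\<Phi> (H x)) < 1" using \<Phi>(3) aut_pairD(2)[OF FH]
    by blast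
  moreover have "\<forall>z\<in>\<bbbD>. \<Phi> (H (F (h z))) = z" using \<Phi>(4) aut_pairD(3)[OF FH hG]
    by simp
  ultimately show ?thesis unfolding geodesic_map_iff by (intro conjI exI[of _ "\<lambda>x. \<Phi> (H x)"])
qed

lemma mob_image: assumes "cmod B < cmod A" shows "mob A B ` \<bbbD> = \<bbbD>"
proof
  show "mob A B ` \<bbbD> \<subseteq> \<bbbD>" using mob_norm(1)[OF assms] by auto
  have AB': "cmod (- B) < cmod (cnj A)" using assms by simp
  show "\<bbbD> \<subseteq> mob A B ` \<bbbD>"
  proof
    fix z :: complex assume z: "z \<in> \<bbbD>"
    have "mob A B (mob (cnj A) (- B) z) = z" using mob_inverse[OF AB', of z] z by simp
    moreover have "mob (cnj A) (- B) z \<in> \<bbbD>" using mob_norm(1)[OF AB', of z] z by simp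
    ultimately show "z \<in> mob A B ` \<bbbD>" by (metis image_eqI)
  qed
qed

lemma gradient_holomorphic_comp:
  assumes "n holomorphic_on \<bbbD>" "holomorphic_cvec f symm_bidisc" "\<forall>x\<in>symm_bidisc. cmod (f x) < 1"
  shows "holomorphic_cvec (\<lambda>x. n (f x)) symm_bidisc"
  unfolding holomorphic_cvec_iff
proof
  fix x assume x: "x \<in> symm_bidisc"
  then obtain a b where "gradient f x a b" using assms(2) unfolding holomorphic_cvec_iff by blast
  moreover have "(n has_field_derivative deriv n (f x)) (at (f x))"
    using assms x by (intro holomorphic_derivI[of n "\<bbbD>"]) auto
  ultimately show "\<exists>a b. gradient (\<lambda>x. n (f x)) x a b" using gradient_comp by blast
qed

lemma geodesic_map_reparam:
  assumes h: "geodesic_map h" and AB: "cmod B < cmod A" shows "geodesic_map (\<lambda>z. h (mob A B z))"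
proof -
  obtain \<Phi> where \<Phi>: "analytic_disc h" "holomorphic_cvec \<Phi> symm_bidisc" "\<forall>x\<in>symm_bidisc. cmod (\<Phi> x) < 1" "\<forall>z\<in>\<bbbD>. \<Phi> (h z) = z"
    using h unfolding geodesic_map_iff by blast
  have AB': "cmod (- B) < cmod (cnj A)" using AB by simp
  have "analytic_disc (\<lambda>z. h (mob A B z))"
    using mob_image[OF AB] by (intro analytic_disc_reparam[OF \<Phi>(1) mob_holomorphic[OF AB]]) simp
  moreover have "holomorphic_cvec (\<lambda>x. mob (cnj A) (- B) (\<Phi> x)) symm_bidisc"
    by (rule gradient_holomorphic_comp[OF mob_holomorphic[OF AB'] \<Phi>(2,3)])
  moreover have "\<forall>x\<in>symm_bidisc. cmod (mob (cnj A) (- B) (\<Phi> x)) < 1"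
    using \<Phi>(3) mob_norm(1)[OF AB'] by blast
  moreover have "mob (cnj A) (- B) (\<Phi> (h (mob A B z))) = z" if "z \<in> \<bbbD>" for z
    using \<Phi>(4) mob_norm(1)[OF AB, of z] mob_inverse[OF AB, of z] that by simp
  ultimately show ?thesis unfolding geodesic_map_iff
    by (intro conjI exI[of _ "\<lambda>x. mob (cnj A) (- B) (\<Phi> x)"]) simp_all
qed

lemma left_inverse_gradient:
  assumes \<Phi>: "\<forall>z\<in>\<bbbD>. \<Phi> (h z) = z" and z: "z \<in> \<bbbD>"
  and d: "disc_deriv h z d" and g: "gradient \<Phi> (h z) a b"
  shows "a * d$1 + b * d$2 = 1"
proof -
  have "((\<lambda>z. z) has_field_derivative (a * d$1 + b * d$2)) (at z)"
    by (rule has_field_derivative_transform_within_open[where f = "\<lambda>z. \<Phi> (h z)" and S = \<bbbD>])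
      (use gradient_disc[of \<Phi> h, OF g d] \<Phi> z in auto)
  then show ?thesis using DERIV_unique DERIV_ident by blast
qed

lemma geodesic_deriv_nonzero:
  assumes h: "geodesic_map h" "z \<in> \<bbbD>" "disc_deriv h z d" shows "d \<noteq> 0"
proof -
  obtain \<Phi> where \<Phi>: "analytic_disc h" "holomorphic_cvec \<Phi> symm_bidisc" "\<forall>z\<in>\<bbbD>. \<Phi> (h z) = z"
    using h(1) unfolding geodesic_map_iff by blast
  then obtain a b where "gradient \<Phi> (h z) a b" using h(2)
    unfolding holomorphic_cvec_iff analytic_disc_def by blast
  from left_inverse_gradient[OF \<Phi>(3) h(2,3) this] show ?thesis by auto
qed

text \<open>If \<open>h\<close> and \<open>k\<close> parametrize the same geodesic and \<open>\<Phi>\<close> is a left inverse of \<open>k\<close>, then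
  \<open>h = k \<circ> (\<Phi> \<circ> h)\<close>; so their derivatives at a common point are proportional, and they are
  nonzero because of the left inverses.\<close>
lemma geodesic_tangent_eq:
  assumes h: "geodesic_map h" "z \<in> \<bbbD>" "disc_deriv h z d"
  shows "geodesic_tangent (h ` \<bbbD>) (h z) = cline d"
  unfolding geodesic_tangent_def
proof (rule the_equality)
  show "\<exists>h' z'. geodesic_map h' \<and> h ` \<bbbD> = h' ` \<bbbD> \<and> z' \<in> \<bbbD> \<and> h z = h' z' \<and>
      cline d = range (\<lambda>c. c *s (\<chi> i. deriv (\<lambda>\<zeta>. h' \<zeta> $ i) z'))"
    using h disc_deriv_deriv[OF h(3)] unfolding cline_def by (intro exI[of _ h] exI[of _ z]) simp
next
  fix M assume "\<exists>k w. geodesic_map k \<and> h ` \<bbbD> = k ` \<bbbD> \<and> w \<in> \<bbbD> \<and> h z = k w \<and>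
      M = range (\<lambda>c. c *s (\<chi> i. deriv (\<lambda>\<zeta>. k \<zeta> $ i) w))"
  then obtain k w where k: "geodesic_map k" "h ` \<bbbD> = k ` \<bbbD>" "w \<in> \<bbbD>" "h z = k w"
    and M: "M = cline (\<chi> i. deriv (\<lambda>\<zeta>. k \<zeta> $ i) w)" unfolding cline_def by auto
  define d' where "d' = (\<chi> i. deriv (\<lambda>\<zeta>. k \<zeta> $ i) w)"
  obtain \<Phi> where \<Phi>: "analytic_disc k" "holomorphic_cvec \<Phi> symm_bidisc" "\<forall>z\<in>\<bbbD>. \<Phi> (k z) = z"
    using k(1) unfolding geodesic_map_iff by blast
  have ah: "analytic_disc h" using h(1) unfolding geodesic_map_iff by blast
  have d': "disc_deriv k w d'"
    unfolding d'_def by (rule holomorphic_disc_deriv[OF _ k(3)]) (use k(1) in \<open>simp add: geodesic_map_def\<close>)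
  \<comment> \<open>The change of parameter from \<open>h\<close> to \<open>k\<close>.\<close>
  define m where "m = (\<lambda>\<zeta>. \<Phi> (h \<zeta>))"
  have "m holomorphic_on \<bbbD>" unfolding m_def by (rule holomorphic_along_disc[OF ah \<Phi>(2)])
  then have m: "(m has_field_derivative deriv m z) (at z)" using h(2) by (auto intro: holomorphic_derivI)
  have mz: "m z = w" using \<Phi>(3) k(3,4) by (simp add: m_def)
  have km: "k (m \<zeta>) = h \<zeta>" if "\<zeta> \<in> \<bbbD>" for \<zeta>
  proof -
    have "h \<zeta> \<in> k ` \<bbbD>" using that unfolding k(2)[symmetric] by (rule imageI)
    then obtain \<eta> where "\<eta> \<in> \<bbbD>" "h \<zeta> = k \<eta>" by auto
    then show ?thesis using \<Phi>(3) by (simp add: m_def)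
  qed
  have "disc_deriv (\<lambda>\<zeta>. k (m \<zeta>)) z (deriv m z *s d')"
    by (rule disc_deriv_reparam[OF m]) (simp add: mz d')
  then have "disc_deriv h z (deriv m z *s d')"
    unfolding disc_deriv_def by (rule has_derivative_transform_within_open[OF _ open_ball h(2)]) (rule km)
  from disc_deriv_deriv[OF this] have "d = deriv m z *s d'" unfolding disc_deriv_deriv[OF h(3)] .
  then have "d \<in> cline d'" unfolding cline_def by (rule range_eqI)
  then have "cline d = cline d'" using geodesic_deriv_nonzero[OF h] by (rule cline_eqI)
  then show "M = cline d" unfolding M d'_def by simp
qed

lemma geodesic_map_royal: "geodesic_map (\<lambda>z. vector [2 * z, z\<^sup>2])"
proof -
  have "holomorphic_cvec (\<lambda>x. x$1 * (1/2)) symm_bidisc"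
    unfolding holomorphic_cvec_iff using gradient_mult[OF gradient_nth1 gradient_const] by blast
  moreover have "cmod (x$1 * (1/2)) < 1" if xG: "x \<in> symm_bidisc" for x
  proof -
    obtain z w where "x = symm z w" "cmod z < 1" "cmod w < 1" using xG unfolding mem_symm_bidisc by blast
    then show ?thesis using norm_triangle_ineq[of z w] by (simp add: norm_divide)
  qed
  ultimately show ?thesis unfolding geodesic_map_iff using analytic_disc_royal
    by (intro conjI exI[of _ "\<lambda>x. x$1 * (1/2)"]) simp_all
qed

text \<open>Along the balanced disc \<open>\<Phi>\<^sub>\<epsilon>\<close>, for \<open>\<epsilon> = 1\<close> and \<open>\<epsilon> = -1\<close>, is minus the Moebius map
  \<open>z \<mapsto> (z + \<epsilon> r) / (1 + \<epsilon> r z)\<close>; undoing this map gives two different left inverses.\<close>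
definition balanced_retraction :: "real \<Rightarrow> real \<Rightarrow> complex^2 \<Rightarrow> complex" where
  "balanced_retraction \<epsilon> r x = mob 1 (- of_real (\<epsilon> * r)) (- magic (of_real \<epsilon>) x)"

lemma magic_balanced_disc:
  assumes r: "0 \<le> r" "r < 1" and z: "cmod z < 1" and e: "\<epsilon> = 1 \<or> \<epsilon> = -1"
  shows "magic (of_real \<epsilon>) (balanced_disc r z) = - mob 1 (of_real (\<epsilon> * r)) z"
proof -
  have D: "1 - complex_of_real r * z\<^sup>2 \<noteq> 0" using balanced_disc_denom[of r z] assms by simp
  have e2: "complex_of_real \<epsilon> * of_real \<epsilon> = 1" using e by auto
  have "cmod (of_real \<epsilon> * z) < 1" using e z by (auto simp: norm_mult)
  then have z1: "1 - of_real \<epsilon> * z \<noteq> 0" by auto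
  have z2: "1 + of_real \<epsilon> * of_real r * z \<noteq> 0"
    using mob_denom[of "of_real (\<epsilon> * r)" 1 z] r z e by (auto simp: add.commute)
  have "magic (of_real \<epsilon>) (balanced_disc r z) =
      (2 * of_real \<epsilon> * (z\<^sup>2 - of_real r) - 2 * (1 - of_real r) * z) / (2 * (1 - of_real r * z\<^sup>2) - of_real \<epsilon> * (2 * (1 - of_real r) * z))"
  proof -
    have "(2 * of_real \<epsilon> * (p / D) - s / D) / (2 - of_real \<epsilon> * (s / D)) = (2 * of_real \<epsilon> * p - s) / (2 * D - of_real \<epsilon> * s)"
      if "D \<noteq> 0" for p s D :: complex
    proof -
      have "(2 * of_real \<epsilon> * (p / D) - s / D) = (2 * of_real \<epsilon> * p - s) / D" "2 - of_real \<epsilon> * (s / D) = (2 * D - of_real \<epsilon> * s) / D"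
        using that by (simp_all add: diff_divide_distrib)
      then show ?thesis using that by simp
    qed
    from this[OF D] show ?thesis unfolding magic_def balanced_disc_nth .
  qed
  also have "2 * of_real \<epsilon> * (z\<^sup>2 - of_real r) - 2 * (1 - of_real r) * z = - 2 * (1 - of_real \<epsilon> * z) * (z + of_real (\<epsilon> * r))"
    using e by (auto simp: algebra_simps power2_eq_square)
  also have "2 * (1 - of_real r * z\<^sup>2) - of_real \<epsilon> * (2 * (1 - of_real r) * z) = 2 * (1 - of_real \<epsilon> * z) * (1 + of_real \<epsilon> * of_real r * z)"
    using e by (auto simp: algebra_simps power2_eq_square)
  also have "- 2 * (1 - of_real \<epsilon> * z) * (z + of_real (\<epsilon> * r)) / (2 * (1 - of_real \<epsilon> * z) * (1 + of_real \<epsilon> * of_real r * z))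
      = - ((z + of_real (\<epsilon> * r)) / (1 + of_real \<epsilon> * of_real r * z))"
  proof -
    have "- 2 * u * n / (2 * u * m) = - (n / m)" if "u \<noteq> 0" for u n m :: complex
      using that by simp
    from this[OF z1] show ?thesis .
  qed
  finally show ?thesis by (simp add: mob_def add.commute)
qed

lemma balanced_retraction_props:
  assumes r: "0 \<le> r" "r < 1" and e: "\<epsilon> = 1 \<or> \<epsilon> = -1"
  shows "holomorphic_cvec (balanced_retraction \<epsilon> r) symm_bidisc" "\<forall>x\<in>symm_bidisc. cmod (balanced_retraction \<epsilon> r x) < 1"
    "\<forall>z\<in>\<bbbD>. balanced_retraction \<epsilon> r (balanced_disc r z) = z"
    "\<And>x y. x \<in> symm_bidisc \<Longrightarrow> y \<in> symm_bidisc \<Longrightarrow> balanced_retraction \<epsilon> r x = balanced_retraction \<epsilon> r y \<Longrightarrow> magic (of_real \<epsilon>) x = magic (of_real \<epsilon>) y"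
proof -
  have n: "cmod (- of_real (\<epsilon> * r)) < cmod 1" "cmod (of_real (\<epsilon> * r)) < cmod 1" "cmod (of_real \<epsilon>) = 1"
    using r e by auto
  have mg: "\<forall>x\<in>symm_bidisc. cmod (- magic (of_real \<epsilon>) x) < 1"
    using magic_in_disc[OF _ n(3)] by simp
  have "(\<lambda>z. mob 1 (- of_real (\<epsilon> * r)) (- z)) holomorphic_on \<bbbD>"
    using holomorphic_on_compose_gen[OF holomorphic_on_minus[OF holomorphic_on_ident] mob_holomorphic[OF n(1)], of \<bbbD>]
    unfolding o_def by (simp add: image_subset_iff)
  from gradient_holomorphic_comp[OF this holomorphic_magic[OF n(3)]] mg
  show "holomorphic_cvec (balanced_retraction \<epsilon> r) symm_bidisc" unfolding balanced_retraction_def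
    by simp
  show "\<forall>x\<in>symm_bidisc. cmod (balanced_retraction \<epsilon> r x) < 1"
    unfolding balanced_retraction_def using mob_norm(1)[OF n(1)] mg by blast
  show "\<forall>z\<in>\<bbbD>. balanced_retraction \<epsilon> r (balanced_disc r z) = z"
    unfolding balanced_retraction_def using magic_balanced_disc[OF r _ e] mob_inverse[OF n(2)] by simp
  fix x y assume xy: "x \<in> symm_bidisc" "y \<in> symm_bidisc" "balanced_retraction \<epsilon> r x = balanced_retraction \<epsilon> r y"
  have "mob 1 (of_real (\<epsilon> * r)) (balanced_retraction \<epsilon> r x) = - magic (of_real \<epsilon>) x" if "x \<in> symm_bidisc" for x
    using mob_inverse[OF n(1), of "- magic (of_real \<epsilon>) x"] mg that
      unfolding balanced_retraction_def by (simp add: less_imp_le)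
  from this[OF xy(1)] this[OF xy(2)] xy(3) show "magic (of_real \<epsilon>) x = magic (of_real \<epsilon>) y" by simp
qed

lemma geodesic_map_balanced_disc: "0 \<le> r \<Longrightarrow> r < 1 \<Longrightarrow> geodesic_map (balanced_disc r)"
  unfolding geodesic_map_iff using analytic_disc_balanced_disc balanced_retraction_props(1-3)[of r 1] by blast

text \<open>Let \<open>k\<close> be another geodesic map with \<open>k 0 = (0, -r)\<close> and \<open>k' 0 = (c, 0)\<close>. A left inverse of \<open>k\<close>
  along the balanced disc shows \<open>|c| \<ge> 2 (1 - r)\<close>. So both left inverses of the balanced disc
  have derivative \<open>\<alpha> = c / (2 (1 - r))\<close> of modulus at least 1 along \<open>k\<close>, and by Schwarz's lemma
  they are \<open>z \<mapsto> \<alpha> z\<close> there. Since the two together separate points, \<open>k\<close> is the balanced disc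
  reparametrized by a rotation.\<close>
lemma geodesic_unique_axis_point:
  assumes r: "0 \<le> r" "r < 1"
  and D: "geodesic D" "axis_point r \<in> D" "geodesic_tangent D (axis_point r) = cline (vector [1, 0])"
  shows "D = balanced_disc r ` \<bbbD>"
proof -
  obtain k0 z0 where k0: "geodesic_map k0" "D = k0 ` \<bbbD>" "z0 \<in> \<bbbD>" "axis_point r = k0 z0"
    using D(1,2) unfolding geodesic_def by blast
  have z0: "cmod z0 < cmod 1" using k0(3) by simp
  \<comment> \<open>Reparametrized so that \<open>k 0\<close> is the base point.\<close>
  define k where "k = (\<lambda>z. k0 (mob 1 z0 z))"
  have k: "geodesic_map k" unfolding k_def by (rule geodesic_map_reparam[OF k0(1) z0])
  have kD: "D = k ` \<bbbD>" unfolding k_def k0(2) using mob_image[OF z0] by (metis image_image)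
  have k00: "k 0 = axis_point r" unfolding k_def k0(4) by (simp add: mob_def)
  obtain \<Psi> where \<Psi>: "analytic_disc k" "holomorphic_cvec \<Psi> symm_bidisc" "\<forall>x\<in>symm_bidisc. cmod (\<Psi> x) < 1" "\<forall>z\<in>\<bbbD>. \<Psi> (k z) = z"
    using k unfolding geodesic_map_iff by blast
  obtain d where d: "disc_deriv k 0 d" using \<Psi>(1) unfolding analytic_disc_def by force
  have "cline d = cline (vector [1, 0])"
    using geodesic_tangent_eq[OF k _ d] D(3) unfolding kD k00 by simp
  then have "d \<in> cline (vector [1, 0])" using cline_self[of d] by simp
  then obtain c where c: "d = c *s vector [1, 0]" unfolding cline_def by blast
  have x: "axis_point r \<in> symm_bidisc" using r by (rule axis_point_mem)
  have c1: "1 \<le> cmod (c / (2 * of_real (1 - r)))"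
  proof -
    obtain a b where g: "gradient \<Psi> (axis_point r) a b" using \<Psi>(2) x
      unfolding holomorphic_cvec_iff by blast
    have "a * c = 1"
      using left_inverse_gradient[OF \<Psi>(4) _ d, unfolded k00, OF _ g] by (simp add: c)
    moreover have "cmod (a * (2 * of_real (1 - r))) \<le> 1"
      using Schwarz_Pick_disc[OF analytic_disc_balanced_disc[OF r] \<Psi>(2) _ balanced_disc_deriv, of a b] \<Psi>(3) g
      by (simp add: balanced_disc_0 order_trans)
    ultimately have "cmod a * cmod (2 * of_real (1 - r)) \<le> cmod a * cmod c"
      by (simp only: norm_mult[symmetric]) simp
    moreover have "0 < cmod a" using \<open>a * c = 1\<close> by auto
    ultimately have "cmod (2 * of_real (1 - r)) \<le> cmod c" by (simp only: mult_le_cancel_left_pos)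
    moreover have "0 < cmod (2 * of_real (1 - r))" using r by (simp only: norm_mult norm_of_real) simp
    ultimately show ?thesis by (simp only: norm_divide le_divide_eq) simp
  qed
  define \<alpha> where "\<alpha> = c / (2 * of_real (1 - r))"
  have lin: "cmod \<alpha> = 1 \<and> (\<forall>z\<in>\<bbbD>. balanced_retraction \<epsilon> r (k z) = \<alpha> * z)" if e: "\<epsilon> = 1 \<or> \<epsilon> = -1" for \<epsilon>
  proof -
    note L = balanced_retraction_props[OF r e]
    obtain a b where g: "gradient (balanced_retraction \<epsilon> r) (axis_point r) a b" using L(1) x
      unfolding holomorphic_cvec_iff by blast
    have "a * (2 * of_real (1 - r)) = 1"
      using left_inverse_gradient[OF L(3) _ balanced_disc_deriv, unfolded balanced_disc_0, OF _ g] by simp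
    then have "a = 1 / (2 * of_real (1 - r))" by (metis eq_divide_imp mult_zero_right zero_neq_one)
    then have ac: "a * c = \<alpha>" unfolding \<alpha>_def by simp
    let ?\<phi> = "\<lambda>z. balanced_retraction \<epsilon> r (k z)"
    have hol: "?\<phi> holomorphic_on \<bbbD>" by (rule holomorphic_along_disc[OF \<Psi>(1) L(1)])
    have "balanced_retraction \<epsilon> r (axis_point r) = 0" using L(3) balanced_disc_0[of r]
      by (metis centre_in_ball zero_less_one)
    then have \<phi>0: "?\<phi> 0 = 0" by (simp add: k00)
    have \<phi>1: "cmod (?\<phi> z) < 1" if "cmod z < 1" for z
      using L(2) \<Psi>(1) that unfolding analytic_disc_def by simp
    have "(?\<phi> has_field_derivative (a * d$1 + b * d$2)) (at 0)"
      by (rule gradient_disc[OF _ d]) (simp add: k00 g)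
    then have \<phi>': "(?\<phi> has_field_derivative \<alpha>) (at 0)" using ac by (simp add: c)
    then have "cmod \<alpha> \<le> 1"
      using Schwarz_Lemma(2)[OF hol \<phi>0 \<phi>1, of 0] DERIV_imp_deriv[OF \<phi>'] by simp
    then have \<alpha>1: "cmod \<alpha> = 1" using c1 unfolding \<alpha>_def by simp
    then obtain \<beta> where \<beta>: "\<forall>z. cmod z < 1 \<longrightarrow> ?\<phi> z = \<beta> * z"
      using Schwarz_Lemma(3)[OF hol \<phi>0 \<phi>1, of 0] DERIV_imp_deriv[OF \<phi>'] by auto
    have "((\<lambda>z. \<beta> * z) has_field_derivative \<alpha>) (at 0)"
      by (rule has_field_derivative_transform_within_open[OF \<phi>', of \<bbbD>]) (use \<beta> in auto)
    then have "\<alpha> = \<beta>" using DERIV_unique DERIV_cmult_Id by blast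
    then show ?thesis using \<alpha>1 \<beta> by simp
  qed
  have \<alpha>1: "cmod \<alpha> = 1" using lin[of 1] by simp
  have keq: "k z = balanced_disc r (\<alpha> * z)" if z: "z \<in> \<bbbD>" for z
  proof -
    have az: "\<alpha> * z \<in> \<bbbD>" using z \<alpha>1 by (simp add: norm_mult)
    have kG: "k z \<in> symm_bidisc" "balanced_disc r (\<alpha> * z) \<in> symm_bidisc"
      using \<Psi>(1) z analytic_disc_balanced_disc[OF r] az unfolding analytic_disc_def by simp_all
    have "magic (of_real \<epsilon>) (k z) = magic (of_real \<epsilon>) (balanced_disc r (\<alpha> * z))" if e: "\<epsilon> = 1 \<or> \<epsilon> = -1" for \<epsilon>
    proof (rule balanced_retraction_props(4)[OF r e kG])
      show "balanced_retraction \<epsilon> r (k z) = balanced_retraction \<epsilon> r (balanced_disc r (\<alpha> * z))"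
        using balanced_retraction_props(3)[OF r e] lin[OF e] z az by simp
    qed
    from magic_determine[OF kG] this[of 1] this[of "-1"] show ?thesis by simp
  qed
  have rot: "(\<lambda>z. \<alpha> * z) ` \<bbbD> = \<bbbD>"
  proof
    show "(\<lambda>z. \<alpha> * z) ` \<bbbD> \<subseteq> \<bbbD>" using \<alpha>1 by (auto simp: norm_mult)
    show "\<bbbD> \<subseteq> (\<lambda>z. \<alpha> * z) ` \<bbbD>"
    proof
      fix z :: complex assume "z \<in> \<bbbD>"
      then have "z / \<alpha> \<in> \<bbbD>" "z = \<alpha> * (z / \<alpha>)" using \<alpha>1
        by (auto simp: norm_divide)
      then show "z \<in> (\<lambda>z. \<alpha> * z) ` \<bbbD>" by blast
    qed
  qed
  have "k ` \<bbbD> = balanced_disc r ` ((\<lambda>z. \<alpha> * z) ` \<bbbD>)" unfolding image_image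
    using keq by (intro image_cong) auto
  then show ?thesis unfolding kD rot .
qed

section \<open>Closures and royal nodes\<close>

lemma closure_image_ball:
  fixes g :: "complex \<Rightarrow> 'a::t2_space"
  assumes "continuous_on (cball 0 1) g"
  shows "closure (g ` \<bbbD>) = g ` cball 0 1"
proof
  have "compact (g ` cball 0 1)" using assms by (intro compact_continuous_image) auto
  then have "closed (g ` cball 0 1)" by (rule compact_imp_closed)
  then show "closure (g ` \<bbbD>) \<subseteq> g ` cball 0 1" by (intro closure_minimal image_mono) auto
  have "g ` closure \<bbbD> \<subseteq> closure (g ` \<bbbD>)"
    using assms by (intro image_closure_subset) (auto intro: closure_subset[THEN subsetD])
  then show "g ` cball 0 1 \<subseteq> closure (g ` \<bbbD>)" by simp
qed

lemma continuous_on_vec2I: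
  fixes g :: "'a::topological_space \<Rightarrow> complex^2"
  assumes "continuous_on S (\<lambda>z. g z $ 1)" "continuous_on S (\<lambda>z. g z $ 2)"
  shows "continuous_on S g"
proof -
  have "continuous_on S (\<lambda>z. g z $ i)" for i using assms exhaust_2[of i] by auto
  then have "continuous_on S (\<lambda>z. \<chi> i. g z $ i)" by (rule continuous_on_vec_lambda)
  then show ?thesis by simp
qed

text \<open>A closed set containing the symmetrized bidisc on which the maps induced by Moebius maps are
  still defined and continuous.\<close>
definition closed_symm_bidisc :: "(complex^2) set" where
  "closed_symm_bidisc = {symm z w | z w. cmod z \<le> 1 \<and> cmod w \<le> 1}"

lemma mem_closed_symm_bidisc:
  "x \<in> closed_symm_bidisc \<longleftrightarrow> (\<exists>z w. cmod z \<le> 1 \<and> cmod w \<le> 1 \<and> x = symm z w)"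
  unfolding closed_symm_bidisc_def by blast

lemma closed_closed_symm_bidisc: "closed closed_symm_bidisc"
proof -
  have "continuous_on (cball 0 1 \<times> cball 0 1) (\<lambda>p. symm (fst p) (snd p))"
    by (rule continuous_on_vec2I) (auto intro!: continuous_intros)
  then have "compact ((\<lambda>p. symm (fst p) (snd p)) ` (cball 0 1 \<times> cball 0 1))"
    by (intro compact_continuous_image compact_Times) auto
  moreover have "closed_symm_bidisc = (\<lambda>p. symm (fst p) (snd p)) ` (cball 0 1 \<times> cball 0 1)"
    by (simp add: set_eq_iff mem_closed_symm_bidisc image_iff Bex_def)
  ultimately show ?thesis using compact_imp_closed by simp
qed

lemma balanced_disc_closed:
  assumes r: "0 \<le> r" "r < 1"
  shows "continuous_on (cball 0 1) (balanced_disc r)" "balanced_disc r ` cball 0 1 \<subseteq> closed_symm_bidisc"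
proof -
  show c: "continuous_on (cball 0 1) (balanced_disc r)"
    using balanced_disc_denom[OF r]
      by (intro continuous_on_vec2I) (auto simp: balanced_disc_nth intro!: continuous_intros)
  have "balanced_disc r ` \<bbbD> \<subseteq> closed_symm_bidisc"
  proof
    fix x assume "x \<in> balanced_disc r ` \<bbbD>"
    then have "x \<in> symm_bidisc" using balanced_disc_mem[OF r] by auto
    then obtain z w where zw: "cmod z < 1" "cmod w < 1" "x = symm z w" unfolding mem_symm_bidisc by auto
    show "x \<in> closed_symm_bidisc" unfolding mem_closed_symm_bidisc
      using zw by (intro exI[of _ z] exI[of _ w]) simp
  qed
  then show "balanced_disc r ` cball 0 1 \<subseteq> closed_symm_bidisc"
    unfolding closure_image_ball[OF c, symmetric] using closed_closed_symm_bidisc by (rule closure_minimal)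
qed

lemma lift_mob_continuous:
  assumes AB: "cmod B < cmod A" shows "continuous_on closed_symm_bidisc (lift_mob A B)"
proof -
  have "lift_mob_den A B x \<noteq> 0" if x: "x \<in> closed_symm_bidisc" for x
  proof -
    obtain z w where "cmod z \<le> 1" "cmod w \<le> 1" "x = symm z w" using x
      unfolding mem_closed_symm_bidisc by auto
    then show ?thesis using mob_denom[OF AB] by (simp add: lift_mob_den_symm)
  qed
  moreover have "continuous_on closed_symm_bidisc (lift_mob_den A B)"
    unfolding lift_mob_den_def by (intro continuous_intros)
  ultimately show ?thesis
    by (intro continuous_on_vec2I) (auto simp: lift_mob_nth intro!: continuous_intros)
qed

lemma closure_royal: "closure royal = (\<lambda>z. symm z z) ` cball 0 1"
proof -
  have r: "royal = (\<lambda>z. symm z z) ` \<bbbD>" by (simp add: set_eq_iff royal_iff image_iff Bex_def)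
  have "continuous_on (cball 0 1) (\<lambda>z. symm z z)"
    by (rule continuous_on_vec2I) (auto intro!: continuous_intros)
  then show ?thesis unfolding r by (rule closure_image_ball)
qed

lemma symm_diagonal: "symm a b = symm w w \<Longrightarrow> a = w \<and> b = w"
proof -
  assume eq: "symm a b = symm w w"
  from arg_cong[OF eq, of "\<lambda>x. x$1"] arg_cong[OF eq, of "\<lambda>x. x$2"]
  have "a + b = 2 * w" "a * b = w * w" by simp_all
  then have "(a - w) * (a - w) = 0" by algebra
  then have "a = w" by simp
  then show "a = w \<and> b = w" using \<open>a + b = 2 * w\<close> by simp
qed

text \<open>On the diagonal \<open>s\<^sup>2 = 4 p\<close>, and \<open>s\<^sup>2 - 4 p\<close> is a multiple of \<open>r (z\<^sup>2 - 1)\<^sup>2\<close> along the balanced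
  disc.\<close>
lemma balanced_disc_royal_node:
  assumes r: "0 < r" "r < 1" and z: "cmod z \<le> 1" and eq: "balanced_disc r z = symm a a"
  shows "z = 1 \<or> z = -1"
proof -
  define D where "D = 1 - complex_of_real r * z\<^sup>2"
  have D: "D \<noteq> 0" using balanced_disc_denom[of r z] r z by (simp add: D_def)
  have s: "balanced_disc r z $ 1 * D = 2 * (1 - of_real r) * z"
  and p: "balanced_disc r z $ 2 * D = z\<^sup>2 - of_real r"
    using D by (simp_all add: balanced_disc_nth D_def[symmetric])
  have "balanced_disc r z $ 1 * balanced_disc r z $ 1 = 4 * balanced_disc r z $ 2" unfolding eq by simp
  then have "(balanced_disc r z $ 1 * D) * (balanced_disc r z $ 1 * D) = 4 * (balanced_disc r z $ 2 * D) * D" by algebra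
  then have "(2 * (1 - of_real r) * z) * (2 * (1 - of_real r) * z) = 4 * (z\<^sup>2 - of_real r) * D"
    unfolding s p .
  then have "of_real r * ((z - 1) * (z + 1))\<^sup>2 = 0" unfolding D_def by algebra
  then have "(z - 1) * (z + 1) = 0" using r by simp
  then show ?thesis by (simp add: eq_neg_iff_add_eq_0)
qed

lemma balanced_disc_nodes:
  assumes "r < 1" shows "balanced_disc r 1 = symm 1 1" "balanced_disc r (-1) = symm (-1) (-1)"
proof -
  have "1 - complex_of_real r \<noteq> 0" using assms
    by (metis eq_iff_diff_eq_0 less_irrefl of_real_1 of_real_eq_iff)
  then show "balanced_disc r 1 = symm 1 1" "balanced_disc r (-1) = symm (-1) (-1)"
    by (auto intro!: vec2_eqI simp: balanced_disc_nth field_simps)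
qed

text \<open>The induced map and the Moebius map extend to the closures, where the Moebius map is injective;
  so points of the image of the balanced disc are diagonal only if the original ones are.\<close>
lemma purely_balanced_balanced_disc:
  assumes r: "0 < r" "r < 1" and AB: "cmod B < cmod A"
  shows "purely_balanced ((\<lambda>z. lift_mob A B (balanced_disc r z)) ` \<bbbD>)"
proof -
  let ?g = "\<lambda>z. lift_mob A B (balanced_disc r z)"
  have r0: "0 \<le> r" using r by simp
  have "continuous_on (cball 0 1) ?g"
    by (rule continuous_on_compose2[OF lift_mob_continuous[OF AB] balanced_disc_closed[OF r0 r(2)]])
  note cl = closure_image_ball[OF this]
  have ends: "?g 1 = symm (mob A B 1) (mob A B 1)" "?g (-1) = symm (mob A B (-1)) (mob A B (-1))"
    unfolding balanced_disc_nodes[OF r(2)] by (rule lift_mob_symm[OF AB]; simp)+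
  have inter: "closure (?g ` \<bbbD>) \<inter> closure royal = {?g 1, ?g (-1)}"
  proof
    show "closure (?g ` \<bbbD>) \<inter> closure royal \<subseteq> {?g 1, ?g (-1)}"
    proof
      fix y assume y: "y \<in> closure (?g ` \<bbbD>) \<inter> closure royal"
      then have "y \<in> ?g ` cball 0 1" "y \<in> (\<lambda>z. symm z z) ` cball 0 1"
        unfolding cl closure_royal by simp_all
      then obtain z w where zw: "z \<in> cball 0 1" "y = ?g z" and w: "y = symm w w" by (elim imageE)
      then have z: "cmod z \<le> 1" "y = ?g z" by simp_all
      have "balanced_disc r z \<in> closed_symm_bidisc" using balanced_disc_closed(2)[OF r0 r(2)] zw(1)
        by (rule subsetD[OF _ imageI])
      then obtain a b where ab: "cmod a \<le> 1" "cmod b \<le> 1" "balanced_disc r z = symm a b"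
        unfolding mem_closed_symm_bidisc by (elim exE conjE)
      have "symm (mob A B a) (mob A B b) = ?g z" unfolding ab(3)
        by (rule lift_mob_symm[OF AB ab(1,2), symmetric])
      also have "\<dots> = symm w w" using zw(2) w by (rule trans[OF sym])
      finally have "mob A B a = w" "mob A B b = w" by (simp_all add: symm_diagonal)
      have "a = mob (cnj A) (- B) (mob A B a)" by (rule mob_inverse[OF AB ab(1), symmetric])
      also have "\<dots> = mob (cnj A) (- B) (mob A B b)"
        unfolding \<open>mob A B a = w\<close> \<open>mob A B b = w\<close> ..
      also have "\<dots> = b" by (rule mob_inverse[OF AB ab(2)])
      finally have "a = b" .
      then have "z = 1 \<or> z = -1" using balanced_disc_royal_node[OF r z(1), of a] ab(3) by simp
      then show "y \<in> {?g 1, ?g (-1)}" unfolding zw(2) by (elim disjE) simp_all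
    qed
    have "?g 1 \<in> closure royal" "?g (-1) \<in> closure royal"
      unfolding ends closure_royal by (rule imageI, use mob_norm(3)[OF AB] in simp)+
    moreover have "?g 1 \<in> closure (?g ` \<bbbD>)" "?g (-1) \<in> closure (?g ` \<bbbD>)"
      unfolding cl by (rule imageI, simp)+
    ultimately show "{?g 1, ?g (-1)} \<subseteq> closure (?g ` \<bbbD>) \<inter> closure royal" by simp
  qed
  have "?g 1 \<noteq> ?g (-1)"
  proof
    assume "?g 1 = ?g (-1)"
    from symm_diagonal[OF this[unfolded ends]] have "mob A B 1 = mob A B (-1)" by simp
    then have "mob (cnj A) (- B) (mob A B 1) = mob (cnj A) (- B) (mob A B (-1))" by (rule arg_cong)
    also have "\<dots> = -1" by (rule mob_inverse[OF AB]) simp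
    finally show False using mob_inverse[OF AB, of 1] by simp
  qed
  then have card: "card (closure (?g ` \<bbbD>) \<inter> closure royal) = 2" unfolding inter by simp
  have bd: "symm z z \<in> royal_boundary" if "cmod z = 1" for z
  proof -
    have "symm z z = vector [2 * z, z\<^sup>2]" by (rule vec2_eqI) (simp_all add: power2_eq_square)
    then show ?thesis unfolding royal_boundary_def using that by (intro CollectI exI[of _ z]) simp
  qed
  have "closure (?g ` \<bbbD>) \<inter> closure royal \<subseteq> royal_boundary"
    unfolding inter ends using bd mob_norm(2)[OF AB] by simp
  moreover have "geodesic (?g ` \<bbbD>)"
    unfolding geodesic_def
    by (intro exI conjI) (rule geodesic_map_aut[OF geodesic_map_balanced_disc[OF r0 r(2)] aut_pair_lift_mob[OF AB]], rule refl)
  ultimately show ?thesis unfolding purely_balanced_def using card by simp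
qed

text \<open>Existence and uniqueness are transported from \<open>(0, -r)\<close>: the inverse automorphism takes a
  geodesic through the image point in the sharp direction to one through \<open>(0, -r)\<close> in the
  direction \<open>(1, 0)\<close>.\<close>
lemma geodesic_through_sharp:
  assumes r: "0 < r" "r < 1" and AB: "cmod B < cmod A"
  shows "geodesic_through (lift_mob A B (axis_point r)) (sharp (lift_mob A B (axis_point r))) = (\<lambda>z. lift_mob A B (balanced_disc r z)) ` \<bbbD>"
proof -
  let ?g = "\<lambda>z. lift_mob A B (balanced_disc r z)" and ?\<mu> = "lift_mob A B (axis_point r)"
  and ?u = "vector [1, 0] :: complex^2"
  have r0: "0 \<le> r" using r by simp
  note S = aut_pair_lift_mob[OF AB]
  have x: "axis_point r \<in> symm_bidisc" by (rule axis_point_mem[OF r0 r(2)])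
  have \<mu>: "?\<mu> \<in> symm_bidisc" by (rule aut_pairD(1)[OF S x])
  have inv_mu: "lift_mob (cnj A) (- B) ?\<mu> = axis_point r" by (rule aut_pairD(3)[OF S x])
  obtain M where M: "(lift_mob A B has_derivative (\<lambda>v. M *v v)) (at (axis_point r))"
    using aut_pairD(5)[OF S x] by auto
  obtain N where N: "(lift_mob (cnj A) (- B) has_derivative (\<lambda>v. N *v v)) (at ?\<mu>)"
    using aut_pairD(6)[OF S \<mu>] by auto
  have NM: "N *v (M *v v) = v" for v by (rule aut_pair_deriv_inverse[OF S x M N])
  have sh: "sharp ?\<mu> = cline (M *v ?u)"
    by (rule sharp_dir_sharp[OF sharp_dir_lift_mob[OF AB x M sharp_dir_axis_point[OF r]]])
  have g: "geodesic_map ?g" by (rule geodesic_map_aut[OF geodesic_map_balanced_disc[OF r0 r(2)] S])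
  have g0: "?g 0 = ?\<mu>" by (simp add: balanced_disc_0)
  show ?thesis
    unfolding geodesic_through_def
  proof (rule the_equality, intro conjI)
    show "geodesic (?g ` \<bbbD>)" unfolding geodesic_def using g by (intro exI[of _ ?g]) simp
    show "?\<mu> \<in> ?g ` \<bbbD>" unfolding g0[symmetric] by (rule imageI) simp
    have "disc_deriv ?g 0 (M *v vector [2 * (1 - of_real r), 0])"
      by (rule map_disc_deriv[OF _ balanced_disc_deriv]) (simp add: balanced_disc_0 M)
    then have "geodesic_tangent (?g ` \<bbbD>) (?g 0) = cline (M *v vector [2 * (1 - of_real r), 0])"
      by (intro geodesic_tangent_eq[OF g]) simp_all
    also have "vector [2 * (1 - of_real r), 0] = (2 * (1 - of_real r)) *s ?u" by (rule vec2_eqI) simp_all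
    also have "M *v \<dots> = (2 * (1 - of_real r)) *s (M *v ?u)" by (rule vector_scalar_commute)
    also have "cline \<dots> = cline (M *v ?u)"
    proof (rule cline_scale)
      have "complex_of_real (2 * (1 - r)) \<noteq> 0" using r unfolding of_real_eq_0_iff by simp
      then show "2 * (1 - complex_of_real r) \<noteq> 0" by simp
    qed
    finally show "geodesic_tangent (?g ` \<bbbD>) ?\<mu> = sharp ?\<mu>" unfolding g0 sh .
  next
    fix D assume "geodesic D \<and> ?\<mu> \<in> D \<and> geodesic_tangent D ?\<mu> = sharp ?\<mu>"
    then have D: "geodesic D" "?\<mu> \<in> D" "geodesic_tangent D ?\<mu> = cline (M *v ?u)" using sh
      by simp_all
    obtain k where k: "geodesic_map k" "D = k ` \<bbbD>" using D(1) unfolding geodesic_def by auto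
    obtain z where z: "z \<in> \<bbbD>" "k z = ?\<mu>" using D(2) unfolding k(2) by auto
    have ak: "analytic_disc k" using k(1) unfolding geodesic_map_iff by simp
    obtain d where d: "disc_deriv k z d" using bspec[OF ak[unfolded analytic_disc_def] z(1)] by (elim conjE exE)
    have "cline d = cline (M *v ?u)" using geodesic_tangent_eq[OF k(1) z(1) d] D(3) unfolding k(2) z(2) by simp
    then have "d \<in> cline (M *v ?u)" using cline_self[of d] by simp
    from cline_mult[OF this, of N] have Nd: "N *v d \<in> cline ?u" unfolding NM .
    let ?k = "\<lambda>z. lift_mob (cnj A) (- B) (k z)"
    have gk: "geodesic_map ?k" by (rule geodesic_map_aut[OF k(1) aut_pair_sym[OF S]])
    have dk: "disc_deriv ?k z (N *v d)" by (rule map_disc_deriv[OF _ d]) (simp add: z(2) N)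
    have kz: "?k z = axis_point r" using z(2) inv_mu by simp
    have "?k ` \<bbbD> = balanced_disc r ` \<bbbD>"
    proof (rule geodesic_unique_axis_point[OF r0 r(2)])
      show "geodesic (?k ` \<bbbD>)" unfolding geodesic_def using gk by (intro exI[of _ ?k]) simp
      show "axis_point r \<in> ?k ` \<bbbD>" unfolding kz[symmetric] using z(1) by (rule imageI)
      show "geodesic_tangent (?k ` \<bbbD>) (axis_point r) = cline ?u"
        using geodesic_tangent_eq[OF gk z(1) dk] cline_eqI[OF Nd geodesic_deriv_nonzero[OF gk z(1) dk]]
        unfolding kz by simp
    qed
    then have "lift_mob A B ` ?k ` \<bbbD> = lift_mob A B ` balanced_disc r ` \<bbbD>" by simp
    moreover have "lift_mob A B (?k \<zeta>) = k \<zeta>" if "\<zeta> \<in> \<bbbD>" for \<zeta>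
      using aut_pairD(4)[OF S, of "k \<zeta>"] ak that unfolding analytic_disc_def by simp
    ultimately show "D = ?g ` \<bbbD>" unfolding k(2) image_image by simp
  qed
qed

theorem corollary5p8:
  fixes \<mu> :: "complex^2"
  shows "(\<mu> \<in> royal \<longrightarrow> sharp \<mu> = geodesic_tangent royal \<mu>) \<and>
         (\<mu> \<in> symm_bidisc - royal \<longrightarrow> purely_balanced (geodesic_through \<mu> (sharp \<mu>)))"
proof (intro conjI impI)
  assume "\<mu> \<in> royal"
  then obtain z where z: "cmod z < 1" "\<mu> = symm z z" unfolding royal_iff by auto
  let ?h = "\<lambda>z. vector [2 * z, z\<^sup>2] :: complex^2"
  have h: "?h z = symm z z" for z by (rule vec2_eqI) (simp_all add: power2_eq_square)
  have "royal = ?h ` \<bbbD>" unfolding royal_def by auto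
  moreover have "geodesic_tangent (?h ` \<bbbD>) (?h z) = cline (vector [2, 2 * z])"
    using z(1) by (intro geodesic_tangent_eq[OF geodesic_map_royal _ royal_disc_deriv]) simp
  ultimately show "sharp \<mu> = geodesic_tangent royal \<mu>"
    using sharp_dir_sharp[OF sharp_dir_royal[OF z(1)]] unfolding z(2) h by simp
next
  assume \<mu>: "\<mu> \<in> symm_bidisc - royal"
  then have \<mu>G: "\<mu> \<in> symm_bidisc" by simp
  obtain A B r where n: "cmod B < cmod A" "0 \<le> r" "r < 1" "lift_mob A B \<mu> = axis_point r"
    using normal_form[OF \<mu>G] by auto
  have AB: "cmod (- B) < cmod (cnj A)" using n(1) by simp
  have eq: "\<mu> = lift_mob (cnj A) (- B) (axis_point r)"
    using aut_pairD(3)[OF aut_pair_lift_mob[OF n(1)] \<mu>G] n(4) by simp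
  have "r \<noteq> 0"
  proof
    assume "r = 0"
    then have "axis_point r \<in> royal" using axis_point_royal_iff by simp
    then have "\<mu> \<in> royal" unfolding eq by (rule lift_mob_royal[OF AB])
    then show False using \<mu> by simp
  qed
  then have r: "0 < r" using n(2) by simp
  show "purely_balanced (geodesic_through \<mu> (sharp \<mu>))"
    unfolding eq geodesic_through_sharp[OF r n(3) AB] by (rule purely_balanced_balanced_disc[OF r n(3) AB])
qed

end
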